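(* Let $h\ge 1$, $p_1,\dots,p_h\ge 1$, and for each $n$ let $\{X_{i,n}^j: 1\le i\le p_j,\ 1\le j\le h\}$ be $n\times n$ real symmetric patterned random matrices, where $X_{i,n}^j$ has link function $L_j$ and input sequence $\{X_i^j(t)\}_t$, satisfying Assumptions (A1) and (A2) of the context. Fix a monomial $q$ of length $k$ in these matrices, $$q=X_{t_1}^{c_1}X_{t_2}^{c_2}\cdots X_{t_k}^{c_k},$$ and assume that for all $w\in CW(2)$ the limit $$p_C(w)=\lim_{n\to\infty}\frac{1}{n^{1+k/2}}|\Pi_C^*(w)|$$ exists. Then: (1) for all $w\in CIW(2)$, the limit $p_{CI}(w)=\lim_{n\to\infty}\frac1{n^{1+k/2}}|\Pi^*_{CI}(w)|$ exists and $p_{CI}(w)=p_C(\psi(w))$; (2) $\displaystyle\lim_{n\to\infty}\widehat\mu_n(q)=\sum_{w\in CIW(2)}p_{CI}(w)=:\alpha(q)$, and $$|\alpha(q)|\le \frac{k!\,\Delta^{k/2}}{(k/2)!\,2^{k/2}}$$ if $k$ is even and each of the matrices $X_i^j$ appears an even number of times in $q$, while $\alpha(q)=0$ otherwise; (3) $\lim_{n\to\infty}\widetilde\mu_n(q)=\alpha(q)$ almost surely. As a consequence, if the existence of $p_C(w)$ for all $w\in CW(2)$ holds for every monomial $q$, then $\{\frac1{\sqrt n}X_{i,n}^j: 1\le i\le p_j\}_{1\le j\le h}$ converges jointly with respect to both $\varphi_1$ (almost surely) and $\varphi_2$, and the limit does not depend on the (distributions of the) input sequences.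
   Context: A link function $L$ is, for each $n$ (the dependence on $n$ being suppressed), a symmetric function $L:\{1,\dots,n\}^2\to\mathbb Z^d$, $d\in\{1,2\}$. The patterned matrix with link function $L$ and input sequence $\{x(t)\}$ (real random variables indexed by $\mathbb Z^d$) is the $n\times n$ matrix with $(p,q)$ entry $x(L(p,q))$. There are $h$ link functions ("colors") $L_1,\dots,L_h$, and $p_j$ independent copies ("indices") $X_{1,n}^j,\dots,X_{p_j,n}^j$ of color $j$; the $(p,q)$ entry of $X_{i,n}^j$ is $X_i^j(L_j(p,q))$. The subscript $n$ is often suppressed. (A1) (Property B for all link functions) There is $\Delta<\infty$ with $\max_{1\le j\le h}\sup_{n\ge1}\sup_t\sup_{1\le p\le n}\#\{q:1\le q\le n,\ L_j(p,q)=t\}\le\Delta$. (A2) The input variables $X_i^j(t)$ are real random variables, independent across $i$, $j$ and $t$, with mean $0$, variance $1$ and uniformly bounded moments: for every $k$, $\sup_{i,j}\sup_n\sup_{1\le p,q\le n}E|X_i^j(L_j(p,q))|^k\le c_k<\infty$. For the monomial $q=X_{t_1}^{c_1}\cdots X_{t_k}^{c_k}$ (colors $c_i$, indices $t_i$), put $\widetilde\mu_n(q)=\frac1n\mathrm{Tr}\big[n^{-k/2}X_{t_1,n}^{c_1}\cdots X_{t_k,n}^{c_k}\big]$ and $\widehat\mu_n(q)=E[\widetilde\mu_n(q)]$. A circuit is a map $\pi:\{0,1,\dots,k\}\to\{1,\dots,n\}$ with $\pi(0)=\pi(k)$. $CIW(2)$ is the set of colored and indexed pair-matched words corresponding to $q$: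 words $w=w[1]\cdots w[k]$ (up to renaming of letters) in which each letter appears exactly twice and $w[i]=w[j]$ implies $c_i=c_j$ and $t_i=t_j$. $CW(2)$ is the set of colored pair-matched words corresponding to the monomial $\psi(q)$ obtained from $q$ by dropping the indices: words of length $k$ in which each letter appears exactly twice and $w[i]=w[j]$ implies $c_i=c_j$. Dropping indices gives an injective map $\psi:CIW(2)\to CW(2)$. For such words (dependence on $n$ suppressed), $$\Pi_C^*(w)=\{\pi \text{ circuit}: w[i]=w[j]\Rightarrow c_i=c_j \text{ and } L_{c_i}(\pi(i-1),\pi(i))=L_{c_j}(\pi(j-1),\pi(j))\},$$ $$\Pi_{CI}^*(w)=\{\pi \text{ circuit}: w[i]=w[j]\Rightarrow (c_i,t_i,L_{c_i}(\pi(i-1),\pi(i)))=(c_j,t_j,L_{c_j}(\pi(j-1),\pi(j)))\}.$$ On $n\times n$ random matrices whose entries have all moments, $\varphi_1(A)=\frac1n\mathrm{Tr}(A)$ and $\varphi_2(A)=\frac1nE[\mathrm{Tr}(A)]$. Joint convergence with respect to $\varphi_2$ (resp. $\varphi_1$) means that for every monomial in the matrices, $\varphi_2$ (resp. $\varphi_1$, almost surely) of that monomial converges as $n\to\infty$. *)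

theory Defs
  imports "HOL-Probability.Probability" "Jordan_Normal_Form.Matrix"
begin

section \<open>Link functions and patterned matrices\<close>

text \<open>
  The lattice $Z^d$ is the set of integer lists of length d, so that the dimension d may differ
  from color to color. A family of link functions is
  L :: nat => nat => nat => nat => int list, with L j n p q the value of the color j link function
  of size n at (p, q); only arguments p and q in {1..n} are meaningful.
\<close>

definition lattice :: "nat \<Rightarrow> int list set" where
  "lattice d = {v. length v = d}"

definition link_function :: "nat \<Rightarrow> (nat \<Rightarrow> nat \<Rightarrow> nat \<Rightarrow> int list) \<Rightarrow> bool" where
  "link_function d L \<longleftrightarrow> d \<in> {1, 2} \<and>
     (\<forall>n. \<forall>p\<in>{1..n}. \<forall>q\<in>{1..n}. L n p q \<in> lattice d \<and> L n p q = L n q p)"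

definition assumption_A1 ::
  "nat \<Rightarrow> (nat \<Rightarrow> nat) \<Rightarrow> (nat \<Rightarrow> nat \<Rightarrow> nat \<Rightarrow> nat \<Rightarrow> int list) \<Rightarrow> real \<Rightarrow> bool" where
  "assumption_A1 h d L \<Delta> \<longleftrightarrow>
     (\<forall>j\<in>{1..h}. \<forall>n\<ge>1. \<forall>t\<in>lattice (d j). \<forall>p\<in>{1..n}.
        real (card {q \<in> {1..n}. L j n p q = t}) \<le> \<Delta>)"

text \<open>
  X j i t is the input variable with color j, index i (the i-th copy) and lattice point t.
  Integrability is required explicitly, since the Bochner integral of a non-integrable function
  is 0.
\<close>

definition assumption_A2 ::
  "'a measure \<Rightarrow> nat \<Rightarrow> (nat \<Rightarrow> nat) \<Rightarrow> (nat \<Rightarrow> nat) \<Rightarrow> (nat \<Rightarrow> nat \<Rightarrow> nat \<Rightarrow> nat \<Rightarrow> int list) \<Rightarrow>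
   (nat \<Rightarrow> nat \<Rightarrow> int list \<Rightarrow> 'a \<Rightarrow> real) \<Rightarrow> bool" where
  "assumption_A2 M h p d L X \<longleftrightarrow>
     prob_space.indep_vars M (\<lambda>_. borel) (\<lambda>(j, i, t). X j i t)
       {(j, i, t). j \<in> {1..h} \<and> i \<in> {1..p j} \<and> t \<in> lattice (d j)} \<and>
     (\<forall>j\<in>{1..h}. \<forall>i\<in>{1..p j}. \<forall>t\<in>lattice (d j).
        integrable M (X j i t) \<and> prob_space.expectation M (X j i t) = 0 \<and>
        integrable M (\<lambda>\<omega>. (X j i t \<omega>)\<^sup>2) \<and> prob_space.variance M (X j i t) = 1) \<and>
     (\<exists>c :: nat \<Rightarrow> real. \<forall>k. \<forall>j\<in>{1..h}. \<forall>i\<in>{1..p j}. \<forall>n\<ge>1. \<forall>a\<in>{1..n}. \<forall>b\<in>{1..n}.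
        integrable M (\<lambda>\<omega>. \<bar>X j i (L j n a b) \<omega>\<bar> ^ k) \<and>
        prob_space.expectation M (\<lambda>\<omega>. \<bar>X j i (L j n a b) \<omega>\<bar> ^ k) \<le> c k)"

text \<open>The shift by 1 is due to the library matrices being indexed from 0.\<close>

definition patterned_mat ::
  "nat \<Rightarrow> (nat \<Rightarrow> nat \<Rightarrow> int list) \<Rightarrow> (int list \<Rightarrow> real) \<Rightarrow> real mat" where
  "patterned_mat n L x = Matrix.mat n n (\<lambda>(a, b). x (L (a + 1) (b + 1)))"

definition mat_trace :: "real mat \<Rightarrow> real" where
  "mat_trace A = (\<Sum>i<dim_row A. A $$ (i, i))"

definition mat_list_prod :: "nat \<Rightarrow> real mat list \<Rightarrow> real mat" where
  "mat_list_prod n As = foldr (*) As (1\<^sub>m n)"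

definition phi1 :: "nat \<Rightarrow> real mat \<Rightarrow> real" where
  "phi1 n A = 1 / real n * mat_trace A"

definition phi2 :: "'a measure \<Rightarrow> nat \<Rightarrow> ('a \<Rightarrow> real mat) \<Rightarrow> real" where
  "phi2 M n A = 1 / real n * prob_space.expectation M (\<lambda>\<omega>. mat_trace (A \<omega>))"


section \<open>Monomials\<close>

text \<open>
  A monomial is the list of its (color, index) pairs from left to right.
\<close>

definition monomials :: "nat \<Rightarrow> (nat \<Rightarrow> nat) \<Rightarrow> (nat \<times> nat) list set" where
  "monomials h p = {q. \<forall>(j, i)\<in>set q. j \<in> {1..h} \<and> i \<in> {1..p j}}"

definition X_mat ::
  "(nat \<Rightarrow> nat \<Rightarrow> nat \<Rightarrow> nat \<Rightarrow> int list) \<Rightarrow> (nat \<Rightarrow> nat \<Rightarrow> int list \<Rightarrow> 'a \<Rightarrow> real) \<Rightarrow>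
   nat \<Rightarrow> 'a \<Rightarrow> nat \<times> nat \<Rightarrow> real mat" where
  "X_mat L X n \<omega> = (\<lambda>(j, i). patterned_mat n (L j n) (\<lambda>t. X j i t \<omega>))"

definition mu_tilde ::
  "(nat \<Rightarrow> nat \<Rightarrow> nat \<Rightarrow> nat \<Rightarrow> int list) \<Rightarrow> (nat \<Rightarrow> nat \<Rightarrow> int list \<Rightarrow> 'a \<Rightarrow> real) \<Rightarrow>
   (nat \<times> nat) list \<Rightarrow> nat \<Rightarrow> 'a \<Rightarrow> real" where
  "mu_tilde L X q n \<omega> =
     1 / real n * mat_trace
       ((real n powr (- (real (length q) / 2))) \<cdot>\<^sub>m mat_list_prod n (map (X_mat L X n \<omega>) q))"

definition mu_hat ::
  "'a measure \<Rightarrow> (nat \<Rightarrow> nat \<Rightarrow> nat \<Rightarrow> nat \<Rightarrow> int list) \<Rightarrow> (nat \<Rightarrow> nat \<Rightarrow> int list \<Rightarrow> 'a \<Rightarrow> real) \<Rightarrow>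
   (nat \<times> nat) list \<Rightarrow> nat \<Rightarrow> real" where
  "mu_hat M L X q n = prob_space.expectation M (mu_tilde L X q n)"


section \<open>Pair-matched words\<close>

text \<open>
  Words up to renaming of letters are represented by their normal forms, in which the letters
  are 0, 1, 2, ... in the order of their first appearance. See ex1_normal_word below.
\<close>

definition normal_word :: "nat list \<Rightarrow> bool" where
  "normal_word w \<longleftrightarrow>
     (\<forall>i<length w. w ! i \<in> set (take i w) \<or> w ! i = card (set (take i w)))"

lemma normal_word_snoc:
  "normal_word (w @ [a]) \<longleftrightarrow> normal_word w \<and> (a \<in> set w \<or> a = card (set w))"
  by (simp add: normal_word_def nth_append All_less_Suc conj_commute)

lemma set_normal_word: "normal_word w \<Longrightarrow> set w = {..<card (set w)}"
proof (induction w rule: rev_induct)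
  case (snoc a w)
  have nw: "normal_word w" and n: "a \<in> set w \<or> a = card (set w)"
    using snoc.prems by (simp_all add: normal_word_snoc)
  obtain m where s: "set w = {..<m}" using snoc.IH[OF nw] ..
  have "a < m \<or> a = m" using n s by simp
  then have "set (w @ [a]) = {..<m} \<or> set (w @ [a]) = {..<Suc m}"
  proof
    assume "a < m"
    then show ?thesis using s by (simp add: insert_absorb)
  next
    assume "a = m"
    then show ?thesis using s by (simp add: lessThan_Suc)
  qed
  then show ?case
  proof
    assume *: "set (w @ [a]) = {..<m}"
    show ?thesis unfolding * by simp
  next
    assume *: "set (w @ [a]) = {..<Suc m}"
    show ?thesis unfolding * by simp
  qed
qed simp

lemma ex1_normal_word:
  fixes u :: "'b list"
  shows "\<exists>!w. normal_word w \<and> (\<exists>f. inj_on f (set u) \<and> w = map f u)"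
proof (induction u rule: rev_induct)
  case Nil
  then show ?case by (auto simp: normal_word_def)
next
  case (snoc a u)
  then obtain w f where w: "normal_word w" "inj_on f (set u)" "w = map f u"
    and uniq: "\<And>w' f'. normal_word w' \<Longrightarrow> inj_on f' (set u) \<Longrightarrow> w' = map f' u \<Longrightarrow> w' = w"
    by (elim ex1E conjE exE) metis
  obtain m where sw: "set w = {..<m}" using set_normal_word[OF w(1)] ..
  define g where "g = (if a \<in> set u then f else f(a := card (set w)))"
  have gu: "map g u = w" using w(3) by (auto simp: g_def)
  have new: "card (set w) \<notin> set w" by (simp add: sw)
  have ginj: "inj_on g (set (u @ [a]))"
  proof (cases "a \<in> set u")
    case True
    then show ?thesis using w(2) by (simp add: g_def insert_absorb)
  next
    case False
    have "inj_on g (set u)"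
      using w(2) False by (auto simp: g_def inj_on_def)
    moreover have "g a \<notin> g ` set u"
    proof -
      have "g a = card (set w)" using False by (simp add: g_def)
      moreover have "g ` set u = set w" by (simp flip: gu)
      ultimately show ?thesis using new by simp
    qed
    ultimately show ?thesis by (auto simp: inj_on_insert False)
  qed
  have gn: "normal_word (map g (u @ [a]))"
  proof -
    have "map g (u @ [a]) = w @ [g a]" by (simp add: gu)
    moreover have "g a \<in> set w \<or> g a = card (set w)"
      using w(3) by (cases "a \<in> set u") (simp_all add: g_def)
    ultimately show ?thesis using w(1) by (simp add: normal_word_snoc)
  qed
  show ?case
  proof (rule ex1I[of _ "map g (u @ [a])"])
    show "normal_word (map g (u @ [a])) \<and>
      (\<exists>f. inj_on f (set (u @ [a])) \<and> map g (u @ [a]) = map f (u @ [a]))"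
      using gn ginj by blast
  next
    fix v assume "normal_word v \<and> (\<exists>f. inj_on f (set (u @ [a])) \<and> v = map f (u @ [a]))"
    then obtain f' where v: "normal_word v" "inj_on f' (set (u @ [a]))" "v = map f' (u @ [a])"
      by blast
    have nv: "normal_word (map f' u)" "f' a \<in> set (map f' u) \<or> f' a = card (set (map f' u))"
      using v(1,3) normal_word_snoc[of "map f' u" "f' a"] by simp_all
    have inj': "inj_on f' (set u)" using v(2) by (auto simp: inj_on_def)
    have e: "map f' u = map g u" using uniq[OF nv(1) inj' refl] gu by simp
    have "f' a = g a"
    proof (cases "a \<in> set u")
      case True
      then show ?thesis using e by simp
    next
      case False
      then have "f' a \<notin> f' ` set u" using v(2) by (auto simp: inj_on_def)
      then have "f' a = card (set (map f' u))" using nv(2) by auto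
      also have "\<dots> = card (set w)" unfolding e gu ..
      finally show ?thesis using False by (simp add: g_def)
    qed
    then show "v = map g (u @ [a])" using v(3) e by simp
  qed
qed

definition pair_matched :: "nat list \<Rightarrow> bool" where
  "pair_matched w \<longleftrightarrow> (\<forall>a\<in>set w. count_list w a = 2)"

definition compatible :: "'c list \<Rightarrow> nat list \<Rightarrow> bool" where
  "compatible cs w \<longleftrightarrow> length w = length cs \<and>
     (\<forall>i<length w. \<forall>j<length w. w ! i = w ! j \<longrightarrow> cs ! i = cs ! j)"

definition CIW2 :: "(nat \<times> nat) list \<Rightarrow> nat list set" where
  "CIW2 q = {w. normal_word w \<and> pair_matched w \<and> compatible q w}"

definition CW2 :: "nat list \<Rightarrow> nat list set" where
  "CW2 cs = {w. normal_word w \<and> pair_matched w \<and> compatible cs w}"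

text \<open>
  The map psi drops the indices of a monomial. As a word does not record colors and indices
  itself, the induced map from CIW2 q to CW2 (psi q) leaves the word unchanged, i.e. it is the
  inclusion CIW2_subset_CW2.
\<close>

definition psi :: "(nat \<times> nat) list \<Rightarrow> nat list" where
  "psi q = map fst q"

lemma CIW2_subset_CW2: "CIW2 q \<subseteq> CW2 (psi q)"
proof
  fix w assume "w \<in> CIW2 q"
  then have w: "normal_word w" "pair_matched w" "compatible q w"
    by (simp_all add: CIW2_def)
  from w(3) have "compatible (psi q) w"
    unfolding compatible_def psi_def by (metis length_map nth_map)
  with w show "w \<in> CW2 (psi q)" by (simp add: CW2_def)
qed

lemma finite_CW2: "finite (CW2 cs)"
proof (rule finite_subset)
  show "CW2 cs \<subseteq> {w. set w \<subseteq> {..<length cs} \<and> length w = length cs}"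
  proof
    fix w assume "w \<in> CW2 cs"
    then have w: "normal_word w" "length w = length cs"
      unfolding CW2_def compatible_def by blast+
    have "card (set w) \<le> length cs" using card_length[of w] w(2) by simp
    then have "{..<card (set w)} \<subseteq> {..<length cs}" by simp
    with set_normal_word[OF w(1)] have "set w \<subseteq> {..<length cs}" by (rule ord_eq_le_trans)
    with w(2) show "w \<in> {w. set w \<subseteq> {..<length cs} \<and> length w = length cs}" by simp
  qed
  show "finite {w. set w \<subseteq> {..<length cs} \<and> length w = length cs}"
    by (rule finite_lists_length_eq) simp
qed

lemma finite_CIW2: "finite (CIW2 q)"
  using CIW2_subset_CW2 finite_CW2 by (rule finite_subset)


section \<open>Circuits and the limits of their normalized counts\<close>

definition circuits :: "nat \<Rightarrow> nat \<Rightarrow> (nat \<Rightarrow> nat) set" where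
  "circuits k n = {\<pi> \<in> {0..k} \<rightarrow>\<^sub>E {1..n}. \<pi> 0 = \<pi> k}"

text \<open>
  Positions in lists start at 0: the letter w[i + 1] is w ! i, and it is attached to the step
  from \<open>\<pi> i\<close> to \<open>\<pi> (i + 1)\<close>.
\<close>

definition Pi_C ::
  "(nat \<Rightarrow> nat \<Rightarrow> nat \<Rightarrow> nat \<Rightarrow> int list) \<Rightarrow> nat list \<Rightarrow> nat list \<Rightarrow> nat \<Rightarrow> (nat \<Rightarrow> nat) set" where
  "Pi_C L cs w n = {\<pi> \<in> circuits (length cs) n.
     \<forall>i<length cs. \<forall>j<length cs. w ! i = w ! j \<longrightarrow>
       cs ! i = cs ! j \<and>
       L (cs ! i) n (\<pi> i) (\<pi> (i + 1)) = L (cs ! j) n (\<pi> j) (\<pi> (j + 1))}"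

definition Pi_CI ::
  "(nat \<Rightarrow> nat \<Rightarrow> nat \<Rightarrow> nat \<Rightarrow> int list) \<Rightarrow> (nat \<times> nat) list \<Rightarrow> nat list \<Rightarrow> nat \<Rightarrow>
   (nat \<Rightarrow> nat) set" where
  "Pi_CI L q w n = {\<pi> \<in> circuits (length q) n.
     \<forall>i<length q. \<forall>j<length q. w ! i = w ! j \<longrightarrow>
       (fst (q ! i), snd (q ! i), L (fst (q ! i)) n (\<pi> i) (\<pi> (i + 1))) =
       (fst (q ! j), snd (q ! j), L (fst (q ! j)) n (\<pi> j) (\<pi> (j + 1)))}"

definition p_C_seq ::
  "(nat \<Rightarrow> nat \<Rightarrow> nat \<Rightarrow> nat \<Rightarrow> int list) \<Rightarrow> nat list \<Rightarrow> nat list \<Rightarrow> nat \<Rightarrow> real" where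
  "p_C_seq L cs w n = 1 / real n powr (1 + real (length cs) / 2) * real (card (Pi_C L cs w n))"

definition p_CI_seq ::
  "(nat \<Rightarrow> nat \<Rightarrow> nat \<Rightarrow> nat \<Rightarrow> int list) \<Rightarrow> (nat \<times> nat) list \<Rightarrow> nat list \<Rightarrow> nat \<Rightarrow> real" where
  "p_CI_seq L q w n = 1 / real n powr (1 + real (length q) / 2) * real (card (Pi_CI L q w n))"

definition p_C :: "(nat \<Rightarrow> nat \<Rightarrow> nat \<Rightarrow> nat \<Rightarrow> int list) \<Rightarrow> nat list \<Rightarrow> nat list \<Rightarrow> real" where
  "p_C L cs w = lim (p_C_seq L cs w)"

definition p_CI ::
  "(nat \<Rightarrow> nat \<Rightarrow> nat \<Rightarrow> nat \<Rightarrow> int list) \<Rightarrow> (nat \<times> nat) list \<Rightarrow> nat list \<Rightarrow> real" where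
  "p_CI L q w = lim (p_CI_seq L q w)"

definition p_C_exists ::
  "(nat \<Rightarrow> nat \<Rightarrow> nat \<Rightarrow> nat \<Rightarrow> int list) \<Rightarrow> (nat \<times> nat) list \<Rightarrow> bool" where
  "p_C_exists L q \<longleftrightarrow> (\<forall>w\<in>CW2 (psi q). convergent (p_C_seq L (psi q) w))"

definition alpha ::
  "(nat \<Rightarrow> nat \<Rightarrow> nat \<Rightarrow> nat \<Rightarrow> int list) \<Rightarrow> (nat \<times> nat) list \<Rightarrow> real" where
  "alpha L q = (\<Sum>w\<in>CIW2 q. p_CI L q w)"


section \<open>Joint convergence\<close>

definition scaled_monomial ::
  "(nat \<Rightarrow> nat \<Rightarrow> nat \<Rightarrow> nat \<Rightarrow> int list) \<Rightarrow> (nat \<Rightarrow> nat \<Rightarrow> int list \<Rightarrow> 'a \<Rightarrow> real) \<Rightarrow>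
   (nat \<times> nat) list \<Rightarrow> nat \<Rightarrow> 'a \<Rightarrow> real mat" where
  "scaled_monomial L X q n \<omega> =
     mat_list_prod n (map (\<lambda>m. (1 / sqrt (real n)) \<cdot>\<^sub>m X_mat L X n \<omega> m) q)"

text \<open>Joint convergence of the matrices X_mat scaled by 1 / sqrt n, with limit functional a.\<close>

definition converges_jointly_phi1_as ::
  "'a measure \<Rightarrow> nat \<Rightarrow> (nat \<Rightarrow> nat) \<Rightarrow> (nat \<Rightarrow> nat \<Rightarrow> nat \<Rightarrow> nat \<Rightarrow> int list) \<Rightarrow>
   (nat \<Rightarrow> nat \<Rightarrow> int list \<Rightarrow> 'a \<Rightarrow> real) \<Rightarrow> ((nat \<times> nat) list \<Rightarrow> real) \<Rightarrow> bool" where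
  "converges_jointly_phi1_as M h p L X a \<longleftrightarrow>
     (\<forall>q\<in>monomials h p. AE \<omega> in M. (\<lambda>n. phi1 n (scaled_monomial L X q n \<omega>)) \<longlonglongrightarrow> a q)"

definition converges_jointly_phi2 ::
  "'a measure \<Rightarrow> nat \<Rightarrow> (nat \<Rightarrow> nat) \<Rightarrow> (nat \<Rightarrow> nat \<Rightarrow> nat \<Rightarrow> nat \<Rightarrow> int list) \<Rightarrow>
   (nat \<Rightarrow> nat \<Rightarrow> int list \<Rightarrow> 'a \<Rightarrow> real) \<Rightarrow> ((nat \<times> nat) list \<Rightarrow> real) \<Rightarrow> bool" where
  "converges_jointly_phi2 M h p L X a \<longleftrightarrow>
     (\<forall>q\<in>monomials h p. (\<lambda>n. phi2 M n (scaled_monomial L X q n)) \<longlonglongrightarrow> a q)"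

end

theory Submission
  imports Defs "HOL-Combinatorics.Multiset_Permutations"
begin

text \<open>
  Expanding the trace writes a monomial as a sum over circuits $\pi$ of products of input variables,
  whose expectation vanishes as soon as some label (color, index, lattice point) occurs only once
  along $\pi$. Circuits with at most m distinct labels are $O(n^{m+1})$ in number, so only the circuits
  whose labels are exactly paired survive in the limit, and each of those belongs to a unique
  pair-matched word.

  For the almost sure statement it suffices that the centered fourth moment is $O(n^{-2})$. It is a sum
  over quadruples of circuits, to which a quadruple contributes only if no label occurs just once and
  every circuit shares a label with another one. A circuit is closed, so one of its steps comes for free:
  if a circuit has a label that is new and occurs in it once, it can be cut there, which saves a
  factor n. Every contributing quadruple either allows two such savings or has correspondingly
  fewer distinct labels.
\<close>

section \<open>Words and multisets of labels\<close>

text \<open>The second moment would not do: two linked circuits guarantee only one saving, so the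
  same count gives a variance of order 1/n, which is not summable. Four circuits give two savings.

  Circuits are not counted class by class. Each one gets the weight n^(-r), with r the number of its
  labels outside a set \<open>K\<close>. The sum of these weights has a bound that does not refer to
  the shape of the circuits, and bounds for several circuits multiply when \<open>K\<close> collects
  the labels of the circuits placed earlier; this is why \<open>K\<close> runs through the counting
  lemmas. Cardinalities come back at the end because n^m times n^(-r) is at least 1 for r at most m.

  The counting works for an arbitrary labelling of steps in which the current vertex and a
  prescribed label leave at most \<Delta> choices for the next vertex. Property B enters in this
  forward form, so a circuit is cut by rotating it, which keeps the direction of travel.\<close>

definition has_fresh_single :: "'l set \<Rightarrow> 'l multiset \<Rightarrow> bool" where
  "has_fresh_single K A \<longleftrightarrow> (\<exists>x. count A x = 1 \<and> x \<notin> K)"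

text \<open>The two conjuncts negate the two reasons for which a centered factor with labels
  \<open>A\<close> has zero expectation against factors with labels \<open>R\<close>: independence
  of the rest, or a mean-zero variable that occurs only once in total.\<close>

definition linked :: "'l multiset \<Rightarrow> 'l multiset \<Rightarrow> bool" where
  "linked A R \<longleftrightarrow> set_mset A \<inter> set_mset R \<noteq> {} \<and> (\<forall>x. count A x = 1 \<longrightarrow> x \<in># R)"

text \<open>Two units of multiplicity beyond 2 cost one distinct label; the size being fixed, lower
  bounds on the excess become upper bounds on the number of labels.\<close>

lemma excess_sum:
  fixes U :: "'l multiset"
  assumes "\<And>x. x \<in># U \<Longrightarrow> count U x \<ge> 2"
  shows "2 * card (set_mset U) + (\<Sum>x\<in>set_mset U. count U x - 2) = size U"
proof -
  have "size U = (\<Sum>x\<in>set_mset U. 2 + (count U x - 2))"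
    unfolding size_multiset_overloaded_eq by (intro sum.cong refl) (use assms in fastforce)
  also have "\<dots> = 2 * card (set_mset U) + (\<Sum>x\<in>set_mset U. count U x - 2)"
    by (subst sum.distrib) simp
  finally show ?thesis by simp
qed

text \<open>
  In each alternative the number of labels missing from 2k plus the number of available cuts is at
  least two. If no circuit contains a label exactly once, then a shared label is repeated within every
  circuit containing it, so it has multiplicity at least 4.
\<close>
lemma linked_quadruple_cases:
  fixes A B C D :: "'l multiset"
  assumes size: "size (A + B + C + D) = 4 * k"
    and A: "linked A (B + C + D)" and B: "linked B (A + C + D)"
    and C: "linked C (A + B + D)" and D: "linked D (A + B + C)"
  defines "m \<equiv> card (set_mset (A + B + C + D))"
  shows "m + 2 \<le> 2 * k \<or>
     m + 1 \<le> 2 * k \<and> (\<exists>E\<in>{A, B, C, D}. has_fresh_single {} E) \<or>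
     m \<le> 2 * k \<and> (has_fresh_single {} A \<and> has_fresh_single (set_mset A) B \<or>
                    has_fresh_single {} C \<and> has_fresh_single (set_mset C) B)"
proof -
  define U where "U = A + B + C + D"
  \<comment> \<open>A label of total multiplicity 1 is single in one multiset and absent from the
    other three, which the second conjunct of \<open>linked\<close> forbids.\<close>
  have U2: "count U x \<ge> 2" if "x \<in># U" for x
  proof (rule ccontr)
    assume "\<not> count U x \<ge> 2"
    with that have "count A x + count B x + count C x + count D x = 1"
      by (simp add: U_def flip: count_greater_zero_iff) linarith
    then consider "count A x = 1" "count B x = 0" "count C x = 0" "count D x = 0"
      | "count B x = 1" "count A x = 0" "count C x = 0" "count D x = 0"
      | "count C x = 1" "count B x = 0" "count A x = 0" "count D x = 0"
      | "count D x = 1" "count B x = 0" "count C x = 0" "count A x = 0"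
      by linarith
    then show False using A B C D unfolding linked_def
      by cases (auto simp: count_eq_zero_iff)
  qed
  have excess: "2 * m + (\<Sum>x\<in>set_mset U. count U x - 2) = 4 * k"
    using excess_sum[of U] U2 size by (simp add: m_def U_def)
  have le: "m \<le> 2 * k" using excess by linarith
  have exc_ge: "count U x - 2 \<le> (\<Sum>x\<in>set_mset U. count U x - 2)" if "x \<in># U" for x
    using that by (intro member_le_sum) auto
  show ?thesis
  proof (cases "\<forall>x\<in>#U. count U x = 2")
    case True
    \<comment> \<open>The second cut is made in \<open>B\<close> at \<open>x\<close>. Its other
      occurrence lies in just one of the other multisets, so \<open>A\<close> or \<open>C\<close>
      avoids \<open>x\<close>; whichever does is placed first and is cut at a single label of its
      own.\<close>
    obtain x where x: "x \<in># B" "x \<in># A + C + D" using B by (auto simp: linked_def)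
    have "x \<in># U" using x by (simp add: U_def)
    then have c2: "count A x + count B x + count C x + count D x = 2" using True by (simp add: U_def)
    have Bx: "count B x = 1"
      using x c2 by (auto simp flip: count_greater_zero_iff)
    have single: "has_fresh_single {} E" if ER: "linked E R" "E + R = U" for E R
    proof -
      obtain y where y: "y \<in># E" "y \<in># R" using ER(1) by (auto simp: linked_def)
      then have "count E y + count R y = 2" using True ER(2) by (metis count_union union_iff)
      then have "count E y = 1" using y by (auto simp flip: count_greater_zero_iff)
      then show ?thesis by (auto simp: has_fresh_single_def)
    qed
    show ?thesis
    proof (cases "x \<in># A")
      case False
      have "has_fresh_single {} A" using single[OF A] by (simp add: U_def add_ac)
      moreover have "has_fresh_single (set_mset A) B"
        using False Bx by (auto simp: has_fresh_single_def)
      ultimately show ?thesis using le by blast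
    next
      case True
      then have "x \<notin># C" using c2 Bx x
        by (auto simp flip: count_greater_zero_iff count_eq_zero_iff)
      then have "has_fresh_single (set_mset C) B"
        using Bx by (auto simp: has_fresh_single_def)
      moreover have "has_fresh_single {} C" using single[OF C] by (simp add: U_def add_ac)
      ultimately show ?thesis using le by blast
    qed
  next
    case False
    then obtain x where "x \<in># U" "count U x \<noteq> 2" by blast
    then have "count U x - 2 \<ge> 1" using U2[of x] by linarith
    \<comment> \<open>Since \<open>2 * m\<close> plus the excess is \<open>4 * k\<close>, the excess
      is even, and one surplus unit already costs a whole label.\<close>
    then have m1: "m + 1 \<le> 2 * k" using exc_ge[OF \<open>x \<in># U\<close>] excess by linarith
    show ?thesis
    proof (cases "\<exists>E\<in>{A, B, C, D}. has_fresh_single {} E")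
      case True
      then show ?thesis using m1 by blast
    next
      case False
      then have ge2: "count E x \<ge> 2" if "x \<in># E" "E \<in> {A, B, C, D}" for E x
      proof -
        have "count E x \<noteq> 1" using False that(2) by (auto simp: has_fresh_single_def)
        moreover have "count E x > 0" using that(1) by simp
        ultimately show ?thesis by linarith
      qed
      have cnt: "count E x = 0 \<or> count E x \<ge> 2" if "E \<in> {A, B, C, D}" for E x
        using ge2[of x E] that by (cases "x \<in># E") (auto simp: count_eq_zero_iff)
      have four: "count U y \<ge> 4" if "y \<in># E" "y \<in># R" "E + R = U" "E \<in> {A, B, C, D}" for y E R
      proof -
        have "count R y \<ge> 1" using that(2) by simp
        moreover have "count E y \<ge> 2" using ge2[OF that(1,4)] .
        moreover have "count A y + count B y + count C y + count D y = count E y + count R y"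
          using that(3) by (metis U_def count_union)
        moreover have "count E y = count A y \<or> count E y = count B y \<or> count E y = count C y \<or>
            count E y = count D y"
          using that(4) by auto
        moreover have "count U y = count A y + count B y + count C y + count D y"
          by (simp add: U_def)
        moreover have "count A y = 0 \<or> count A y \<ge> 2" "count B y = 0 \<or> count B y \<ge> 2"
          "count C y = 0 \<or> count C y \<ge> 2" "count D y = 0 \<or> count D y \<ge> 2"
          using cnt by blast+
        ultimately show ?thesis by (elim disjE) linarith+
      qed
      obtain a where a: "a \<in># A" "a \<in># B + C + D" using A by (auto simp: linked_def)
      obtain b where b: "b \<in># B" "b \<in># A + C + D" using B by (auto simp: linked_def)
      obtain c where c: "c \<in># C" "c \<in># A + B + D" using C by (auto simp: linked_def)
      obtain d where d: "d \<in># D" "d \<in># A + B + C" using D by (auto simp: linked_def)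
      have f: "count U a \<ge> 4" "count U b \<ge> 4" "count U c \<ge> 4" "count U d \<ge> 4"
        using four[OF a] four[OF b] four[OF c] four[OF d] by (simp_all add: U_def add_ac)
      have aU: "a \<in># U" using a by (simp add: U_def)
      \<comment> \<open>The shared labels may coincide. If all four are equal, each multiset
        contributes at least 2 to one label of multiplicity at least 8; otherwise two different
        labels have surplus at least 2 each.\<close>
      have "(\<Sum>x\<in>set_mset U. count U x - 2) \<ge> 4"
      proof (cases "b = a \<and> c = a \<and> d = a")
        case True
        then have "count U a \<ge> 8"
          using ge2[OF a(1)] ge2[OF b(1)] ge2[OF c(1)] ge2[OF d(1)] by (simp add: U_def)
        then show ?thesis using exc_ge[OF aU] by linarith
      next
        case False
        then obtain y where y: "y \<noteq> a" "count U y \<ge> 4" using f by blast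
        then have "y \<in># U" by (metis count_greater_zero_iff less_le_trans zero_less_numeral)
        then have "(\<Sum>x\<in>{a, y}. count U x - 2) \<le> (\<Sum>x\<in>set_mset U. count U x - 2)"
          using aU by (intro sum_mono2) auto
        then show ?thesis using y f(1) by simp
      qed
      then show ?thesis using excess by linarith
    qed
  qed
qed


section \<open>Number and parity of pair-matched words\<close>

lemma length_pair_matched: "pair_matched w \<Longrightarrow> length w = 2 * card (set w)"
  using sum_count_set[of w "set w"] by (simp add: pair_matched_def)

text \<open>Renaming the letters of a normal word by the m! permutations of its m letters gives
  distinct arrangements of the multiset with every letter twice, and uniqueness of normal forms
  separates different words. There are (2m)! / 2^m arrangements; the factors stay on the left
  because the estimate lives in \<open>nat\<close>.\<close>

lemma card_normal_pair_matched:
  "card {w. normal_word w \<and> pair_matched w \<and> length w = 2 * m} * (fact m * 2 ^ m) \<le> fact (2 * m)"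
proof -
  let ?W = "{w. normal_word w \<and> pair_matched w \<and> length w = 2 * m}"
  let ?T = "{\<tau>. \<tau> permutes {..<m}}"
  define A where "A = repeat_mset 2 (mset_set {..<m})"
  have A_def2: "A = mset_set {..<m} + mset_set {..<m}" by (simp add: A_def multiset_eq_iff)
  have set_w: "set w = {..<m}" if "w \<in> ?W" for w
    using that set_normal_word[of w] length_pair_matched[of w] by auto
  have mset_w: "mset w = A" if w: "w \<in> ?W" for w
  proof (rule multiset_eqI)
    fix x
    have "count (mset w) x = count_list w x" by (simp add: count_mset)
    also have "\<dots> = count A x"
      using w set_w[OF w] by (cases "x \<in> set w") (auto simp: pair_matched_def A_def count_list_0_iff)
    finally show "count (mset w) x = count A x" .
  qed
  have inj: "inj_on (\<lambda>(w, \<tau>). map \<tau> w) (?W \<times> ?T)"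
  proof (rule inj_onI)
    fix y y' assume y: "y \<in> ?W \<times> ?T" "y' \<in> ?W \<times> ?T" "(case y of (w, \<tau>) \<Rightarrow> map \<tau> w) = (case y' of (w, \<tau>) \<Rightarrow> map \<tau> w)"
    obtain w \<tau> w' \<tau>' where y_eq: "y = (w, \<tau>)" "y' = (w', \<tau>')" by (metis surj_pair)
    have w: "normal_word w" "pair_matched w" "length w = 2 * m" and w': "normal_word w'"
      and \<tau>: "\<tau> permutes {..<m}" and \<tau>': "\<tau>' permutes {..<m}" and eq: "map \<tau> w = map \<tau>' w'"
      using y unfolding y_eq by simp_all
    have undo: "map (inv_into UNIV \<sigma>) (map \<sigma> v) = v" "inj_on (inv_into UNIV \<sigma>) S" if "\<sigma> permutes {..<m}" for \<sigma> :: "nat \<Rightarrow> nat" and v S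
      using inj_on_subset[OF permutes_inj[OF permutes_inv[OF that]] subset_UNIV]
      by (simp_all add: o_def permutes_inverses(2)[OF that])
    have ww: "w = w'"
    proof (rule ex1E[OF ex1_normal_word[of "map \<tau> w"]])
      fix v assume uniq: "\<forall>y. normal_word y \<and> (\<exists>f. inj_on f (set (map \<tau> w)) \<and> y = map f (map \<tau> w)) \<longrightarrow> y = v"
      have "w = v" by (rule uniq[rule_format]) (use w(1) undo[OF \<tau>] in metis)
      moreover have "w' = v"
        by (rule uniq[rule_format], unfold eq) (use w'(1) undo[OF \<tau>'] in metis)
      ultimately show "w = w'" by simp
    qed
    have "\<tau> x = \<tau>' x" for x
      using eq set_w[of w] w permutes_not_in[OF \<tau>, of x] permutes_not_in[OF \<tau>', of x]
      by (cases "x < m") (auto simp: ww)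
    with ww show "y = y'" unfolding y_eq by auto
  qed
  have sub: "(\<lambda>(w, \<tau>). map \<tau> w) ` (?W \<times> ?T) \<subseteq> permutations_of_multiset A"
  proof (rule image_subsetI)
    fix y assume y: "y \<in> ?W \<times> ?T"
    obtain w \<tau> where y_eq: "y = (w, \<tau>)" by (cases y)
    have w: "w \<in> ?W" and \<tau>: "\<tau> permutes {..<m}" using y unfolding y_eq by simp_all
    have "mset (map \<tau> w) = image_mset \<tau> A" using mset_w[OF w] by simp
    also have "\<dots> = A"
      unfolding A_def2 image_mset_union permutes_image_mset[OF \<tau>] ..
    finally show "(case y of (w, \<tau>) \<Rightarrow> map \<tau> w) \<in> permutations_of_multiset A"
      by (simp add: permutations_of_multiset_def y_eq)
  qed
  have "card ?W * fact m = card (?W \<times> ?T)"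
    by (simp add: card_cartesian_product card_permutations[of "{..<m}" m])
  also have "\<dots> \<le> card (permutations_of_multiset A)"
    using card_inj_on_le[OF inj sub] by simp
  finally have "card ?W * fact m * 2 ^ m \<le> card (permutations_of_multiset A) * 2 ^ m" by simp
  also have "\<dots> = card (permutations_of_multiset A) * (\<Prod>x\<in>set_mset A. fact (count A x))"
  proof -
    have "set_mset A = {..<m}" by (auto simp: A_def2)
    moreover have "(\<Prod>x<m. fact (count A x)) = (\<Prod>x<m. 2 :: nat)"
      by (intro prod.cong) (auto simp: A_def)
    ultimately show ?thesis by simp
  qed
  also have "\<dots> = fact (2 * m)"
    by (subst card_permutations_of_multiset_aux) (simp add: A_def)
  finally show ?thesis by (simp add: mult_ac)
qed

text \<open>Compatibility makes \<open>q\<close> a letterwise image of \<open>w\<close>, so the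
  number of occurrences of a factor is a sum of 2s over the letters mapped to it. Read
  contrapositively, a parity defect empties \<open>CIW2 q\<close>, which is how the limit comes to
  vanish.\<close>

lemma CIW2_even:
  assumes "w \<in> CIW2 q"
  shows "even (length q)" "even (count_list q x)"
proof -
  have w: "pair_matched w" "length w = length q"
    and eq: "\<And>i j. i < length w \<Longrightarrow> j < length w \<Longrightarrow> w ! i = w ! j \<Longrightarrow> q ! i = q ! j"
    using assms unfolding CIW2_def compatible_def by blast+
  show "even (length q)" using length_pair_matched[OF w(1)] w(2) by simp
  define g where "g a = q ! (SOME i. i < length w \<and> w ! i = a)" for a
  have "q ! i = g (w ! i)" if "i < length w" for i
  proof -
    have "(SOME j. j < length w \<and> w ! j = w ! i) < length w \<and> w ! (SOME j. j < length w \<and> w ! j = w ! i) = w ! i"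
      by (rule someI[of _ i]) (use that in simp)
    then show ?thesis unfolding g_def using eq that by metis
  qed
  then have q: "q = map g w" using w(2) by (intro nth_equalityI) auto
  have "count_list (map g w) x = (\<Sum>a\<in>{a \<in> set w. g a = x}. count_list w a)"
  proof -
    \<comment> \<open>A fixed letter set \<open>V\<close> replaces \<open>set v\<close>, which
      changes along the induction.\<close>
    have "count_list (map g v) x = (\<Sum>a\<in>{a \<in> V. g a = x}. count_list v a)"
      if "finite V" "set v \<subseteq> V" for v V
      using that(2)
    proof (induction v)
      case (Cons b v)
      have "(\<Sum>a\<in>{a \<in> V. g a = x}. if b = a then count_list v a + 1 else count_list v a) =
          (\<Sum>a\<in>{a \<in> V. g a = x}. count_list v a) + (\<Sum>a\<in>{a \<in> V. g a = x}. if b = a then 1 else 0)"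
        by (subst sum.distrib[symmetric]) (intro sum.cong, auto)
      then show ?case using Cons that(1) by (auto simp: sum.delta)
    qed simp
    then show ?thesis by simp
  qed
  also have "even \<dots>" using w(1) by (intro dvd_sum) (simp add: pair_matched_def)
  finally show "even (count_list q x)" by (simp add: q)
qed

section \<open>Counting circuits\<close>

lemma sum_PiE_Suc:
  fixes g :: "(nat \<Rightarrow> 'b) \<Rightarrow> 'c::comm_monoid_add"
  shows "(\<Sum>\<pi>\<in>{0..Suc k} \<rightarrow>\<^sub>E B. g \<pi>) = (\<Sum>\<pi>\<in>{0..k} \<rightarrow>\<^sub>E B. \<Sum>v\<in>B. g (\<pi>(Suc k := v)))"
proof -
  have eq: "{0..Suc k} \<rightarrow>\<^sub>E B = (\<lambda>(y, f). f(Suc k := y)) ` (B \<times> ({0..k} \<rightarrow>\<^sub>E B))"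
    by (simp add: atLeastAtMostSuc_conv PiE_insert_eq)
  have inj: "inj_on (\<lambda>(y, f). f(Suc k := y)) (B \<times> ({0..k} \<rightarrow>\<^sub>E B))"
    using inj_combinator[of "Suc k" "{0..k}" "\<lambda>_. B"] by simp
  have "(\<Sum>\<pi>\<in>{0..Suc k} \<rightarrow>\<^sub>E B. g \<pi>) = (\<Sum>(y, f)\<in>B \<times> ({0..k} \<rightarrow>\<^sub>E B). g (f(Suc k := y)))"
    unfolding eq by (subst sum.reindex[OF inj]) (simp add: case_prod_beta' o_def)
  also have "\<dots> = (\<Sum>y\<in>B. \<Sum>f\<in>{0..k} \<rightarrow>\<^sub>E B. g (f(Suc k := y)))"
    by (simp add: sum.cartesian_product)
  finally show ?thesis by (subst (asm) sum.swap)
qed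

lemma sum_PiE_0:
  fixes g :: "(nat \<Rightarrow> 'b) \<Rightarrow> 'c::comm_monoid_add"
  shows "(\<Sum>\<pi>\<in>{0..0} \<rightarrow>\<^sub>E B. g \<pi>) = (\<Sum>v\<in>B. g ((\<lambda>_. undefined)(0 := v)))"
proof -
  have eq: "{0..0::nat} \<rightarrow>\<^sub>E B = (\<lambda>y. (\<lambda>_. undefined)(0 := y)) ` B"
    by (auto simp: PiE_insert_eq)
  show ?thesis unfolding eq
    by (subst sum.reindex) (auto intro!: inj_onI dest: fun_cong[where x = 0])
qed

text \<open>The label function depends on the step so that the color and index of the corresponding
  factor can be part of the label, and so that a rotated circuit is again described by a function of
  this kind.\<close>

definition labels :: "(nat \<Rightarrow> nat \<Rightarrow> nat \<Rightarrow> 'l) \<Rightarrow> nat \<Rightarrow> (nat \<Rightarrow> nat) \<Rightarrow> 'l multiset" where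
  "labels lab k \<pi> = image_mset (\<lambda>i. lab i (\<pi> i) (\<pi> (Suc i))) (mset_set {..<k})"

lemma set_mset_labels: "set_mset (labels lab k \<pi>) = (\<lambda>i. lab i (\<pi> i) (\<pi> (Suc i))) ` {..<k}"
  by (simp add: labels_def)

lemma size_labels: "size (labels lab k \<pi>) = k"
  by (simp add: labels_def)

lemma labels_upd:
  "labels lab (Suc k) (\<pi>(Suc k := v)) = add_mset (lab k (\<pi> k) v) (labels lab k \<pi>)"
proof -
  have "image_mset (\<lambda>i. lab i ((\<pi>(Suc k := v)) i) ((\<pi>(Suc k := v)) (Suc i))) (mset_set {..<k})
    = labels lab k \<pi>"
    unfolding labels_def by (rule image_mset_cong) auto
  then show ?thesis by (simp add: labels_def lessThan_Suc)
qed

lemma finite_circuits: "finite (circuits k n)"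
  unfolding circuits_def by (rule finite_subset[of _ "{0..k} \<rightarrow>\<^sub>E {1..n}"]) (auto intro: finite_PiE)

text \<open>
  Weighting a walk by $n^{-r}$, with r the number of its labels outside K, makes each step
  cost a bounded factor: n choices at weight 1/n, or boundedly many at weight 1.
\<close>
lemma walk_weight:
  fixes lab :: "nat \<Rightarrow> nat \<Rightarrow> nat \<Rightarrow> 'l" and \<Delta> :: real
  assumes B: "\<And>i a t. a \<in> {1..n} \<Longrightarrow> i < l \<Longrightarrow> real (card {b \<in> {1..n}. lab i a b = t}) \<le> \<Delta>"
    and K: "finite K" "card K + l \<le> r" and n: "n \<ge> 1" and \<Delta>: "\<Delta> \<ge> 0"
  shows "(\<Sum>\<pi>\<in>{0..l} \<rightarrow>\<^sub>E {1..n}. (1 / real n) ^ card (set_mset (labels lab l \<pi>) - K))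
     \<le> (real r * \<Delta> + 1) ^ l * real n"
  using B K(2)
proof (induction l)
  case 0
  show ?case by (subst sum_PiE_0) (simp add: labels_def)
next
  case (Suc l)
  define W where "W \<pi> = (1 / real n) ^ card (set_mset (labels lab l \<pi>) - K)" for \<pi> :: "nat \<Rightarrow> nat"
  have step: "(\<Sum>v\<in>{1..n}. (1 / real n) ^ card (set_mset (labels lab (Suc l) (\<pi>(Suc l := v))) - K))
      \<le> W \<pi> * (real r * \<Delta> + 1)" if \<pi>: "\<pi> \<in> {0..l} \<rightarrow>\<^sub>E {1..n}" for \<pi>
  proof -
    let ?S = "set_mset (labels lab l \<pi>)"
    let ?old = "{v \<in> {1..n}. lab l (\<pi> l) v \<in> K \<union> ?S}"
    have fS: "finite ?S" by simp
    have pl: "\<pi> l \<in> {1..n}" using \<pi> by auto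
    \<comment> \<open>An old label leaves the weight unchanged, a new one multiplies it by exactly
      1/n. Charging 1/n to every vertex covers the second case and sums to \<open>W \<pi>\<close>
      over all n vertices.\<close>
    have "(1 / real n) ^ card (set_mset (labels lab (Suc l) (\<pi>(Suc l := v))) - K)
        \<le> W \<pi> * (if v \<in> ?old then 1 else 0) + W \<pi> * (1 / real n)" if v: "v \<in> {1..n}" for v
    proof (cases "v \<in> ?old")
      case True
      then have "insert (lab l (\<pi> l) v) ?S - K = ?S - K" by auto
      with True show ?thesis by (simp add: labels_upd W_def)
    next
      case False
      then have "insert (lab l (\<pi> l) v) ?S - K = insert (lab l (\<pi> l) v) (?S - K)"
        "lab l (\<pi> l) v \<notin> ?S - K" using v by auto
      then have "card (insert (lab l (\<pi> l) v) ?S - K) = Suc (card (?S - K))" by simp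
      then show ?thesis using False by (simp add: labels_upd W_def)
    qed
    then have "(\<Sum>v\<in>{1..n}. (1 / real n) ^ card (set_mset (labels lab (Suc l) (\<pi>(Suc l := v))) - K))
       \<le> (\<Sum>v\<in>{1..n}. W \<pi> * (if v \<in> ?old then 1 else 0) + W \<pi> * (1 / real n))"
      by (rule sum_mono)
    also have "\<dots> = W \<pi> * real (card ?old) + W \<pi>"
    proof -
      have "(\<Sum>v\<in>{1..n}. if v \<in> ?old then 1 else (0::real)) = real (card ?old)"
        by (simp add: sum.If_cases Int_def)
      then show ?thesis using n by (simp add: sum.distrib flip: sum_distrib_left)
    qed
    \<comment> \<open>\<open>r\<close> bounds the number of labels that can be old at any step,
      those in \<open>K\<close> plus one for each earlier step; each of them is reached from the
      current vertex in at most \<Delta> ways.\<close>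
    also have "real (card ?old) \<le> real r * \<Delta>"
    proof -
      have "?old = (\<Union>t\<in>K \<union> ?S. {v \<in> {1..n}. lab l (\<pi> l) v = t})" by auto
      then have "card ?old \<le> (\<Sum>t\<in>K \<union> ?S. card {v \<in> {1..n}. lab l (\<pi> l) v = t})"
        using card_UN_le[of "K \<union> ?S"] K(1) fS by simp
      then have "real (card ?old) \<le> (\<Sum>t\<in>K \<union> ?S. real (card {v \<in> {1..n}. lab l (\<pi> l) v = t}))"
        unfolding of_nat_sum[symmetric] of_nat_le_iff .
      also have "\<dots> \<le> (\<Sum>t\<in>K \<union> ?S. \<Delta>)"
        using Suc.prems(1)[OF pl] by (intro sum_mono) auto
      also have "\<dots> = real (card (K \<union> ?S)) * \<Delta>" by simp
      also have "card (K \<union> ?S) \<le> r"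
      proof -
        have "card ?S \<le> l" unfolding set_mset_labels using card_image_le[of "{..<l}"] by simp
        then show ?thesis using card_Un_le[of K ?S] Suc.prems(2) by linarith
      qed
      finally show ?thesis using \<Delta> by (simp add: mult_right_mono)
    qed
    then have "W \<pi> * real (card ?old) + W \<pi> \<le> W \<pi> * (real r * \<Delta>) + W \<pi>"
      using mult_left_mono[of "real (card ?old)" "real r * \<Delta>" "W \<pi>"] by (simp add: W_def)
    also have "\<dots> = W \<pi> * (real r * \<Delta> + 1)" by (simp add: algebra_simps)
    finally show ?thesis .
  qed
  have "(\<Sum>\<pi>\<in>{0..Suc l} \<rightarrow>\<^sub>E {1..n}. (1 / real n) ^ card (set_mset (labels lab (Suc l) \<pi>) - K))
      \<le> (\<Sum>\<pi>\<in>{0..l} \<rightarrow>\<^sub>E {1..n}. W \<pi> * (real r * \<Delta> + 1))"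
    unfolding sum_PiE_Suc by (rule sum_mono) (rule step)
  also have "\<dots> = (\<Sum>\<pi>\<in>{0..l} \<rightarrow>\<^sub>E {1..n}. W \<pi>) * (real r * \<Delta> + 1)"
    by (simp flip: sum_distrib_right)
  also have "\<dots> \<le> ((real r * \<Delta> + 1) ^ l * real n) * (real r * \<Delta> + 1)"
    using Suc.IH Suc.prems \<Delta> unfolding W_def by (intro mult_right_mono) auto
  finally show ?case by (simp add: mult_ac)
qed

text \<open>The closing condition is simply discarded here;
  \<open>circuits_fresh_single_weight\<close> is where it gains a factor n.\<close>

lemma circuits_weight:
  fixes lab :: "nat \<Rightarrow> nat \<Rightarrow> nat \<Rightarrow> 'l" and \<Delta> :: real
  assumes "\<And>i a t. a \<in> {1..n} \<Longrightarrow> i < k \<Longrightarrow> real (card {b \<in> {1..n}. lab i a b = t}) \<le> \<Delta>"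
    and "finite K" "card K + k \<le> r" and "n \<ge> 1" and "\<Delta> \<ge> 0"
  shows "(\<Sum>\<pi>\<in>circuits k n. (1 / real n) ^ card (set_mset (labels lab k \<pi>) - K))
     \<le> (real r * \<Delta> + 1) ^ k * real n"
proof -
  have "(\<Sum>\<pi>\<in>circuits k n. (1 / real n) ^ card (set_mset (labels lab k \<pi>) - K))
    \<le> (\<Sum>\<pi>\<in>{0..k} \<rightarrow>\<^sub>E {1..n}. (1 / real n) ^ card (set_mset (labels lab k \<pi>) - K))"
    by (rule sum_mono2) (auto simp: circuits_def intro: finite_PiE)
  also have "\<dots> \<le> (real r * \<Delta> + 1) ^ k * real n"
    by (rule walk_weight) (use assms in auto)
  finally show ?thesis .
qed

section \<open>Cutting a circuit open at one step\<close>

lemma bij_betw_cyclic_shift: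
  fixes s k :: nat
  assumes "k > 0"
  shows "bij_betw (\<lambda>j. (s + j) mod k) {..<k} {..<k}"
proof -
  have "x = y" if "x \<le> y" "y < k" "(s + y) mod k = (s + x) mod k" for x y
  proof -
    have "k dvd y - x" using mod_eq_dvd_iff_nat[of "s + x" "s + y" k] that by simp
    with that show "x = y" by (auto dest: dvd_imp_le)
  qed
  then have "inj_on (\<lambda>j. (s + j) mod k) {..<k}"
    by (metis (no_types, lifting) inj_onI lessThan_iff nat_le_linear)
  moreover have "(\<lambda>j. (s + j) mod k) ` {..<k} \<subseteq> {..<k}" using assms by auto
  ultimately show ?thesis
    by (simp add: bij_betw_def card_image card_subset_eq)
qed


text \<open>The rotation starts at the end point of step \<open>i\<close>, so that step comes last
  in the rotated circuit and is dropped; the other \<open>k - 1\<close> steps form a walk traversed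
  in the original direction.\<close>

lemma labels_cut:
  assumes \<pi>: "\<pi> \<in> circuits k n" and i: "i < k"
  defines "\<sigma> \<equiv> \<lambda>j. (Suc i + j) mod k"
  shows "labels lab k \<pi> = add_mset (lab i (\<pi> i) (\<pi> (Suc i)))
     (labels (\<lambda>j. lab (\<sigma> j)) (k - 1) (restrict (\<lambda>j. \<pi> (\<sigma> j)) {0..k - 1}))"
proof -
  define f where "f j = lab j (\<pi> j) (\<pi> (Suc j))" for j
  have bij: "bij_betw \<sigma> {..<k} {..<k}"
    unfolding \<sigma>_def using i by (intro bij_betw_cyclic_shift) simp
  have \<sigma>_last: "\<sigma> (k - 1) = i" using i by (simp add: \<sigma>_def)
  have \<pi>_Suc: "\<pi> (Suc (\<sigma> j)) = \<pi> (\<sigma> (Suc j))" for j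
  proof (cases "Suc (\<sigma> j) = k")
    \<comment> \<open>The walk passes from the end of the circuit to its beginning here, which is
      legitimate because \<open>\<pi> k = \<pi> 0\<close>.\<close>
    case True
    then have "\<sigma> (Suc j) = 0" using i unfolding \<sigma>_def by (simp add: mod_Suc)
    then show ?thesis using True \<pi> by (simp add: circuits_def)
  next
    case False
    then have "\<sigma> (Suc j) = Suc (\<sigma> j)" using i unfolding \<sigma>_def by (simp add: mod_Suc)
    then show ?thesis by simp
  qed
  have "labels lab k \<pi> = image_mset f (mset_set {..<k})" by (simp add: labels_def f_def[abs_def])
  also have "mset_set {..<k} = image_mset \<sigma> (mset_set {..<k})"
    using bij by (simp add: bij_betw_def image_mset_mset_set)
  also have "{..<k} = insert (k - 1) {..<k - 1}" using i by auto
  also have "image_mset f (image_mset \<sigma> (mset_set (insert (k - 1) {..<k - 1}))) =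
      add_mset (f i) (image_mset (\<lambda>j. f (\<sigma> j)) (mset_set {..<k - 1}))"
    using \<sigma>_last by (simp add: image_mset.compositionality o_def)
  also have "image_mset (\<lambda>j. f (\<sigma> j)) (mset_set {..<k - 1}) =
      labels (\<lambda>j. lab (\<sigma> j)) (k - 1) (restrict (\<lambda>j. \<pi> (\<sigma> j)) {0..k - 1})"
    unfolding labels_def by (rule image_mset_cong) (auto simp: f_def \<pi>_Suc)
  finally show ?thesis by (simp add: f_def)
qed

text \<open>Only a step is lost, not a vertex: the positions 0 to \<open>k - 1\<close> of the
  rotated walk still visit every residue modulo \<open>k\<close>, and \<open>\<pi> k\<close> repeats
  \<open>\<pi> 0\<close>.\<close>

lemma inj_on_cut:
  assumes k: "k > 0"
  shows "inj_on (\<lambda>\<pi>. restrict (\<lambda>j. \<pi> ((s + j) mod k)) {0..k - 1}) (circuits k n)"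
proof (rule inj_onI)
  fix \<pi> \<rho> assume \<pi>: "\<pi> \<in> circuits k n" and \<rho>: "\<rho> \<in> circuits k n"
    and eq: "restrict (\<lambda>j. \<pi> ((s + j) mod k)) {0..k - 1} = restrict (\<lambda>j. \<rho> ((s + j) mod k)) {0..k - 1}"
  have lt: "\<pi> i = \<rho> i" if "i < k" for i
  proof -
    from that obtain j where j: "j < k" "i = (s + j) mod k"
      using bij_betw_cyclic_shift[OF k, of s] by (auto simp: bij_betw_def)
    then show ?thesis using fun_cong[OF eq, of j] by (auto split: if_splits)
  qed
  have "\<pi> k = \<rho> k" using lt[of 0] k \<pi> \<rho> by (simp add: circuits_def)
  show "\<pi> = \<rho>"
  proof (rule PiE_ext[of _ "{0..k}" "\<lambda>_. {1..n}"])
    show "\<pi> \<in> {0..k} \<rightarrow>\<^sub>E {1..n}" "\<rho> \<in> {0..k} \<rightarrow>\<^sub>E {1..n}" using \<pi> \<rho> by (auto simp: circuits_def)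
    show "\<pi> x = \<rho> x" if "x \<in> {0..k}" for x
      using that lt[of x] \<open>\<pi> k = \<rho> k\<close> by (cases "x = k") auto
  qed
qed

text \<open>
  A circuit can be cut at a step whose label is fresh and occurs only once: the remaining walk
  determines this step, so its label does not cost a factor n.
\<close>
lemma circuits_fresh_single_weight:
  fixes lab :: "nat \<Rightarrow> nat \<Rightarrow> nat \<Rightarrow> 'l" and \<Delta> :: real
  assumes B: "\<And>i a t. a \<in> {1..n} \<Longrightarrow> i < k \<Longrightarrow> real (card {b \<in> {1..n}. lab i a b = t}) \<le> \<Delta>"
    and K: "finite K" "card K + k \<le> r" and n: "n \<ge> 1" and \<Delta>: "\<Delta> \<ge> 0"
  shows "(\<Sum>\<pi> | \<pi> \<in> circuits k n \<and> has_fresh_single K (labels lab k \<pi>).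
        (1 / real n) ^ card (set_mset (labels lab k \<pi>) - K)) \<le> real k * (real r * \<Delta> + 1) ^ k"
proof -
  define W where "W \<pi> = (1 / real n) ^ card (set_mset (labels lab k \<pi>) - K)" for \<pi>
  define x where "x i \<pi> = lab i (\<pi> i) (\<pi> (Suc i))" for i :: nat and \<pi> :: "nat \<Rightarrow> nat"
  \<comment> \<open>The sets \<open>S i\<close> overlap when several steps can serve as the cut; the
    union bound over \<open>i\<close> is the source of the factor \<open>k\<close>.\<close>
  define S where "S i = {\<pi> \<in> circuits k n. count (labels lab k \<pi>) (x i \<pi>) = 1 \<and> x i \<pi> \<notin> K}" for i
  have S: "(\<Sum>\<pi>\<in>S i. W \<pi>) \<le> (real r * \<Delta> + 1) ^ k" if i: "i < k" for i
  proof -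
    define lab' where "lab' j = lab ((Suc i + j) mod k)" for j
    define \<rho> where "\<rho> \<pi> = restrict (\<lambda>j. \<pi> ((Suc i + j) mod k)) {0..k - 1}" for \<pi> :: "nat \<Rightarrow> nat"
    define W' where "W' \<pi> = (1 / real n) ^ card (set_mset (labels lab' (k - 1) \<pi>) - K)" for \<pi>
    have W: "W \<pi> = 1 / real n * W' (\<rho> \<pi>)" if \<pi>: "\<pi> \<in> S i" for \<pi>
    proof -
      have *: "labels lab k \<pi> = add_mset (x i \<pi>) (labels lab' (k - 1) (\<rho> \<pi>))"
        using labels_cut[of \<pi> k n i lab] \<pi> i by (simp add: S_def lab'_def[abs_def] \<rho>_def x_def)
      moreover have "x i \<pi> \<notin># labels lab' (k - 1) (\<rho> \<pi>)" "x i \<pi> \<notin> K"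
        using \<pi> unfolding S_def by (auto simp: * count_eq_zero_iff)
      ultimately have "set_mset (labels lab k \<pi>) - K =
          insert (x i \<pi>) (set_mset (labels lab' (k - 1) (\<rho> \<pi>)) - K)"
        "x i \<pi> \<notin> set_mset (labels lab' (k - 1) (\<rho> \<pi>)) - K" by auto
      then have "card (set_mset (labels lab k \<pi>) - K) =
          Suc (card (set_mset (labels lab' (k - 1) (\<rho> \<pi>)) - K))" by simp
      then show ?thesis unfolding W_def W'_def by simp
    qed
    have inj: "inj_on \<rho> (S i)"
      unfolding \<rho>_def using i by (intro inj_on_subset[OF inj_on_cut]) (auto simp: S_def)
    have "\<rho> ` S i \<subseteq> {0..k - 1} \<rightarrow>\<^sub>E {1..n}"
    proof -
      have "(Suc i + j) mod k \<in> {0..k}" for j using i by (simp add: order.strict_implies_order)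
      then show ?thesis unfolding \<rho>_def S_def circuits_def by (fastforce simp: PiE_iff)
    qed
    then have "(\<Sum>\<pi>\<in>\<rho> ` S i. W' \<pi>) \<le> (\<Sum>\<pi>\<in>{0..k - 1} \<rightarrow>\<^sub>E {1..n}. W' \<pi>)"
      by (intro sum_mono2) (auto simp: W'_def intro: finite_PiE)
    also have "\<dots> \<le> (real r * \<Delta> + 1) ^ (k - 1) * real n"
      unfolding W'_def by (rule walk_weight) (use B K n \<Delta> i in \<open>auto simp: lab'_def\<close>)
    \<comment> \<open>The 1/n of the cut label cancels the n choices of the starting vertex.\<close>
    finally have "(\<Sum>\<pi>\<in>S i. W \<pi>) \<le> 1 / real n * ((real r * \<Delta> + 1) ^ (k - 1) * real n)"
      using n by (simp add: W sum.reindex[OF inj] divide_le_eq flip: sum_divide_distrib)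
    also have "\<dots> = (real r * \<Delta> + 1) ^ (k - 1)" using n by simp
    also have "\<dots> \<le> (real r * \<Delta> + 1) ^ k" using \<Delta> by (intro power_increasing) auto
    finally show ?thesis .
  qed
  have fin: "finite (S i)" for i using finite_circuits by (simp add: S_def)
  have "{\<pi>. \<pi> \<in> circuits k n \<and> has_fresh_single K (labels lab k \<pi>)} \<subseteq> (\<Union>i\<in>{..<k}. S i)"
  proof
    fix \<pi> assume "\<pi> \<in> {\<pi>. \<pi> \<in> circuits k n \<and> has_fresh_single K (labels lab k \<pi>)}"
    then obtain y where y: "\<pi> \<in> circuits k n" "count (labels lab k \<pi>) y = 1" "y \<notin> K"
      by (auto simp: has_fresh_single_def)
    then have "y \<in># labels lab k \<pi>" by (simp flip: count_greater_zero_iff)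
    then obtain i where "i < k" "y = x i \<pi>" by (auto simp: set_mset_labels x_def)
    with y show "\<pi> \<in> (\<Union>i\<in>{..<k}. S i)" by (auto simp: S_def)
  qed
  then have "(\<Sum>\<pi> | \<pi> \<in> circuits k n \<and> has_fresh_single K (labels lab k \<pi>). W \<pi>)
      \<le> sum W (\<Union>i\<in>{..<k}. S i)"
    by (rule sum_mono2[rotated]) (auto simp: W_def fin)
  also have "\<dots> \<le> (\<Sum>i<k. sum W (S i))"
  proof -
    have "sum W (\<Union>i\<in>I. S i) \<le> (\<Sum>i\<in>I. sum W (S i))" if "finite I" for I :: "nat set"
      using that
    proof induction
      case (insert i I)
      have "sum W (S i \<union> \<Union> (S ` I)) \<le> sum W (S i) + sum W (\<Union> (S ` I))"
        using fin insert.hyps by (simp add: sum_Un sum_nonneg W_def)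
      with insert show ?case by simp
    qed simp
    then show ?thesis by simp
  qed
  also have "\<dots> \<le> (\<Sum>i<k. (real r * \<Delta> + 1) ^ k)" by (intro sum_mono S) simp
  finally show ?thesis by (simp add: W_def)
qed

text \<open>A step with a new letter leaves n choices for the next vertex; a repeated letter
  prescribes the label and leaves at most \<Delta>. Keeping the two kinds of steps apart, instead of
  using the crude factor of \<open>walk_weight\<close>, yields the exact power of \<Delta> in the
  bound on the limit.\<close>

lemma card_walks_matching_word:
  fixes lab :: "nat \<Rightarrow> nat \<Rightarrow> nat \<Rightarrow> 'l" and \<Delta> :: real and w :: "nat \<Rightarrow> 'w"
  assumes "\<And>i a t. a \<in> {1..n} \<Longrightarrow> i < l \<Longrightarrow> real (card {b \<in> {1..n}. lab i a b = t}) \<le> \<Delta>"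
    and \<Delta>: "\<Delta> \<ge> 0"
  shows "real (card {\<pi> \<in> {0..l} \<rightarrow>\<^sub>E {1..n}. \<forall>i<l. \<forall>j<l. w i = w j \<longrightarrow>
            lab i (\<pi> i) (\<pi> (Suc i)) = lab j (\<pi> j) (\<pi> (Suc j))})
     \<le> real n ^ Suc (card (w ` {..<l})) * \<Delta> ^ (l - card (w ` {..<l}))"
  using assms(1)
proof (induction l)
  case 0
  have "{\<pi> \<in> {0..0} \<rightarrow>\<^sub>E {1..n}. True} = {0..0::nat} \<rightarrow>\<^sub>E {1..n}" by auto
  then show ?case by (simp add: card_PiE)
next
  case (Suc l)
  define match where "match l \<pi> \<longleftrightarrow> (\<forall>i<l. \<forall>j<l. w i = w j \<longrightarrow>
            lab i (\<pi> i) (\<pi> (Suc i)) = lab j (\<pi> j) (\<pi> (Suc j)))" for l and \<pi> :: "nat \<Rightarrow> nat"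
  have fin: "finite ({0..l} \<rightarrow>\<^sub>E {1..n})" for l :: nat by (auto intro: finite_PiE)
  define new where "new \<longleftrightarrow> w l \<notin> w ` {..<l}"
  define B where "B = (if new then real n else \<Delta>)"
  have card_le: "card (w ` {..<l}) \<le> l" using card_image_le[of "{..<l}" w] by simp
  have step: "(\<Sum>v\<in>{1..n}. of_bool (match (Suc l) (\<pi>(Suc l := v)))) \<le> of_bool (match l \<pi>) * B"
    if \<pi>: "\<pi> \<in> {0..l} \<rightarrow>\<^sub>E {1..n}" for \<pi>
  proof (cases "match l \<pi>")
    case False
    have "\<not> match (Suc l) (\<pi>(Suc l := v))" for v
    proof
      assume *: "match (Suc l) (\<pi>(Suc l := v))"
      have "match l \<pi>" unfolding match_def
      proof (intro allI impI)
        fix i j assume "i < l" "j < l" "w i = w j"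
        then show "lab i (\<pi> i) (\<pi> (Suc i)) = lab j (\<pi> j) (\<pi> (Suc j))"
          using *[unfolded match_def, rule_format, of i j] by simp
      qed
      with False show False by simp
    qed
    with False show ?thesis by simp
  next
    case True
    have "(\<Sum>v\<in>{1..n}. of_bool (match (Suc l) (\<pi>(Suc l := v)))) =
        real (card {v \<in> {1..n}. match (Suc l) (\<pi>(Suc l := v))})"
      by (simp add: Int_def)
    also have "\<dots> \<le> B"
    proof (cases new)
      case True
      have "card {v \<in> {1..n}. match (Suc l) (\<pi>(Suc l := v))} \<le> card {1..n}"
        by (rule card_mono) auto
      then show ?thesis using True by (simp add: B_def)
    next
      case False
      then obtain i where i: "i < l" "w i = w l" by (auto simp: new_def)
      have "{v \<in> {1..n}. match (Suc l) (\<pi>(Suc l := v))} \<subseteq>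
          {v \<in> {1..n}. lab l (\<pi> l) v = lab i (\<pi> i) (\<pi> (Suc i))}"
      proof safe
        fix v assume "match (Suc l) (\<pi>(Suc l := v))"
        from this[unfolded match_def, rule_format, of l i]
        show "lab l (\<pi> l) v = lab i (\<pi> i) (\<pi> (Suc i))" using i by simp
      qed
      then have "card {v \<in> {1..n}. match (Suc l) (\<pi>(Suc l := v))} \<le>
          card {v \<in> {1..n}. lab l (\<pi> l) v = lab i (\<pi> i) (\<pi> (Suc i))}"
        by (rule card_mono[rotated]) simp
      also have "real \<dots> \<le> \<Delta>" using \<pi> by (intro Suc.prems) auto
      finally show ?thesis using False by (simp add: B_def)
    qed
    finally show ?thesis using True by simp
  qed
  have "real (card {\<pi> \<in> {0..Suc l} \<rightarrow>\<^sub>E {1..n}. match (Suc l) \<pi>}) =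
      (\<Sum>\<pi>\<in>{0..Suc l} \<rightarrow>\<^sub>E {1..n}. of_bool (match (Suc l) \<pi>))"
    using fin[of "Suc l"] by (simp add: Int_def)
  also have "\<dots> \<le> (\<Sum>\<pi>\<in>{0..l} \<rightarrow>\<^sub>E {1..n}. of_bool (match l \<pi>) * B)"
    unfolding sum_PiE_Suc by (intro sum_mono step)
  also have "\<dots> = real (card {\<pi> \<in> {0..l} \<rightarrow>\<^sub>E {1..n}. match l \<pi>}) * B"
    using fin[of l] by (simp add: Int_def flip: sum_distrib_right)
  also have "\<dots> \<le> real n ^ Suc (card (w ` {..<l})) * \<Delta> ^ (l - card (w ` {..<l})) * B"
    using Suc.IH Suc.prems \<Delta> unfolding match_def
    by (intro mult_right_mono) (auto simp: B_def)
  also have "\<dots> = real n ^ Suc (card (w ` {..<Suc l})) * \<Delta> ^ (Suc l - card (w ` {..<Suc l}))"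
  proof (cases new)
    case True
    then have "card (w ` {..<Suc l}) = Suc (card (w ` {..<l}))"
      by (simp add: lessThan_Suc new_def)
    then show ?thesis using True by (simp add: B_def)
  next
    case False
    then have "w ` {..<Suc l} = w ` {..<l}" by (auto simp: lessThan_Suc new_def)
    then show ?thesis using False card_le by (simp add: B_def Suc_diff_le)
  qed
  finally show ?case by (simp add: match_def)
qed

section \<open>Traces as sums over circuits\<close>

lemma mat_list_prod_carrier:
  "(\<And>A. A \<in> set As \<Longrightarrow> A \<in> carrier_mat n n) \<Longrightarrow> mat_list_prod n As \<in> carrier_mat n n"
  unfolding mat_list_prod_def by (induction As) (auto intro!: mult_carrier_mat[of _ n n])

lemma mat_list_prod_snoc:
  assumes "\<And>B. B \<in> set As \<Longrightarrow> B \<in> carrier_mat n n" and "A \<in> carrier_mat n n"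
  shows "mat_list_prod n (As @ [A]) = mat_list_prod n As * A"
  using assms(1)
proof (induction As)
  case Nil
  then show ?case using assms(2) by (simp add: mat_list_prod_def)
next
  case (Cons B As)
  have "mat_list_prod n As \<in> carrier_mat n n"
    using Cons.prems by (intro mat_list_prod_carrier) simp
  then show ?case using Cons assms(2)
    by (simp add: mat_list_prod_def assoc_mult_mat[of B n n _ n _ n])
qed

text \<open>The free weight \<open>f\<close> on the end points drives the induction: the last matrix
  is absorbed into it, which gives \<open>g\<close>. The choice \<open>of_bool (a = c)\<close> later
  turns walks into circuits and the sum into the trace.\<close>

lemma sum_mat_list_prod:
  assumes "\<And>A. A \<in> set As \<Longrightarrow> A \<in> carrier_mat n n"
  shows "(\<Sum>a\<in>{1..n}. \<Sum>c\<in>{1..n}. mat_list_prod n As $$ (a - 1, c - 1) * f a c) =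
    (\<Sum>\<pi>\<in>{0..length As} \<rightarrow>\<^sub>E {1..n}.
       (\<Prod>i<length As. (As ! i) $$ (\<pi> i - 1, \<pi> (Suc i) - 1)) * f (\<pi> 0) (\<pi> (length As)))"
  using assms
proof (induction As arbitrary: f rule: rev_induct)
  case Nil
  have "(\<Sum>c\<in>{1..n}. mat_list_prod n [] $$ (a - 1, c - 1) * f a c) = f a a" if "a \<in> {1..n}" for a
  proof -
    have "(\<Sum>c\<in>{1..n}. mat_list_prod n [] $$ (a - 1, c - 1) * f a c) =
        (\<Sum>c\<in>{1..n}. if c = a then f a c else 0)"
      using that by (intro sum.cong) (auto simp: mat_list_prod_def)
    also have "\<dots> = f a a" using that by simp
    finally show ?thesis .
  qed
  then have "(\<Sum>a\<in>{1..n}. \<Sum>c\<in>{1..n}. mat_list_prod n [] $$ (a - 1, c - 1) * f a c) = (\<Sum>a\<in>{1..n}. f a a)"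
    by (rule sum.cong[OF refl])
  also have "\<dots> = (\<Sum>\<pi>\<in>{0..0::nat} \<rightarrow>\<^sub>E {1..n}. f (\<pi> 0) (\<pi> 0))"
    by (subst sum_PiE_0) simp
  finally show ?case by simp
next
  case (snoc A As)
  let ?P = "mat_list_prod n As"
  have A: "A \<in> carrier_mat n n" and As: "\<And>B. B \<in> set As \<Longrightarrow> B \<in> carrier_mat n n"
    using snoc.prems by auto
  have P: "?P \<in> carrier_mat n n" using As by (rule mat_list_prod_carrier)
  have snoc_eq: "mat_list_prod n (As @ [A]) = ?P * A" using As A by (rule mat_list_prod_snoc)
  have entry: "mat_list_prod n (As @ [A]) $$ (a - 1, c - 1) =
      (\<Sum>b\<in>{1..n}. ?P $$ (a - 1, b - 1) * A $$ (b - 1, c - 1))" if "a \<in> {1..n}" "c \<in> {1..n}" for a c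
  proof -
    have "mat_list_prod n (As @ [A]) $$ (a - 1, c - 1) =
        (\<Sum>b\<in>{0..<n}. ?P $$ (a - 1, b) * A $$ (b, c - 1))"
      using that A P unfolding snoc_eq
      by (auto simp: scalar_prod_def intro!: sum.cong)
    also have "\<dots> = (\<Sum>b\<in>{1..n}. ?P $$ (a - 1, b - 1) * A $$ (b - 1, c - 1))"
      by (rule sum.reindex_bij_witness[of _ "\<lambda>b. b - 1" Suc]) auto
    finally show ?thesis .
  qed
  define g where "g a b = (\<Sum>c\<in>{1..n}. A $$ (b - 1, c - 1) * f a c)" for a b
  have "(\<Sum>a\<in>{1..n}. \<Sum>c\<in>{1..n}. mat_list_prod n (As @ [A]) $$ (a - 1, c - 1) * f a c) =
      (\<Sum>a\<in>{1..n}. \<Sum>c\<in>{1..n}. \<Sum>b\<in>{1..n}. ?P $$ (a - 1, b - 1) * A $$ (b - 1, c - 1) * f a c)"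
    by (intro sum.cong refl) (subst entry, simp_all add: sum_distrib_right)
  also have "\<dots> = (\<Sum>a\<in>{1..n}. \<Sum>b\<in>{1..n}. ?P $$ (a - 1, b - 1) * g a b)"
    by (rule sum.cong[OF refl], subst sum.swap) (simp add: g_def sum_distrib_left mult.assoc)
  also have "\<dots> = (\<Sum>\<pi>\<in>{0..length As} \<rightarrow>\<^sub>E {1..n}.
       (\<Prod>i<length As. (As ! i) $$ (\<pi> i - 1, \<pi> (Suc i) - 1)) * g (\<pi> 0) (\<pi> (length As)))"
    using As by (rule snoc.IH)
  also have "\<dots> = (\<Sum>\<pi>\<in>{0..Suc (length As)} \<rightarrow>\<^sub>E {1..n}.
       (\<Prod>i<Suc (length As). ((As @ [A]) ! i) $$ (\<pi> i - 1, \<pi> (Suc i) - 1)) *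
         f (\<pi> 0) (\<pi> (Suc (length As))))"
    unfolding sum_PiE_Suc
  proof (intro sum.cong refl)
    fix \<pi> :: "nat \<Rightarrow> nat"
    let ?l = "length As"
    have "(\<Prod>i<?l. (As @ [A]) ! i $$ ((\<pi>(Suc ?l := v)) i - 1, (\<pi>(Suc ?l := v)) (Suc i) - 1)) =
      (\<Prod>i<?l. (As ! i) $$ (\<pi> i - 1, \<pi> (Suc i) - 1))" for v
      by (intro prod.cong refl) (simp add: nth_append)
    then show "(\<Prod>i<?l. (As ! i) $$ (\<pi> i - 1, \<pi> (Suc i) - 1)) * g (\<pi> 0) (\<pi> ?l) =
      (\<Sum>v\<in>{1..n}. (\<Prod>i<Suc ?l. ((As @ [A]) ! i) $$
          ((\<pi>(Suc ?l := v)) i - 1, (\<pi>(Suc ?l := v)) (Suc i) - 1)) *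
         f ((\<pi>(Suc ?l := v)) 0) ((\<pi>(Suc ?l := v)) (Suc ?l)))"
      by (simp add: g_def sum_distrib_left mult.assoc)
  qed
  finally show ?case by simp
qed

lemma mat_trace_list_prod:
  assumes "\<And>A. A \<in> set As \<Longrightarrow> A \<in> carrier_mat n n"
  shows "mat_trace (mat_list_prod n As) =
    (\<Sum>\<pi>\<in>circuits (length As) n. \<Prod>i<length As. (As ! i) $$ (\<pi> i - 1, \<pi> (Suc i) - 1))"
proof -
  let ?P = "mat_list_prod n As"
  have "mat_trace ?P = (\<Sum>a\<in>{1..n}. ?P $$ (a - 1, a - 1))"
    unfolding mat_trace_def using carrier_matD(1)[OF mat_list_prod_carrier[of As n]] assms
    by (intro sum.reindex_bij_witness[of _ "\<lambda>b. b - 1" Suc]) auto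
  also have "\<dots> = (\<Sum>a\<in>{1..n}. \<Sum>c\<in>{1..n}. ?P $$ (a - 1, c - 1) * of_bool (a = c))"
  proof (rule sum.cong[OF refl])
    fix a assume a: "a \<in> {1..n}"
    have "(\<Sum>c\<in>{1..n}. ?P $$ (a - 1, c - 1) * of_bool (a = c)) =
        (\<Sum>c\<in>{1..n}. if c = a then ?P $$ (a - 1, c - 1) else 0)"
      by (intro sum.cong) auto
    then show "?P $$ (a - 1, a - 1) = (\<Sum>c\<in>{1..n}. ?P $$ (a - 1, c - 1) * of_bool (a = c))"
      using a by simp
  qed
  also have "\<dots> = (\<Sum>\<pi>\<in>{0..length As} \<rightarrow>\<^sub>E {1..n}.
       (\<Prod>i<length As. (As ! i) $$ (\<pi> i - 1, \<pi> (Suc i) - 1)) * of_bool (\<pi> 0 = \<pi> (length As)))"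
    using assms by (rule sum_mat_list_prod)
  also have "\<dots> = (\<Sum>\<pi>\<in>circuits (length As) n. \<Prod>i<length As. (As ! i) $$ (\<pi> i - 1, \<pi> (Suc i) - 1))"
    unfolding circuits_def by (rule sum.mono_neutral_cong_right) (auto intro: finite_PiE)
  finally show ?thesis .
qed

definition monomial_labels ::
  "(nat \<Rightarrow> nat \<Rightarrow> nat \<Rightarrow> nat \<Rightarrow> int list) \<Rightarrow> (nat \<times> nat) list \<Rightarrow> nat \<Rightarrow> (nat \<Rightarrow> nat) \<Rightarrow>
   (nat \<times> nat \<times> int list) multiset" where
  "monomial_labels L q n \<pi> =
     labels (\<lambda>i a b. (fst (q ! i), snd (q ! i), L (fst (q ! i)) n a b)) (length q) \<pi>"

text \<open>The scale \<open>s\<close> serves two normalizations: 1 for \<open>mu_tilde\<close>,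
  which scales the whole product, and \<open>1 / sqrt n\<close> for \<open>scaled_monomial\<close>,
  which scales each factor.\<close>

lemma mat_trace_X_mat:
  "mat_trace (mat_list_prod n (map (\<lambda>m. s \<cdot>\<^sub>m X_mat L X n \<omega> m) q)) =
     s ^ length q * (\<Sum>\<pi>\<in>circuits (length q) n. \<Prod>(j, i, t)\<in>#monomial_labels L q n \<pi>. X j i t \<omega>)"
proof -
  have "mat_trace (mat_list_prod n (map (\<lambda>m. s \<cdot>\<^sub>m X_mat L X n \<omega> m) q)) =
    (\<Sum>\<pi>\<in>circuits (length q) n. \<Prod>i<length q. (s \<cdot>\<^sub>m X_mat L X n \<omega> (q ! i)) $$ (\<pi> i - 1, \<pi> (Suc i) - 1))"
    by (subst mat_trace_list_prod) (auto simp: X_mat_def patterned_mat_def)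
  also have "\<dots> = (\<Sum>\<pi>\<in>circuits (length q) n. s ^ length q * (\<Prod>(j, i, t)\<in>#monomial_labels L q n \<pi>. X j i t \<omega>))"
  proof (rule sum.cong[OF refl])
    fix \<pi> assume "\<pi> \<in> circuits (length q) n"
    then have \<pi>: "\<pi> i \<in> {1..n}" if "i \<le> length q" for i using that by (auto simp: circuits_def)
    have "(\<Prod>i<length q. (s \<cdot>\<^sub>m X_mat L X n \<omega> (q ! i)) $$ (\<pi> i - 1, \<pi> (Suc i) - 1)) =
      (\<Prod>i<length q. s * X (fst (q ! i)) (snd (q ! i)) (L (fst (q ! i)) n (\<pi> i) (\<pi> (Suc i))) \<omega>)"
    proof (rule prod.cong[OF refl])
      fix i assume "i \<in> {..<length q}"
      then show "(s \<cdot>\<^sub>m X_mat L X n \<omega> (q ! i)) $$ (\<pi> i - 1, \<pi> (Suc i) - 1) =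
          s * X (fst (q ! i)) (snd (q ! i)) (L (fst (q ! i)) n (\<pi> i) (\<pi> (Suc i))) \<omega>"
        using \<pi>[of i] \<pi>[of "Suc i"] by (cases "q ! i") (auto simp: X_mat_def patterned_mat_def)
    qed
    also have "\<dots> = s ^ length q * (\<Prod>(j, i, t)\<in>#monomial_labels L q n \<pi>. X j i t \<omega>)"
      by (simp add: prod.distrib monomial_labels_def labels_def image_mset.compositionality o_def
          prod_unfold_prod_mset)
    finally show "(\<Prod>i<length q. (s \<cdot>\<^sub>m X_mat L X n \<omega> (q ! i)) $$ (\<pi> i - 1, \<pi> (Suc i) - 1)) =
      s ^ length q * (\<Prod>(j, i, t)\<in>#monomial_labels L q n \<pi>. X j i t \<omega>)" .
  qed
  finally show ?thesis by (simp add: sum_distrib_left)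
qed

lemma inverse_mult_powr: "1 / real n * real n powr (- a) = real n powr (- (1 + a))"
proof -
  have "real n powr (- (1 + a)) = real n powr (- 1 + - a)" by simp
  also have "\<dots> = real n powr (- 1) * real n powr (- a)" by (rule powr_add)
  finally show ?thesis by (simp add: powr_minus_divide)
qed

lemma mu_tilde_circuits:
  "mu_tilde L X q n \<omega> = real n powr (- (1 + real (length q) / 2)) *
     (\<Sum>\<pi>\<in>circuits (length q) n. \<Prod>(j, i, t)\<in>#monomial_labels L q n \<pi>. X j i t \<omega>)"
proof -
  have trace_smult: "mat_trace (c \<cdot>\<^sub>m A) = c * mat_trace A" if "A \<in> carrier_mat n n" for c A
    using that by (simp add: mat_trace_def sum_distrib_left)
  have id: "(1 :: real) \<cdot>\<^sub>m A = A" for A by (rule eq_matI) auto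
  have "mat_list_prod n (map (X_mat L X n \<omega>) q) \<in> carrier_mat n n"
    by (rule mat_list_prod_carrier) (auto simp: X_mat_def patterned_mat_def)
  note trace_smult[OF this]
  moreover have "1 / real n * real n powr (- (real (length q) / 2)) = real n powr (- (1 + real (length q) / 2))"
    by (rule inverse_mult_powr)
  ultimately show ?thesis
    using mat_trace_X_mat[of n 1 L X \<omega> q] unfolding mu_tilde_def id
    by (simp add: mult.assoc[symmetric])
qed

lemma phi1_scaled_monomial: "phi1 n (scaled_monomial L X q n \<omega>) = mu_tilde L X q n \<omega>"
\<comment> \<open>At n = 0 both sides vanish through \<open>1 / real 0 = 0\<close>. The scalings
  themselves disagree there for the empty monomial, since \<open>0 powr 0\<close> is 0 while
  \<open>0 ^ 0\<close> is 1.\<close>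
proof (cases "n = 0")
  case True
  then show ?thesis by (simp add: phi1_def mu_tilde_def)
next
  case False
  have "(1 / sqrt (real n)) ^ length q = real n powr (- (real (length q) / 2))"
  proof -
    have "1 / sqrt (real n) = real n powr (- (1 / 2))"
      using False by (simp add: powr_minus powr_half_sqrt inverse_eq_divide)
    then show ?thesis using False by (simp add: powr_power)
  qed
  moreover have "1 / real n * real n powr (- (real (length q) / 2)) = real n powr (- (1 + real (length q) / 2))"
    by (rule inverse_mult_powr)
  ultimately show ?thesis
    unfolding phi1_def scaled_monomial_def mat_trace_X_mat mu_tilde_circuits
    by (simp add: mult.assoc[symmetric])
qed

lemma phi2_scaled_monomial: "phi2 M n (scaled_monomial L X q n) = mu_hat M L X q n"
  unfolding phi2_def mu_hat_def phi1_scaled_monomial[symmetric, abs_def] phi1_def by simp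

section \<open>Moments of products of independent variables\<close>

lemma prod_mset_le_power:
  fixes f :: "'l \<Rightarrow> real"
  assumes "\<And>l. l \<in># A \<Longrightarrow> 0 \<le> f l \<and> f l \<le> m"
  shows "0 \<le> (\<Prod>l\<in>#A. f l) \<and> (\<Prod>l\<in>#A. f l) \<le> m ^ size A"
  using assms
proof (induction A)
  case (add x A)
  have "0 \<le> f x" "f x \<le> m" using add.prems by auto
  moreover have "0 \<le> (\<Prod>l\<in>#A. f l) \<and> (\<Prod>l\<in>#A. f l) \<le> m ^ size A"
    using add.prems by (intro add.IH) auto
  ultimately show ?case by (auto intro: mult_mono)
qed simp

text \<open>A crude substitute for Hoelder's inequality: the product is at most the largest factor
  to the power \<open>size A\<close>, and that power is one of the summands. The 1 accounts for the
  empty product.\<close>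

lemma prod_mset_le_sum_power:
  fixes f :: "'l \<Rightarrow> real"
  assumes nonneg: "\<And>l. l \<in># A \<Longrightarrow> 0 \<le> f l"
  shows "(\<Prod>l\<in>#A. f l) \<le> 1 + (\<Sum>l\<in>#A. f l ^ size A)"
proof (cases "A = {#}")
  case False
  define m where "m = Max (f ` set_mset A)"
  have "m \<in> f ` set_mset A" using False unfolding m_def by (intro Max_in) auto
  then obtain x where x: "x \<in># A" "f x = m" by auto
  have "(\<Prod>l\<in>#A. f l) \<le> m ^ size A"
    using nonneg prod_mset_le_power[of A f m] by (simp add: m_def)
  also have "\<dots> \<le> (\<Sum>l\<in>#A. f l ^ size A)"
  proof -
    obtain A' where A': "A = add_mset x A'" using x(1) by (metis insert_DiffM)
    have "0 \<le> (\<Sum>l\<in>#A'. f l ^ r)" for r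
      proof -
      have "(\<forall>l\<in>#B. 0 \<le> f l) \<longrightarrow> 0 \<le> (\<Sum>l\<in>#B. f l ^ r)" for B by (induction B) auto
      then show ?thesis using nonneg by (simp add: A')
    qed
    then show ?thesis using x(2) by (subst (3) A') (simp add: algebra_simps)
  qed
  finally show ?thesis by simp
qed simp

lemma abs_prod4_le:
  fixes x y z w :: real
  shows "\<bar>x * (y * z * w)\<bar> \<le> x ^ 4 + y ^ 4 + z ^ 4 + w ^ 4"
proof -
  have sq: "2 * \<bar>a * b\<bar> \<le> a\<^sup>2 + b\<^sup>2" for a b :: real
    using sum_squares_bound[of "\<bar>a\<bar>" "\<bar>b\<bar>"] by (simp add: abs_mult)
  have "2 * \<bar>(x * y) * (z * w)\<bar> \<le> (x * y)\<^sup>2 + (z * w)\<^sup>2" by (rule sq)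
  moreover have "2 * (x * y)\<^sup>2 \<le> x ^ 4 + y ^ 4" "2 * (z * w)\<^sup>2 \<le> z ^ 4 + w ^ 4"
    using sq[of "x\<^sup>2" "y\<^sup>2"] sq[of "z\<^sup>2" "w\<^sup>2"] by (simp_all add: power_mult_distrib)
  moreover have "0 \<le> x ^ 4" "0 \<le> y ^ 4" "0 \<le> z ^ 4" "0 \<le> w ^ 4" by simp_all
  moreover have "x * (y * z * w) = (x * y) * (z * w)" by simp
  ultimately show ?thesis by linarith
qed

lemma diff_power4_le:
  fixes x a :: real
  shows "(x - a) ^ 4 \<le> 8 * x ^ 4 + 8 * a ^ 4"
proof -
  have sq: "(u - v)\<^sup>2 \<le> 2 * u\<^sup>2 + 2 * v\<^sup>2" "(u + v)\<^sup>2 \<le> 2 * u\<^sup>2 + 2 * v\<^sup>2" for u v :: real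
    using sum_squares_bound[of u v] sum_squares_bound[of u "- v"]
    by (simp_all add: power2_eq_square algebra_simps)
  have "(x - a) ^ 4 = ((x - a)\<^sup>2)\<^sup>2" by simp
  also have "\<dots> \<le> (2 * x\<^sup>2 + 2 * a\<^sup>2)\<^sup>2" using sq(1) by (intro power_mono) auto
  also have "\<dots> = 4 * (x\<^sup>2 + a\<^sup>2)\<^sup>2" by (simp add: power2_eq_square algebra_simps)
  also have "\<dots> \<le> 4 * (2 * (x\<^sup>2)\<^sup>2 + 2 * (a\<^sup>2)\<^sup>2)" by (rule mult_left_mono[OF sq(2)]) simp
  finally show ?thesis by simp
qed

section \<open>Random variables with all moments\<close>

context prob_space
begin

text \<open>Unlike integrability, this property passes to products, so the integrability of every
  centered product below is settled by closure rules.\<close>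

definition all_moments :: "('a \<Rightarrow> real) \<Rightarrow> bool" where
  "all_moments f \<longleftrightarrow> f \<in> borel_measurable M \<and> (\<forall>k. integrable M (\<lambda>\<omega>. \<bar>f \<omega>\<bar> ^ k))"

lemma all_moments_bound:
  assumes g: "g \<in> borel_measurable M" and h: "\<And>k. integrable M (h k)"
    and le: "\<And>k \<omega>. \<bar>g \<omega>\<bar> ^ k \<le> h k \<omega>"
  shows "all_moments g"
  unfolding all_moments_def
proof (intro conjI allI g)
  fix k show "integrable M (\<lambda>\<omega>. \<bar>g \<omega>\<bar> ^ k)"
    by (rule Bochner_Integration.integrable_bound[OF h[of k]])
       (use g le[of _ k] in \<open>auto intro!: AE_I2 intro: order_trans[OF _ abs_ge_self]\<close>)
qed

lemma all_moments_const: "all_moments (\<lambda>_. c)"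
  by (simp add: all_moments_def)

lemma all_moments_mult:
  assumes f: "all_moments f" and g: "all_moments g"
  shows "all_moments (\<lambda>\<omega>. f \<omega> * g \<omega>)"
proof (rule all_moments_bound[where h = "\<lambda>k \<omega>. \<bar>f \<omega>\<bar> ^ (2 * k) + \<bar>g \<omega>\<bar> ^ (2 * k)"])
  show "\<bar>f \<omega> * g \<omega>\<bar> ^ k \<le> \<bar>f \<omega>\<bar> ^ (2 * k) + \<bar>g \<omega>\<bar> ^ (2 * k)" for k \<omega>
  proof -
    have nn: "0 \<le> \<bar>f \<omega>\<bar> ^ k" "0 \<le> \<bar>g \<omega>\<bar> ^ k" by simp_all
    then have "0 \<le> \<bar>f \<omega>\<bar> ^ k * \<bar>g \<omega>\<bar> ^ k" by simp
    then show ?thesis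
      using sum_squares_bound[of "\<bar>f \<omega>\<bar> ^ k" "\<bar>g \<omega>\<bar> ^ k"]
      unfolding abs_mult power_mult_distrib power_even_eq by linarith
  qed
qed (use f g in \<open>auto simp: all_moments_def\<close>)

lemma all_moments_diff:
  assumes f: "all_moments f" and g: "all_moments g"
  shows "all_moments (\<lambda>\<omega>. f \<omega> - g \<omega>)"
proof (rule all_moments_bound[where h = "\<lambda>k \<omega>. 2 ^ k * (\<bar>f \<omega>\<bar> ^ k + \<bar>g \<omega>\<bar> ^ k)"])
  show "\<bar>f \<omega> - g \<omega>\<bar> ^ k \<le> 2 ^ k * (\<bar>f \<omega>\<bar> ^ k + \<bar>g \<omega>\<bar> ^ k)" for k \<omega>
  proof -
    let ?m = "max \<bar>f \<omega>\<bar> \<bar>g \<omega>\<bar>"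
    have "\<bar>f \<omega> - g \<omega>\<bar> ^ k \<le> (2 * ?m) ^ k" by (intro power_mono) auto
    also have "\<dots> = 2 ^ k * ?m ^ k" by (rule power_mult_distrib)
    also have "?m ^ k \<le> \<bar>f \<omega>\<bar> ^ k + \<bar>g \<omega>\<bar> ^ k" by (simp add: max_def)
    finally show ?thesis by simp
  qed
qed (use f g in \<open>auto simp: all_moments_def\<close>)

lemma all_moments_power: "all_moments f \<Longrightarrow> all_moments (\<lambda>\<omega>. f \<omega> ^ k)"
  by (induction k) (auto intro: all_moments_const all_moments_mult)

lemma all_moments_integrable: "all_moments f \<Longrightarrow> integrable M f"
  unfolding all_moments_def using integrable_abs_cancel[of M f] by (auto dest: spec[of _ 1])

text \<open>Independence of groups of variables is available for coordinate restrictions, hence the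
  detour through functions \<open>f\<close> and \<open>g\<close> of the coordinates in disjoint
  groups; \<open>F\<close> and \<open>G\<close> are the random variables they represent.\<close>

lemma expectation_restrict_mult:
  fixes V :: "'l \<Rightarrow> 'a \<Rightarrow> real" and f g :: "('l \<Rightarrow> real) \<Rightarrow> real"
  assumes "indep_vars (\<lambda>_. borel) V I" and "J \<inter> K = {}" "J \<subseteq> I" "K \<subseteq> I"
    and f: "f \<in> borel_measurable (PiM J (\<lambda>_. borel))" and g: "g \<in> borel_measurable (PiM K (\<lambda>_. borel))"
    and fF: "\<And>\<omega>. f (restrict (\<lambda>l. V l \<omega>) J) = F \<omega>" and gG: "\<And>\<omega>. g (restrict (\<lambda>l. V l \<omega>) K) = G \<omega>"
    and int: "integrable M F" "integrable M G"
  shows "expectation (\<lambda>\<omega>. F \<omega> * G \<omega>) = expectation F * expectation G"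
proof -
  have "indep_var borel (f \<circ> (\<lambda>\<omega>. restrict (\<lambda>l. V l \<omega>) J)) borel (g \<circ> (\<lambda>\<omega>. restrict (\<lambda>l. V l \<omega>) K))"
    by (rule indep_var_compose[OF indep_var_restrict[OF assms(1-4)] f g])
  then have "indep_var borel F borel G" by (simp add: o_def fF gG)
  then show ?thesis using int by (rule indep_var_lebesgue_integral)
qed

end

section \<open>Products of independent standardized variables over multisets\<close>

lemma measurable_prod_mset_component:
  "set_mset A \<subseteq> J \<Longrightarrow> (\<lambda>v. \<Prod>l\<in>#A. v l :: real) \<in> borel_measurable (PiM J (\<lambda>_. borel))"
  by (induction A) (auto intro!: borel_measurable_times measurable_component_singleton)

lemma prod_mset_restrict:
  "set_mset A \<subseteq> J \<Longrightarrow> (\<Prod>l\<in>#A. restrict v J l) = (\<Prod>l\<in>#A. v l)"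
  by (rule arg_cong[of _ _ prod_mset], rule image_mset_cong) auto

text \<open>There are two label sets because mean, variance and independence are given on all of
  \<open>I\<close>, whereas higher moments are bounded on \<open>S\<close>, the labels that occur as
  matrix entries. The bounds \<open>c\<close> are uniform in the label, which makes all later
  estimates uniform in n.\<close>

locale standardized_variables = prob_space +
  fixes V :: "'l \<Rightarrow> 'a \<Rightarrow> real" and I S :: "'l set" and c :: "nat \<Rightarrow> real"
  assumes indep: "indep_vars (\<lambda>_. borel) V I"
    and S: "S \<subseteq> I"
    and mean: "l \<in> I \<Longrightarrow> expectation (V l) = 0"
    and var: "l \<in> I \<Longrightarrow> expectation (\<lambda>\<omega>. (V l \<omega>)\<^sup>2) = 1"
    and moments: "l \<in> S \<Longrightarrow> integrable M (\<lambda>\<omega>. \<bar>V l \<omega>\<bar> ^ k)"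
      "l \<in> S \<Longrightarrow> expectation (\<lambda>\<omega>. \<bar>V l \<omega>\<bar> ^ k) \<le> c k"
begin

abbreviation vprod :: "'l multiset \<Rightarrow> 'a \<Rightarrow> real" where
  "vprod A \<omega> \<equiv> \<Prod>l\<in>#A. V l \<omega>"

lemma all_moments_V: "l \<in> S \<Longrightarrow> all_moments (V l)"
  using indep S moments(1) unfolding all_moments_def indep_vars_def by auto

lemma all_moments_vprod: "set_mset A \<subseteq> S \<Longrightarrow> all_moments (vprod A)"
  by (induction A) (auto intro!: all_moments_const all_moments_mult all_moments_V)

lemma expectation_vprod:
  assumes A: "set_mset A \<subseteq> S"
  shows "expectation (vprod A) = (\<Prod>l\<in>set_mset A. expectation (\<lambda>\<omega>. V l \<omega> ^ count A l))"
proof -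
  have "indep_vars (\<lambda>_. borel) V (set_mset A)"
    using A S by (intro indep_vars_subset[OF indep]) auto
  then have "indep_vars (\<lambda>_. borel) (\<lambda>l \<omega>. V l \<omega> ^ count A l) (set_mset A)"
    by (rule indep_vars_compose2[where Y = "\<lambda>l x. x ^ count A l"]) auto
  then have "expectation (\<lambda>\<omega>. \<Prod>l\<in>set_mset A. V l \<omega> ^ count A l) =
      (\<Prod>l\<in>set_mset A. expectation (\<lambda>\<omega>. V l \<omega> ^ count A l))"
    using A by (intro indep_vars_lebesgue_integral)
      (auto intro!: all_moments_integrable all_moments_power all_moments_V)
  then show ?thesis by (simp add: image_prod_mset_multiplicity)
qed

lemma expectation_vprod_single:
  assumes A: "set_mset A \<subseteq> S" and x: "count A x = 1"
  shows "expectation (vprod A) = 0"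
proof -
  have "x \<in># A" using x by (simp flip: count_greater_zero_iff)
  moreover have "expectation (\<lambda>\<omega>. V x \<omega> ^ count A x) = 0"
    using x mean[of x] A S \<open>x \<in># A\<close> by auto
  ultimately show ?thesis unfolding expectation_vprod[OF A] by (intro prod_zero) auto
qed

lemma expectation_vprod_pairs:
  assumes A: "set_mset A \<subseteq> S" and 2: "\<And>x. x \<in># A \<Longrightarrow> count A x = 2"
  shows "expectation (vprod A) = 1"
  unfolding expectation_vprod[OF A] using A S 2 var by (intro prod.neutral) auto

text \<open>The bound depends on \<open>A\<close> through its size only; every circuit of length k
  thereby gets one constant, independent of n and of the pattern of its labels.\<close>

lemma expectation_vprod_power_le:
  assumes A: "set_mset A \<subseteq> S"
  shows "expectation (\<lambda>\<omega>. \<bar>vprod A \<omega>\<bar> ^ r) \<le> 1 + real (size A) * c (r * size A)"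
proof -
  let ?k = "size A"
  have int: "integrable M (\<lambda>\<omega>. \<Sum>l\<in>#B. \<bar>V l \<omega>\<bar> ^ N)" and
    le: "expectation (\<lambda>\<omega>. \<Sum>l\<in>#B. \<bar>V l \<omega>\<bar> ^ N) \<le> real (size B) * c N"
    if "set_mset B \<subseteq> S" for B N
  proof -
    have "integrable M (\<lambda>\<omega>. \<Sum>l\<in>#B. \<bar>V l \<omega>\<bar> ^ N) \<and>
       expectation (\<lambda>\<omega>. \<Sum>l\<in>#B. \<bar>V l \<omega>\<bar> ^ N) \<le> real (size B) * c N"
      using that
    proof (induction B)
      case (add x B)
      then show ?case using moments[of x N] by (simp add: algebra_simps)
    qed simp
    then show "integrable M (\<lambda>\<omega>. \<Sum>l\<in>#B. \<bar>V l \<omega>\<bar> ^ N)"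
      "expectation (\<lambda>\<omega>. \<Sum>l\<in>#B. \<bar>V l \<omega>\<bar> ^ N) \<le> real (size B) * c N" by auto
  qed
  have "expectation (\<lambda>\<omega>. \<bar>vprod A \<omega>\<bar> ^ r) \<le> expectation (\<lambda>\<omega>. 1 + (\<Sum>l\<in>#A. \<bar>V l \<omega>\<bar> ^ (r * ?k)))"
  proof (rule integral_mono)
    show "integrable M (\<lambda>\<omega>. \<bar>vprod A \<omega>\<bar> ^ r)"
      using all_moments_vprod[OF A] by (simp add: all_moments_def)
    show "integrable M (\<lambda>\<omega>. 1 + (\<Sum>l\<in>#A. \<bar>V l \<omega>\<bar> ^ (r * ?k)))" using int[OF A] by simp
    fix \<omega>
    have "\<bar>vprod A \<omega>\<bar> ^ r = (\<Prod>l\<in>#A. \<bar>V l \<omega>\<bar> ^ r)"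
      by (induction A) (simp_all add: abs_mult power_mult_distrib)
    also have "\<dots> \<le> 1 + (\<Sum>l\<in>#A. (\<bar>V l \<omega>\<bar> ^ r) ^ ?k)" by (rule prod_mset_le_sum_power) simp
    finally show "\<bar>vprod A \<omega>\<bar> ^ r \<le> 1 + (\<Sum>l\<in>#A. \<bar>V l \<omega>\<bar> ^ (r * ?k))"
      by (simp add: power_mult)
  qed
  also have "\<dots> \<le> 1 + real ?k * c (r * ?k)"
    using int[OF A] le[OF A] by (simp add: prob_space)
  finally show ?thesis .
qed

lemma abs_expectation_vprod_le:
  assumes A: "set_mset A \<subseteq> S"
  shows "\<bar>expectation (vprod A)\<bar> \<le> 1 + real (size A) * c (size A)"
  using expectation_vprod_power_le[OF A, of 1] by (intro order_trans[OF integral_abs_bound]) simp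

text \<open>Only the factor for \<open>A\<close> has to be centered by its mean; \<open>b\<close>,
  \<open>b'\<close> and \<open>b''\<close> are arbitrary. Without a shared label this factor is
  independent of the others and has mean 0; with a shared label there must be a single label of
  \<open>A\<close> foreign to the rest.\<close>

lemma expectation_unlinked:
  assumes A: "set_mset A \<subseteq> S" and BCD: "set_mset (B + C + D) \<subseteq> S"
    and unlinked: "\<not> linked A (B + C + D)"
  shows "expectation (\<lambda>\<omega>. (vprod A \<omega> - expectation (vprod A)) *
      ((vprod B \<omega> - b) * (vprod C \<omega> - b') * (vprod D \<omega> - b''))) = 0"
proof -
  define a where "a = expectation (vprod A)"
  define Z where "Z \<omega> = (vprod B \<omega> - b) * (vprod C \<omega> - b') * (vprod D \<omega> - b'')" for \<omega>
  define z where "z v = ((\<Prod>l\<in>#B. v l) - b) * ((\<Prod>l\<in>#C. v l) - b') * ((\<Prod>l\<in>#D. v l) - b'')"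
    for v :: "'l \<Rightarrow> real"
  have sub: "set_mset B \<subseteq> S" "set_mset C \<subseteq> S" "set_mset D \<subseteq> S" using BCD by auto
  have Z: "all_moments Z" unfolding Z_def
    by (intro all_moments_mult all_moments_diff all_moments_vprod all_moments_const sub)
  have z_meas: "z \<in> borel_measurable (PiM J (\<lambda>_. borel))" if "set_mset (B + C + D) \<subseteq> J" for J
    unfolding z_def using that
    by (intro borel_measurable_times borel_measurable_diff measurable_prod_mset_component) auto
  have zZ: "z (restrict (\<lambda>l. V l \<omega>) J) = Z \<omega>" if "set_mset (B + C + D) \<subseteq> J" for J \<omega>
    using that by (simp add: z_def Z_def prod_mset_restrict del: restrict_apply)
  show ?thesis
  proof (cases "set_mset A \<inter> set_mset (B + C + D) = {}")
    case True
    have "expectation (\<lambda>\<omega>. (vprod A \<omega> - a) * Z \<omega>) = expectation (\<lambda>\<omega>. vprod A \<omega> - a) * expectation Z"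
    proof (rule expectation_restrict_mult[OF indep True])
      show "(\<lambda>v. (\<Prod>l\<in>#A. v l) - a) \<in> borel_measurable (PiM (set_mset A) (\<lambda>_. borel))"
        by (intro borel_measurable_diff measurable_prod_mset_component) auto
      show "z \<in> borel_measurable (PiM (set_mset (B + C + D)) (\<lambda>_. borel))" by (rule z_meas) simp
      show "integrable M (\<lambda>\<omega>. vprod A \<omega> - a)"
        by (intro all_moments_integrable all_moments_diff all_moments_vprod all_moments_const A)
      show "integrable M Z" by (rule all_moments_integrable[OF Z])
    qed (use A BCD S in \<open>auto simp: prod_mset_restrict zZ simp del: restrict_apply\<close>)
    moreover have "expectation (\<lambda>\<omega>. vprod A \<omega> - a) = 0"
      using all_moments_integrable[OF all_moments_vprod[OF A]] by (simp add: a_def prob_space)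
    ultimately show ?thesis by (simp add: a_def Z_def)
  next
    case False
    then obtain x where x: "count A x = 1" "x \<notin># B + C + D" using unlinked by (auto simp: linked_def)
    then have "x \<in># A" by (simp flip: count_greater_zero_iff)
    then obtain A' where A': "A = add_mset x A'" by (metis insert_DiffM)
    have xA': "x \<notin># A'" using x(1) by (simp add: A' count_eq_zero_iff)
    let ?K = "set_mset (A' + B + C + D)"
    \<comment> \<open>The single label makes the mean \<open>a\<close> vanish, so the factor is
      \<open>V x\<close> times the product over \<open>A'\<close>, and \<open>V x\<close> splits off
      as an independent factor of mean 0.\<close>
    have a0: "a = 0" unfolding a_def using A x(1) by (rule expectation_vprod_single)
    have "expectation (\<lambda>\<omega>. V x \<omega> * (vprod A' \<omega> * Z \<omega>)) =
        expectation (V x) * expectation (\<lambda>\<omega>. vprod A' \<omega> * Z \<omega>)"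
    proof (rule expectation_restrict_mult[OF indep, of "{x}" ?K "\<lambda>v. v x" "\<lambda>v. (\<Prod>l\<in>#A'. v l) * z v"])
      show "(\<lambda>v. (\<Prod>l\<in>#A'. v l) * z v) \<in> borel_measurable (PiM ?K (\<lambda>_. borel))"
        by (intro borel_measurable_times measurable_prod_mset_component z_meas) auto
      show "(\<lambda>v. v x) \<in> borel_measurable (PiM {x} (\<lambda>_. borel))"
        by (intro measurable_component_singleton) auto
      show "integrable M (\<lambda>\<omega>. vprod A' \<omega> * Z \<omega>)"
        using A by (intro all_moments_integrable all_moments_mult all_moments_vprod Z) (auto simp: A')
      show "integrable M (V x)"
        using A by (intro all_moments_integrable all_moments_V) (auto simp: A')
      show "(\<Prod>l\<in>#A'. restrict (\<lambda>l. V l \<omega>) ?K l) * z (restrict (\<lambda>l. V l \<omega>) ?K) = vprod A' \<omega> * Z \<omega>" for \<omega>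
        by (subst zZ, force, subst prod_mset_restrict) auto
    qed (use A BCD S x(2) xA' in \<open>auto simp: A'\<close>)
    also have "expectation (V x) = 0" using A S by (intro mean) (auto simp: A')
    finally have "expectation (\<lambda>\<omega>. (vprod A \<omega> - a) * Z \<omega>) = 0" by (simp add: A' a0 mult.assoc)
    then show ?thesis by (simp add: a_def Z_def)
  qed
qed

text \<open>Four fourth moments come from \<open>abs_prod4_le\<close>, each with a factor 8 from
  \<open>diff_power4_le\<close>; hence 32. The two summands bound the fourth moment of a product and
  the fourth power of its mean.\<close>

definition moment4_bound :: "nat \<Rightarrow> real" where
  "moment4_bound k = 32 * ((1 + real k * c (4 * k)) + (1 + real k * c k) ^ 4)"

lemma expectation_centered_product4_le:
  assumes S: "set_mset A \<subseteq> S" "set_mset B \<subseteq> S" "set_mset C \<subseteq> S" "set_mset D \<subseteq> S"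
    and k: "size A = k" "size B = k" "size C = k" "size D = k"
  defines "Y \<equiv> \<lambda>A \<omega>. vprod A \<omega> - expectation (vprod A)"
  shows "\<bar>expectation (\<lambda>\<omega>. Y A \<omega> * (Y B \<omega> * Y C \<omega> * Y D \<omega>))\<bar> \<le> moment4_bound k"
proof -
  have Y: "all_moments (Y E)" if "set_mset E \<subseteq> S" for E
    unfolding Y_def by (intro all_moments_diff all_moments_const all_moments_vprod that)
  have int4: "integrable M (\<lambda>\<omega>. Y E \<omega> ^ 4)" if "set_mset E \<subseteq> S" for E
    by (intro all_moments_integrable all_moments_power Y that)
  have Y4: "expectation (\<lambda>\<omega>. Y E \<omega> ^ 4) \<le> 8 * ((1 + real k * c (4 * k)) + (1 + real k * c k) ^ 4)"
    if E: "set_mset E \<subseteq> S" "size E = k" for E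
  proof -
    let ?e = "expectation (vprod E)"
    have intE: "integrable M (\<lambda>\<omega>. vprod E \<omega> ^ 4)"
      by (intro all_moments_integrable all_moments_power all_moments_vprod E)
    have "expectation (\<lambda>\<omega>. Y E \<omega> ^ 4) \<le> expectation (\<lambda>\<omega>. 8 * vprod E \<omega> ^ 4 + 8 * ?e ^ 4)"
      using int4[OF E(1)] intE unfolding Y_def by (intro integral_mono diff_power4_le) auto
    also have "\<dots> = 8 * expectation (\<lambda>\<omega>. vprod E \<omega> ^ 4) + 8 * ?e ^ 4"
      using intE by (simp add: prob_space)
    also have "expectation (\<lambda>\<omega>. vprod E \<omega> ^ 4) \<le> 1 + real k * c (4 * k)"
      using expectation_vprod_power_le[OF E(1), of 4] E(2) by simp
    also have "?e ^ 4 \<le> (1 + real k * c k) ^ 4"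
      using power_mono[OF abs_expectation_vprod_le[OF E(1)], of 4] E(2) by simp
    finally show ?thesis by simp
  qed
  have "\<bar>expectation (\<lambda>\<omega>. Y A \<omega> * (Y B \<omega> * Y C \<omega> * Y D \<omega>))\<bar>
     \<le> expectation (\<lambda>\<omega>. \<bar>Y A \<omega> * (Y B \<omega> * Y C \<omega> * Y D \<omega>)\<bar>)" by (rule integral_abs_bound)
  also have "\<dots> \<le> expectation (\<lambda>\<omega>. Y A \<omega> ^ 4 + Y B \<omega> ^ 4 + Y C \<omega> ^ 4 + Y D \<omega> ^ 4)"
    using S by (intro integral_mono abs_prod4_le integrable_abs all_moments_integrable all_moments_mult Y
      Bochner_Integration.integrable_add int4)
  also have "\<dots> = expectation (\<lambda>\<omega>. Y A \<omega> ^ 4) + expectation (\<lambda>\<omega>. Y B \<omega> ^ 4) +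
      expectation (\<lambda>\<omega>. Y C \<omega> ^ 4) + expectation (\<lambda>\<omega>. Y D \<omega> ^ 4)"
    using int4 S by simp
  also have "\<dots> \<le> moment4_bound k"
    using Y4[OF S(1) k(1)] Y4[OF S(2) k(2)] Y4[OF S(3) k(3)] Y4[OF S(4) k(4)]
    unfolding moment4_bound_def by linarith
  finally show ?thesis .
qed

end

section \<open>The centered fourth moment\<close>

definition linked4 :: "'l multiset \<Rightarrow> 'l multiset \<Rightarrow> 'l multiset \<Rightarrow> 'l multiset \<Rightarrow> bool" where
  "linked4 A B C D \<longleftrightarrow> linked A (B + C + D) \<and> linked B (A + C + D) \<and>
     linked C (A + B + D) \<and> linked D (A + B + C)"

text \<open>After expansion into quadruples, a member that is not linked to the other three has its
  factor moved to the front, and the expectation is zero. One constant bounds all other terms, so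
  everything reduces to counting quadruples.\<close>

lemma (in standardized_variables) expectation_sum_centered_power4:
  fixes \<Gamma> :: "'g set" and A :: "'g \<Rightarrow> 'l multiset"
  assumes fin: "finite \<Gamma>" and A: "\<And>\<gamma>. \<gamma> \<in> \<Gamma> \<Longrightarrow> set_mset (A \<gamma>) \<subseteq> S" "\<And>\<gamma>. \<gamma> \<in> \<Gamma> \<Longrightarrow> size (A \<gamma>) = k"
  defines "Z \<equiv> \<lambda>\<omega>. \<Sum>\<gamma>\<in>\<Gamma>. vprod (A \<gamma>) \<omega>"
  shows "integrable M (\<lambda>\<omega>. (Z \<omega> - expectation Z) ^ 4)"
    and "expectation (\<lambda>\<omega>. (Z \<omega> - expectation Z) ^ 4) \<le>
      moment4_bound k * real (card {(a, b, c, d) \<in> \<Gamma> \<times> \<Gamma> \<times> \<Gamma> \<times> \<Gamma>. linked4 (A a) (A b) (A c) (A d)})"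
proof -
  define Y where "Y \<gamma> \<omega> = vprod (A \<gamma>) \<omega> - expectation (vprod (A \<gamma>))" for \<gamma> \<omega>
  define T where "T a b c d \<omega> = Y a \<omega> * (Y b \<omega> * Y c \<omega> * Y d \<omega>)" for a b c d \<omega>
  let ?Q = "\<Gamma> \<times> \<Gamma> \<times> \<Gamma> \<times> \<Gamma>"
  have Y: "all_moments (Y \<gamma>)" if "\<gamma> \<in> \<Gamma>" for \<gamma>
    unfolding Y_def by (intro all_moments_diff all_moments_const all_moments_vprod A that)
  have T_int: "integrable M (T a b c d)" if "a \<in> \<Gamma>" "b \<in> \<Gamma>" "c \<in> \<Gamma>" "d \<in> \<Gamma>" for a b c d
    unfolding T_def by (intro all_moments_integrable all_moments_mult Y that)
  have "expectation Z = (\<Sum>\<gamma>\<in>\<Gamma>. expectation (vprod (A \<gamma>)))"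
    unfolding Z_def by (intro Bochner_Integration.integral_sum all_moments_integrable all_moments_vprod A)
  then have "Z \<omega> - expectation Z = (\<Sum>\<gamma>\<in>\<Gamma>. Y \<gamma> \<omega>)" for \<omega>
    by (simp add: Z_def Y_def sum_subtractf)
  moreover have "(\<Sum>\<gamma>\<in>\<Gamma>. Y \<gamma> \<omega>) ^ 4 = (\<Sum>(a, b, c, d)\<in>?Q. T a b c d \<omega>)" for \<omega>
  proof -
    have "(\<Sum>\<gamma>\<in>\<Gamma>. Y \<gamma> \<omega>) ^ 4 =
        (\<Sum>a\<in>\<Gamma>. Y a \<omega>) * ((\<Sum>b\<in>\<Gamma>. Y b \<omega>) * ((\<Sum>c\<in>\<Gamma>. Y c \<omega>) * (\<Sum>d\<in>\<Gamma>. Y d \<omega>)))"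
      by (simp add: power4_eq_xxxx mult.assoc)
    also have "\<dots> = (\<Sum>a\<in>\<Gamma>. \<Sum>b\<in>\<Gamma>. \<Sum>c\<in>\<Gamma>. \<Sum>d\<in>\<Gamma>. T a b c d \<omega>)"
      by (simp add: T_def mult.assoc flip: sum_distrib_left sum_distrib_right)
    also have "\<dots> = (\<Sum>(a, b, c, d)\<in>?Q. T a b c d \<omega>)"
      by (simp only: sum.cartesian_product case_prod_beta' fst_conv snd_conv)
    finally show ?thesis .
  qed
  ultimately have eq: "(\<lambda>\<omega>. (Z \<omega> - expectation Z) ^ 4) = (\<lambda>\<omega>. \<Sum>(a, b, c, d)\<in>?Q. T a b c d \<omega>)" by simp
  show "integrable M (\<lambda>\<omega>. (Z \<omega> - expectation Z) ^ 4)"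
    unfolding eq by (rule Bochner_Integration.integrable_sum) (use T_int in auto)
  have "expectation (\<lambda>\<omega>. (Z \<omega> - expectation Z) ^ 4) = (\<Sum>(a, b, c, d)\<in>?Q. expectation (T a b c d))"
    unfolding eq by (subst Bochner_Integration.integral_sum) (use T_int in \<open>auto simp: case_prod_beta' intro!: sum.cong\<close>)
  also have "\<dots> \<le> (\<Sum>(a, b, c, d)\<in>?Q. moment4_bound k * of_bool (linked4 (A a) (A b) (A c) (A d)))"
  proof (intro sum_mono, clarify)
    fix a b c d assume abcd: "a \<in> \<Gamma>" "b \<in> \<Gamma>" "c \<in> \<Gamma>" "d \<in> \<Gamma>"
    show "expectation (T a b c d) \<le> moment4_bound k * of_bool (linked4 (A a) (A b) (A c) (A d))"
    proof (cases "linked4 (A a) (A b) (A c) (A d)")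
      case True
      then show ?thesis
        using expectation_centered_product4_le[of "A a" "A b" "A c" "A d" k] A abcd
        by (simp add: T_def[abs_def] Y_def[abs_def] abs_le_iff)
    next
      case False
      have sub: "set_mset (A x + A y + A z) \<subseteq> S" if "x \<in> \<Gamma>" "y \<in> \<Gamma>" "z \<in> \<Gamma>" for x y z
        using A(1) that by auto
      have 0: "expectation (T x y z u) = 0"
        if "x \<in> \<Gamma>" "y \<in> \<Gamma>" "z \<in> \<Gamma>" "u \<in> \<Gamma>" "\<not> linked (A x) (A y + A z + A u)" for x y z u
        unfolding T_def Y_def using that by (intro expectation_unlinked A sub)
      have perm: "T a b c d = T b a c d" "T a b c d = T c a b d" "T a b c d = T d a b c"
        by (auto simp: T_def fun_eq_iff)
      have "expectation (T a b c d) = 0"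
        using False 0[OF abcd] 0[OF abcd(2,1,3,4)] 0[OF abcd(3,1,2,4)] 0[OF abcd(4,1,2,3)]
        unfolding linked4_def perm[symmetric] by blast
      then show ?thesis using False by simp
    qed
  qed
  also have "\<dots> = moment4_bound k * (\<Sum>x\<in>?Q. of_bool (x \<in> {(a, b, c, d). linked4 (A a) (A b) (A c) (A d)}))"
    by (simp add: case_prod_beta' sum_distrib_left del: of_bool_eq_1_iff sum_of_bool_eq)
  also have "(\<Sum>x\<in>?Q. of_bool (x \<in> {(a, b, c, d). linked4 (A a) (A b) (A c) (A d)})) =
      real (card {(a, b, c, d) \<in> ?Q. linked4 (A a) (A b) (A c) (A d)})"
    using fin by (subst sum_of_bool_eq) (auto intro!: arg_cong[of _ _ card])
  finally show "expectation (\<lambda>\<omega>. (Z \<omega> - expectation Z) ^ 4) \<le>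
      moment4_bound k * real (card {(a, b, c, d) \<in> ?Q. linked4 (A a) (A b) (A c) (A d)})" .
qed

text \<open>Four starting vertices and at most 2k labels would allow n^(2k+4) quadruples; each
  alternative of \<open>linked_quadruple_cases\<close> takes off n^2. The constant mirrors these
  alternatives: 1 for no cut, \<open>4 * k\<close> for a cut in one of four circuits,
  \<open>2 * k^2\<close> for two cuts starting from either of two circuits.\<close>

lemma card_linked4_circuits:
  fixes lab :: "nat \<Rightarrow> nat \<Rightarrow> nat \<Rightarrow> 'l" and \<Delta> :: real
  assumes lab: "\<And>i a t. a \<in> {1..n} \<Longrightarrow> i < k \<Longrightarrow> real (card {b \<in> {1..n}. lab i a b = t}) \<le> \<Delta>"
    and n: "n \<ge> 1" and \<Delta>: "\<Delta> \<ge> 0"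
  defines "A \<equiv> labels lab k" and "\<Gamma> \<equiv> circuits k n"
  shows "real (card {(a, b, c, d) \<in> \<Gamma> \<times> \<Gamma> \<times> \<Gamma> \<times> \<Gamma>. linked4 (A a) (A b) (A c) (A d)})
    \<le> (1 + 4 * real k + 2 * (real k)\<^sup>2) * ((4 * real k * \<Delta> + 1) ^ k) ^ 4 * real n ^ (2 * k + 2)"
\<comment> \<open>Empty circuits share no labels. They are set apart because the exponents
  \<open>2 * k - 2\<close> and \<open>2 * k - 1\<close> below are truncated at
  \<open>k = 0\<close>.\<close>
proof (cases "k = 0")
  case True
  then have "\<not> linked4 (A a) (A b) (A c) (A d)" for a b c d
    by (simp add: A_def labels_def linked4_def linked_def)
  then have "{(a, b, c, d) \<in> \<Gamma> \<times> \<Gamma> \<times> \<Gamma> \<times> \<Gamma>. linked4 (A a) (A b) (A c) (A d)} = {}" by auto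
  then have "card {(a, b, c, d) \<in> \<Gamma> \<times> \<Gamma> \<times> \<Gamma> \<times> \<Gamma>. linked4 (A a) (A b) (A c) (A d)} = 0"
    by (simp only: card.empty)
  then show ?thesis using \<Delta> by (simp only: of_nat_0) simp
next
  case False
  \<comment> \<open>The \<open>4 * k\<close> is the value of \<open>r\<close> in the weight lemmas:
    at most \<open>3 * k\<close> labels of the circuits placed earlier, plus \<open>k\<close> of the
    current one.\<close>
  define B where "B = (4 * real k * \<Delta> + 1) ^ k"
  define u where "u K \<pi> = (1 / real n) ^ card (set_mset (A \<pi>) - K)" for K \<pi>
  define w where "w a b c d = (1 / real n) ^ card (set_mset (A a + A b + A c + A d))" for a b c d
  define s where "s a = (of_bool (has_fresh_single {} (A a)) :: real)" for a
  define t where "t a b = (of_bool (has_fresh_single (set_mset (A a)) (A b)) :: real)" for a b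
  define Q where "Q = \<Gamma> \<times> \<Gamma> \<times> \<Gamma> \<times> \<Gamma>"
  have B0: "B \<ge> 0" using \<Delta> by (simp add: B_def)
  have fin: "finite \<Gamma>" unfolding \<Gamma>_def by (rule finite_circuits)
  have cardA: "card (set_mset (A a)) \<le> k" for a
    unfolding A_def set_mset_labels using card_image_le[of "{..<k}"] by simp
  have u_sum: "(\<Sum>\<pi>\<in>\<Gamma>. u K \<pi>) \<le> B * real n" if "finite K" "card K \<le> 3 * k" for K
    unfolding u_def A_def \<Gamma>_def B_def
    using circuits_weight[of n k lab \<Delta> K "4 * k"] lab n \<Delta> that by (simp add: mult.assoc)
  have u_fresh: "(\<Sum>\<pi>\<in>\<Gamma>. of_bool (has_fresh_single K (A \<pi>)) * u K \<pi>) \<le> real k * B"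
    if "finite K" "card K \<le> 3 * k" for K
  proof -
    have "(\<Sum>\<pi>\<in>\<Gamma>. of_bool (has_fresh_single K (A \<pi>)) * u K \<pi>) =
        (\<Sum>\<pi> | \<pi> \<in> \<Gamma> \<and> has_fresh_single K (A \<pi>). u K \<pi>)"
      using fin by (intro sum.mono_neutral_cong_right) auto
    also have "\<dots> \<le> real k * B"
      unfolding u_def A_def \<Gamma>_def B_def
      using circuits_fresh_single_weight[of n k lab \<Delta> K "4 * k"] lab n \<Delta> that by (simp add: mult.assoc)
    finally show ?thesis .
  qed
  \<comment> \<open>Each label is charged to the first circuit in which it appears, so the joint
    weight is a product of weights relative to the labels met before.\<close>
  have w_split: "w a b c d = u {} a * (u (set_mset (A a)) b *
      (u (set_mset (A a + A b)) c * u (set_mset (A a + A b + A c)) d))" for a b c d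
  proof -
    have "card (set_mset (A + B)) = card (set_mset A) + card (set_mset B - set_mset A)" for A B :: "'l multiset"
      using card_Un_disjoint[of "set_mset A" "set_mset B - set_mset A"] by (simp add: Un_Diff_cancel)
    then show ?thesis by (simp only: w_def u_def Diff_empty power_add mult.assoc)
  qed
  have w0: "w a b c d \<ge> 0" for a b c d by (simp add: w_def)
  \<comment> \<open>The inner sums have bounds that do not depend on the earlier circuits, so the
    quadruple sum collapses one circuit at a time, from the last to the first. The weights
    \<open>f\<close> and \<open>g\<close> are 1 or the indicators that activate a cut in the first
    and second circuit.\<close>
  have Q_sum: "(\<Sum>(a, b, c, d)\<in>Q. f a * (g a b * w a b c d)) \<le> \<beta> * (\<beta>' * (B * real n)\<^sup>2)"
    if f: "\<And>a. f a \<ge> 0" "(\<Sum>a\<in>\<Gamma>. f a * u {} a) \<le> \<beta>"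
      and g: "\<And>a b. g a b \<ge> 0" "\<And>a. (\<Sum>b\<in>\<Gamma>. g a b * u (set_mset (A a)) b) \<le> \<beta>'"
      and \<beta>: "\<beta>' \<ge> 0"
    for f :: "(nat \<Rightarrow> nat) \<Rightarrow> real" and g :: "(nat \<Rightarrow> nat) \<Rightarrow> (nat \<Rightarrow> nat) \<Rightarrow> real" and \<beta> \<beta>'
  proof -
    have u0: "u K \<pi> \<ge> 0" for K \<pi> by (simp add: u_def)
    have c3: "card (set_mset (A a + A b + A c)) \<le> 3 * k" for a b c
      using cardA[of a] cardA[of b] cardA[of c] card_Un_le[of "set_mset (A a)" "set_mset (A b)"]
        card_Un_le[of "set_mset (A a) \<union> set_mset (A b)" "set_mset (A c)"] by simp
    have c2: "card (set_mset (A a + A b)) \<le> 3 * k" for a b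
      using cardA[of a] cardA[of b] card_Un_le[of "set_mset (A a)" "set_mset (A b)"] by simp
    have cd: "(\<Sum>c\<in>\<Gamma>. \<Sum>d\<in>\<Gamma>. u (set_mset (A a + A b)) c * u (set_mset (A a + A b + A c)) d) \<le> (B * real n)\<^sup>2"
      for a b
    proof -
      have "(\<Sum>c\<in>\<Gamma>. \<Sum>d\<in>\<Gamma>. u (set_mset (A a + A b)) c * u (set_mset (A a + A b + A c)) d) =
          (\<Sum>c\<in>\<Gamma>. u (set_mset (A a + A b)) c * (\<Sum>d\<in>\<Gamma>. u (set_mset (A a + A b + A c)) d))"
        by (simp only: sum_distrib_left)
      also have "\<dots> \<le> (\<Sum>c\<in>\<Gamma>. u (set_mset (A a + A b)) c * (B * real n))"
        by (intro sum_mono mult_left_mono u_sum finite_set_mset c3 u0)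
      also have "\<dots> = (\<Sum>c\<in>\<Gamma>. u (set_mset (A a + A b)) c) * (B * real n)"
        by (simp only: sum_distrib_right)
      also have "\<dots> \<le> (B * real n) * (B * real n)"
        by (intro mult_right_mono u_sum finite_set_mset c2) (use B0 in simp)
      finally show ?thesis by (simp only: power2_eq_square)
    qed
    have "(\<Sum>(a, b, c, d)\<in>Q. f a * (g a b * w a b c d)) =
        (\<Sum>a\<in>\<Gamma>. \<Sum>b\<in>\<Gamma>. \<Sum>c\<in>\<Gamma>. \<Sum>d\<in>\<Gamma>. f a * (g a b * w a b c d))"
      by (simp only: Q_def sum.cartesian_product case_prod_beta' fst_conv snd_conv)
    also have "\<dots> = (\<Sum>a\<in>\<Gamma>. (f a * u {} a) * (\<Sum>b\<in>\<Gamma>. (g a b * u (set_mset (A a)) b) *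
        (\<Sum>c\<in>\<Gamma>. \<Sum>d\<in>\<Gamma>. u (set_mset (A a + A b)) c * u (set_mset (A a + A b + A c)) d)))"
      by (simp only: w_split sum_distrib_left mult_ac)
    also have "\<dots> \<le> (\<Sum>a\<in>\<Gamma>. (f a * u {} a) * (\<Sum>b\<in>\<Gamma>. (g a b * u (set_mset (A a)) b) * (B * real n)\<^sup>2))"
      by (intro sum_mono mult_left_mono cd mult_nonneg_nonneg f g u0)
    also have "\<dots> = (\<Sum>a\<in>\<Gamma>. (f a * u {} a) * ((\<Sum>b\<in>\<Gamma>. g a b * u (set_mset (A a)) b) * (B * real n)\<^sup>2))"
      by (simp only: sum_distrib_right)
    also have "\<dots> \<le> (\<Sum>a\<in>\<Gamma>. (f a * u {} a) * (\<beta>' * (B * real n)\<^sup>2))"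
      by (intro sum_mono mult_left_mono mult_right_mono mult_nonneg_nonneg f g u0) simp
    also have "\<dots> = (\<Sum>a\<in>\<Gamma>. f a * u {} a) * (\<beta>' * (B * real n)\<^sup>2)" by (simp only: sum_distrib_right)
    also have "\<dots> \<le> \<beta> * (\<beta>' * (B * real n)\<^sup>2)" using \<beta> by (intro mult_right_mono f) simp
    finally show ?thesis .
  qed
  have s0: "s a \<ge> 0" "t a b \<ge> 0" for a b by (simp_all add: s_def t_def)
  have sum_u: "(\<Sum>a\<in>\<Gamma>. 1 * u {} a) \<le> B * real n" "(\<Sum>b\<in>\<Gamma>. 1 * u (set_mset (A a)) b) \<le> B * real n" for a
    using u_sum[of "{}"] u_sum[of "set_mset (A a)"] cardA[of a] by simp_all
  have sum_su: "(\<Sum>a\<in>\<Gamma>. s a * u {} a) \<le> real k * B" "(\<Sum>b\<in>\<Gamma>. t a b * u (set_mset (A a)) b) \<le> real k * B" for a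
    unfolding s_def t_def using u_fresh[of "{}"] u_fresh[of "set_mset (A a)"] cardA[of a] by simp_all
  have Bn: "B * real n \<ge> 0" "real k * B \<ge> 0" using B0 by simp_all
  have "(\<Sum>(a, b, c, d)\<in>Q. 1 * (1 * w a b c d)) \<le> B * real n * (B * real n * (B * real n)\<^sup>2)"
    by (rule Q_sum) (use sum_u Bn in auto)
  then have sum_w: "(\<Sum>(a, b, c, d)\<in>Q. w a b c d) \<le> B ^ 4 * real n ^ 4"
    by (simp add: power2_eq_square power4_eq_xxxx mult_ac)
  have "(\<Sum>(a, b, c, d)\<in>Q. s a * (1 * w a b c d)) \<le> real k * B * (B * real n * (B * real n)\<^sup>2)"
    by (rule Q_sum) (use sum_u sum_su s0 Bn in auto)
  then have sum_sw: "(\<Sum>(a, b, c, d)\<in>Q. s a * w a b c d) \<le> real k * B ^ 4 * real n ^ 3"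
    by (simp add: power2_eq_square power3_eq_cube power4_eq_xxxx mult_ac)
  have "(\<Sum>(a, b, c, d)\<in>Q. s a * (t a b * w a b c d)) \<le> real k * B * (real k * B * (B * real n)\<^sup>2)"
    by (rule Q_sum) (use sum_su s0 Bn in auto)
  then have sum_stw: "(\<Sum>(a, b, c, d)\<in>Q. s a * (t a b * w a b c d)) \<le> (real k)\<^sup>2 * B ^ 4 * (real n)\<^sup>2"
    by (simp add: power2_eq_square power4_eq_xxxx mult_ac)
  \<comment> \<open>The weight \<open>w\<close> is symmetric in the four circuits, so transpositions
    bring the cut circuits to the front and the three estimates above suffice.\<close>
  have swap: "(\<Sum>(a, b, c, d)\<in>Q. F a b c d) = (\<Sum>(a, b, c, d)\<in>Q. F b a c d)"
    "(\<Sum>(a, b, c, d)\<in>Q. F a b c d) = (\<Sum>(a, b, c, d)\<in>Q. F c b a d)"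
    "(\<Sum>(a, b, c, d)\<in>Q. F a b c d) = (\<Sum>(a, b, c, d)\<in>Q. F d b c a)" for F :: "_ \<Rightarrow> _ \<Rightarrow> _ \<Rightarrow> _ \<Rightarrow> real"
    unfolding Q_def
    by (rule sum.reindex_bij_witness[of _ "\<lambda>(a, b, c, d). (b, a, c, d)" "\<lambda>(a, b, c, d). (b, a, c, d)"], auto)
      (rule sum.reindex_bij_witness[of _ "\<lambda>(a, b, c, d). (c, b, a, d)" "\<lambda>(a, b, c, d). (c, b, a, d)"], auto,
       rule sum.reindex_bij_witness[of _ "\<lambda>(a, b, c, d). (d, b, c, a)" "\<lambda>(a, b, c, d). (d, b, c, a)"], auto)
  define N where "N = real n"
  have N: "N \<ge> 1" using n by (simp add: N_def)
  \<comment> \<open>With m labels, \<open>N ^ r * w a b c d\<close> is at least 1 as soon as m is at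
    most \<open>r\<close>. Taking for \<open>r\<close> the bound on m in each alternative makes one
    summand at least 1, and the others are nonnegative.\<close>
  have pointwise: "of_bool (linked4 (A a) (A b) (A c) (A d)) \<le>
      N ^ (2 * k - 2) * w a b c d +
      N ^ (2 * k - 1) * (s a * w a b c d + s b * w a b c d + s c * w a b c d + s d * w a b c d) +
      N ^ (2 * k) * (s a * (t a b * w a b c d) + s c * (t c b * w a b c d))" (is "_ \<le> ?r1 + ?r2 + ?r3")
    for a b c d
  proof (cases "linked4 (A a) (A b) (A c) (A d)")
    case False
    then show ?thesis using w0 s0 N by (auto intro!: add_nonneg_nonneg mult_nonneg_nonneg)
  next
    case True
    define m where "m = card (set_mset (A a + A b + A c + A d))"
    have nonneg: "?r1 \<ge> 0" "?r2 \<ge> 0" "?r3 \<ge> 0"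
      using w0 s0 N by (auto intro!: add_nonneg_nonneg mult_nonneg_nonneg)
    have one: "1 \<le> N ^ r * w a b c d" if "m \<le> r" for r
    proof -
      have "N ^ r * (1 / N) ^ m = N ^ (r - m)"
        using that N by (simp add: power_diff power_one_over)
      also have "\<dots> \<ge> 1" using N by (rule one_le_power)
      finally show ?thesis by (simp add: w_def m_def N_def)
    qed
    have "m + 2 \<le> 2 * k \<or>
       m + 1 \<le> 2 * k \<and> (\<exists>E\<in>{A a, A b, A c, A d}. has_fresh_single {} E) \<or>
       m \<le> 2 * k \<and> (has_fresh_single {} (A a) \<and> has_fresh_single (set_mset (A a)) (A b) \<or>
                      has_fresh_single {} (A c) \<and> has_fresh_single (set_mset (A c)) (A b))"
      unfolding m_def using True unfolding linked4_def
      by (intro linked_quadruple_cases) (auto simp: A_def size_labels)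
    then consider (1) "m \<le> 2 * k - 2"
      | (2) "m \<le> 2 * k - 1" "s a = 1 \<or> s b = 1 \<or> s c = 1 \<or> s d = 1"
      | (3) "m \<le> 2 * k" "s a = 1 \<and> t a b = 1 \<or> s c = 1 \<and> t c b = 1"
      unfolding s_def t_def by fastforce
    then have "1 \<le> ?r1 \<or> 1 \<le> ?r2 \<or> 1 \<le> ?r3"
    proof cases
      case 1
      then show ?thesis using one by blast
    next
      case 2
      have "w a b c d \<le> s a * w a b c d + s b * w a b c d + s c * w a b c d + s d * w a b c d"
        using 2(2) w0 s0 by (auto intro!: add_nonneg_nonneg mult_nonneg_nonneg)
      then have "N ^ (2 * k - 1) * w a b c d \<le> ?r2" using N by (intro mult_left_mono) auto
      then show ?thesis using one[OF 2(1)] by linarith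
    next
      case 3
      have "w a b c d \<le> s a * (t a b * w a b c d) + s c * (t c b * w a b c d)"
        using 3(2) w0 s0 by (auto intro!: add_nonneg_nonneg mult_nonneg_nonneg)
      then have "N ^ (2 * k) * w a b c d \<le> ?r3" using N by (intro mult_left_mono) auto
      then show ?thesis using one[OF 3(1)] by linarith
    qed
    then show ?thesis using nonneg True by auto
  qed
  have "real (card {(a, b, c, d) \<in> \<Gamma> \<times> \<Gamma> \<times> \<Gamma> \<times> \<Gamma>. linked4 (A a) (A b) (A c) (A d)}) =
      (\<Sum>x\<in>Q. of_bool (x \<in> {(a, b, c, d). linked4 (A a) (A b) (A c) (A d)}))"
    using fin by (subst sum_of_bool_eq) (auto simp: Q_def intro!: arg_cong[of _ _ card])
  also have "\<dots> \<le> (\<Sum>(a, b, c, d)\<in>Q. N ^ (2 * k - 2) * w a b c d +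
      N ^ (2 * k - 1) * (s a * w a b c d + s b * w a b c d + s c * w a b c d + s d * w a b c d) +
      N ^ (2 * k) * (s a * (t a b * w a b c d) + s c * (t c b * w a b c d)))"
  proof (rule sum_mono)
    fix x :: "(nat \<Rightarrow> nat) \<times> (nat \<Rightarrow> nat) \<times> (nat \<Rightarrow> nat) \<times> (nat \<Rightarrow> nat)"
    obtain a b c d where x: "x = (a, b, c, d)" by (cases x)
    show "of_bool (x \<in> {(a, b, c, d). linked4 (A a) (A b) (A c) (A d)}) \<le>
        (case x of (a, b, c, d) \<Rightarrow> N ^ (2 * k - 2) * w a b c d +
      N ^ (2 * k - 1) * (s a * w a b c d + s b * w a b c d + s c * w a b c d + s d * w a b c d) +
      N ^ (2 * k) * (s a * (t a b * w a b c d) + s c * (t c b * w a b c d)))"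
      using pointwise[of a b c d] by (simp only: x mem_Collect_eq case_prod_conv)
  qed
  also have "\<dots> = N ^ (2 * k - 2) * (\<Sum>(a, b, c, d)\<in>Q. w a b c d) +
      N ^ (2 * k - 1) * ((\<Sum>(a, b, c, d)\<in>Q. s a * w a b c d) + (\<Sum>(a, b, c, d)\<in>Q. s b * w a b c d) +
         (\<Sum>(a, b, c, d)\<in>Q. s c * w a b c d) + (\<Sum>(a, b, c, d)\<in>Q. s d * w a b c d)) +
      N ^ (2 * k) * ((\<Sum>(a, b, c, d)\<in>Q. s a * (t a b * w a b c d)) + (\<Sum>(a, b, c, d)\<in>Q. s c * (t c b * w a b c d)))"
    by (simp only: case_prod_beta' sum.distrib sum_distrib_left distrib_left)
  also have "(\<Sum>(a, b, c, d)\<in>Q. s b * w a b c d) = (\<Sum>(a, b, c, d)\<in>Q. s a * w a b c d)"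
    by (subst swap(1)) (simp add: w_def Un_ac)
  also have "(\<Sum>(a, b, c, d)\<in>Q. s c * w a b c d) = (\<Sum>(a, b, c, d)\<in>Q. s a * w a b c d)"
    by (subst swap(2)) (simp add: w_def Un_ac)
  also have "(\<Sum>(a, b, c, d)\<in>Q. s d * w a b c d) = (\<Sum>(a, b, c, d)\<in>Q. s a * w a b c d)"
    by (subst swap(3)) (simp add: w_def Un_ac)
  also have "(\<Sum>(a, b, c, d)\<in>Q. s c * (t c b * w a b c d)) = (\<Sum>(a, b, c, d)\<in>Q. s a * (t a b * w a b c d))"
    by (subst swap(2)) (simp add: w_def Un_ac)
  also have "N ^ (2 * k - 2) * (\<Sum>(a, b, c, d)\<in>Q. w a b c d) +
      N ^ (2 * k - 1) * ((\<Sum>(a, b, c, d)\<in>Q. s a * w a b c d) + (\<Sum>(a, b, c, d)\<in>Q. s a * w a b c d) +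
         (\<Sum>(a, b, c, d)\<in>Q. s a * w a b c d) + (\<Sum>(a, b, c, d)\<in>Q. s a * w a b c d)) +
      N ^ (2 * k) * ((\<Sum>(a, b, c, d)\<in>Q. s a * (t a b * w a b c d)) + (\<Sum>(a, b, c, d)\<in>Q. s a * (t a b * w a b c d)))
    \<le> N ^ (2 * k - 2) * (B ^ 4 * N ^ 4) +
      N ^ (2 * k - 1) * (real k * B ^ 4 * N ^ 3 + real k * B ^ 4 * N ^ 3 + real k * B ^ 4 * N ^ 3 + real k * B ^ 4 * N ^ 3) +
      N ^ (2 * k) * ((real k)\<^sup>2 * B ^ 4 * N\<^sup>2 + (real k)\<^sup>2 * B ^ 4 * N\<^sup>2)"
    using N sum_w sum_sw sum_stw unfolding N_def[symmetric]
    by (intro add_mono mult_left_mono) auto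
  also have "\<dots> = (1 + 4 * real k + 2 * (real k)\<^sup>2) * B ^ 4 * N ^ (2 * k + 2)"
  proof -
    have "N ^ (2 * k - 2) * N ^ 4 = N ^ (2 * k + 2)" "N ^ (2 * k - 1) * N ^ 3 = N ^ (2 * k + 2)"
      "N ^ (2 * k) * N\<^sup>2 = N ^ (2 * k + 2)"
      using False by (simp_all flip: power_add)
    note p = this[symmetric]
    have "(1 + 4 * real k + 2 * (real k)\<^sup>2) * B ^ 4 * N ^ (2 * k + 2) =
        B ^ 4 * N ^ (2 * k + 2) + 4 * real k * B ^ 4 * N ^ (2 * k + 2) + 2 * (real k)\<^sup>2 * B ^ 4 * N ^ (2 * k + 2)"
      by (simp add: algebra_simps)
    also have "\<dots> = B ^ 4 * (N ^ (2 * k - 2) * N ^ 4) + 4 * real k * B ^ 4 * (N ^ (2 * k - 1) * N ^ 3) +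
        2 * (real k)\<^sup>2 * B ^ 4 * (N ^ (2 * k) * N\<^sup>2)" by (simp only: p[symmetric])
    finally show ?thesis by (simp add: algebra_simps)
  qed
  finally show ?thesis by (simp add: B_def N_def)
qed

section \<open>Paired circuits and words\<close>

definition paired_circuits :: "(nat \<Rightarrow> nat \<Rightarrow> nat \<Rightarrow> 'l) \<Rightarrow> nat \<Rightarrow> nat \<Rightarrow> (nat \<Rightarrow> nat) set" where
  "paired_circuits lab k n = {\<pi> \<in> circuits k n. \<forall>x\<in>#labels lab k \<pi>. count (labels lab k \<pi>) x = 2}"

text \<open>The common error class of two comparisons: of expectations with paired circuits and of
  words with paired circuits. The factor 2 avoids halving an odd \<open>k\<close>.\<close>

definition few_label_circuits :: "(nat \<Rightarrow> nat \<Rightarrow> nat \<Rightarrow> 'l) \<Rightarrow> nat \<Rightarrow> nat \<Rightarrow> (nat \<Rightarrow> nat) set" where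
  "few_label_circuits lab k n = {\<pi> \<in> circuits k n. 2 * card (set_mset (labels lab k \<pi>)) < k}"

lemma matched_not_paired:
  assumes \<pi>: "\<pi> \<in> circuits k n" "\<pi> \<notin> paired_circuits lab k n"
    and ge2: "\<And>x. x \<in># labels lab k \<pi> \<Longrightarrow> count (labels lab k \<pi>) x \<ge> 2"
  shows "\<pi> \<in> few_label_circuits lab k n"
proof -
  let ?A = "labels lab k \<pi>"
  obtain x where x: "x \<in># ?A" "count ?A x \<noteq> 2" using \<pi> by (auto simp: paired_circuits_def)
  then have "count ?A x - 2 \<ge> 1" using ge2[of x] by linarith
  also have "count ?A x - 2 \<le> (\<Sum>x\<in>set_mset ?A. count ?A x - 2)" using x by (intro member_le_sum) auto
  finally show ?thesis
    using excess_sum[of ?A] ge2 \<pi> by (simp add: few_label_circuits_def size_labels)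
qed

text \<open>Fewer than k/2 labels means at most (k - 1)/2, which leaves the count half a power of n
  short of the normalization n^(1 + k/2). Real exponents treat both parities of k at once.\<close>

lemma card_few_label_circuits:
  fixes lab :: "nat \<Rightarrow> nat \<Rightarrow> nat \<Rightarrow> 'l" and \<Delta> :: real
  assumes lab: "\<And>i a t. a \<in> {1..n} \<Longrightarrow> i < k \<Longrightarrow> real (card {b \<in> {1..n}. lab i a b = t}) \<le> \<Delta>"
    and n: "n \<ge> 1" and \<Delta>: "\<Delta> \<ge> 0"
  shows "real (card (few_label_circuits lab k n)) \<le> (real k * \<Delta> + 1) ^ k * real n powr (1 / 2 + real k / 2)"
proof -
  let ?R = "few_label_circuits lab k n"
  let ?d = "\<lambda>\<pi>. card (set_mset (labels lab k \<pi>))"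
  have fin: "finite ?R" unfolding few_label_circuits_def using finite_circuits by simp
  have "real (card ?R) * (1 / real n) powr (real k / 2 - 1 / 2) = (\<Sum>\<pi>\<in>?R. (1 / real n) powr (real k / 2 - 1 / 2))"
    by simp
  also have "\<dots> \<le> (\<Sum>\<pi>\<in>?R. (1 / real n) ^ ?d \<pi>)"
  proof (rule sum_mono)
    fix \<pi> assume "\<pi> \<in> ?R"
    then have "2 * ?d \<pi> + 1 \<le> k" by (simp add: few_label_circuits_def)
    then have "real (?d \<pi>) \<le> real k / 2 - 1 / 2" by linarith
    then have "(1 / real n) powr (real k / 2 - 1 / 2) \<le> (1 / real n) powr real (?d \<pi>)"
      using n by (intro powr_mono') auto
    then show "(1 / real n) powr (real k / 2 - 1 / 2) \<le> (1 / real n) ^ ?d \<pi>"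
      using n by (simp add: powr_realpow)
  qed
  also have "\<dots> \<le> (\<Sum>\<pi>\<in>circuits k n. (1 / real n) ^ ?d \<pi>)"
    by (rule sum_mono2) (auto simp: few_label_circuits_def finite_circuits)
  also have "\<dots> \<le> (real k * \<Delta> + 1) ^ k * real n"
    using circuits_weight[of n k lab \<Delta> "{}" k] lab n \<Delta> by simp
  finally have le: "real (card ?R) * (1 / real n) powr (real k / 2 - 1 / 2) \<le> (real k * \<Delta> + 1) ^ k * real n" .
  have "real (card ?R) = real (card ?R) * (1 / real n) powr (real k / 2 - 1 / 2) * real n powr (real k / 2 - 1 / 2)"
    using n by (simp add: powr_divide)
  also have "\<dots> \<le> (real k * \<Delta> + 1) ^ k * real n * real n powr (real k / 2 - 1 / 2)"
    using le by (rule mult_right_mono) simp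
  also have "\<dots> = (real k * \<Delta> + 1) ^ k * real n powr (1 / 2 + real k / 2)"
  proof -
    have "real n * real n powr (real k / 2 - 1 / 2) = real n powr (1 + (real k / 2 - 1 / 2))"
      using n by (simp only: powr_add) simp
    also have "1 + (real k / 2 - 1 / 2) = 1 / 2 + real k / 2" by simp
    finally show ?thesis by (simp add: mult.assoc)
  qed
  finally show ?thesis .
qed

definition matching_circuits :: "(nat \<Rightarrow> nat \<Rightarrow> nat \<Rightarrow> 'l) \<Rightarrow> nat \<Rightarrow> nat list \<Rightarrow> nat \<Rightarrow> (nat \<Rightarrow> nat) set" where
  "matching_circuits lab k w n = {\<pi> \<in> circuits k n. \<forall>i<k. \<forall>j<k. w ! i = w ! j \<longrightarrow>
     lab i (\<pi> i) (\<pi> (Suc i)) = lab j (\<pi> j) (\<pi> (Suc j))}"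

lemma Pi_CI_eq_matching_circuits:
  "Pi_CI L q w n = matching_circuits (\<lambda>i a b. (fst (q ! i), snd (q ! i), L (fst (q ! i)) n a b)) (length q) w n"
  unfolding Pi_CI_def matching_circuits_def Suc_eq_plus1 ..

text \<open>The letter map \<open>g\<close> need not be injective: different letters may carry the
  same label. For a pair-matched word this happens precisely when the circuit fails to be
  paired.\<close>

lemma matching_word_factor:
  assumes w: "length w = k" and \<pi>: "\<pi> \<in> matching_circuits lab k w n"
  shows "\<exists>g. map (\<lambda>i. lab i (\<pi> i) (\<pi> (Suc i))) [0..<k] = map g w"
proof -
  let ?u = "\<lambda>i. lab i (\<pi> i) (\<pi> (Suc i))"
  have all: "?u i = ?u j" if "i < k" "j < k" "w ! i = w ! j" for i j
    using \<pi> that unfolding matching_circuits_def by blast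
  define g where "g a = ?u (SOME i. i < k \<and> w ! i = a)" for a
  have "?u i = g (w ! i)" if "i < k" for i
  proof -
    have *: "(SOME j. j < k \<and> w ! j = w ! i) < k \<and> w ! (SOME j. j < k \<and> w ! j = w ! i) = w ! i"
      by (rule someI[of _ i]) (use that in simp)
    show ?thesis unfolding g_def by (rule all) (use that * in auto)
  qed
  then have "map ?u [0..<k] = map g w" using w by (intro nth_equalityI) auto
  then show ?thesis by blast
qed

lemma mset_map_labels: "mset (map (\<lambda>i. lab i (\<pi> i) (\<pi> (Suc i))) [0..<k]) = labels lab k \<pi>"
proof -
  have "mset [0..<k] = mset_set {..<k}" by (simp add: atLeast0LessThan)
  then show ?thesis unfolding labels_def mset_map by simp
qed

text \<open>
  A circuit whose labels are all paired matches exactly one word, namely the normal form of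
  its sequence of labels.
\<close>
lemma card_paired_circuits:
  fixes lab :: "nat \<Rightarrow> nat \<Rightarrow> nat \<Rightarrow> 'l"
  assumes k: "k = length q"
    and compat: "\<And>i j a b a' b'. i < k \<Longrightarrow> j < k \<Longrightarrow> lab i a b = lab j a' b' \<Longrightarrow> q ! i = q ! j"
  shows "\<bar>(\<Sum>w\<in>CIW2 q. real (card (matching_circuits lab k w n))) - real (card (paired_circuits lab k n))\<bar>
     \<le> real (card (CIW2 q)) * real (card (few_label_circuits lab k n))"
proof -
  define P where "P = paired_circuits lab k n"
  define R where "R = few_label_circuits lab k n"
  define Mt where "Mt w = matching_circuits lab k w n" for w
  define u where "u \<pi> = map (\<lambda>i. lab i (\<pi> i) (\<pi> (Suc i))) [0..<k]" for \<pi>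
  have fin: "finite P" "finite R" "finite (Mt w)" for w
    using finite_circuits by (auto simp: P_def R_def Mt_def paired_circuits_def few_label_circuits_def matching_circuits_def)
  have count_u: "count_list (u \<pi>) x = count (labels lab k \<pi>) x" and set_u: "set (u \<pi>) = set_mset (labels lab k \<pi>)" for \<pi> x
    unfolding u_def mset_map_labels[symmetric] by (simp_all only: count_mset set_mset_mset)
  have len_u: "length (u \<pi>) = k" for \<pi> by (simp add: u_def)
  have nth_u: "u \<pi> ! i = lab i (\<pi> i) (\<pi> (Suc i))" if "i < k" for \<pi> i using that by (simp add: u_def)
  have w: "normal_word w" "pair_matched w" "length w = k" if "w \<in> CIW2 q" for w
    using that by (auto simp: CIW2_def compatible_def k)
  have ex: "\<exists>w\<in>CIW2 q. \<pi> \<in> Mt w" if \<pi>: "\<pi> \<in> P" for \<pi>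
  proof -
    obtain w f where wf: "normal_word w" "inj_on f (set (u \<pi>))" "w = map f (u \<pi>)"
      using ex1_normal_word[of "u \<pi>"] by blast
    have c2: "count_list (u \<pi>) x = 2" if "x \<in> set (u \<pi>)" for x
      using that \<pi> by (simp add: count_u set_u P_def paired_circuits_def)
    have eq: "u \<pi> ! i = u \<pi> ! j" if "i < k" "j < k" "w ! i = w ! j" for i j
      using wf that by (auto simp: inj_on_def len_u)
    have "pair_matched w"
      unfolding pair_matched_def using wf c2 by (auto simp: count_list_inj_map)
    moreover have "compatible q w"
      unfolding compatible_def
    proof (intro conjI allI impI)
      show "length w = length q" using wf(3) by (simp add: len_u k)
      then show "q ! i = q ! j" if "i < length w" "j < length w" "w ! i = w ! j" for i j
        using eq[of i j] that by (intro compat[of i j "\<pi> i" "\<pi> (Suc i)" "\<pi> j" "\<pi> (Suc j)"]) (auto simp: nth_u k)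
    qed
    moreover have "\<pi> \<in> Mt w"
      unfolding Mt_def matching_circuits_def
    proof (intro CollectI conjI allI impI)
      show "\<pi> \<in> circuits k n" using \<pi> by (simp add: P_def paired_circuits_def)
      show "lab i (\<pi> i) (\<pi> (Suc i)) = lab j (\<pi> j) (\<pi> (Suc j))" if "i < k" "j < k" "w ! i = w ! j" for i j
        using eq[OF that] that by (simp add: nth_u)
    qed
    ultimately show ?thesis using wf(1) by (auto simp: CIW2_def)
  qed
  \<comment> \<open>Letters and labels both number k/2, so the map from letters to labels is a
    bijection, and its inverse exhibits \<open>w\<close> as a normal form of the label sequence.
    Uniqueness of normal forms then gives uniqueness of the word.\<close>
  have inj: "\<exists>f. inj_on f (set (u \<pi>)) \<and> w = map f (u \<pi>)"
    if \<pi>: "\<pi> \<in> P" "\<pi> \<in> Mt w" and wq: "w \<in> CIW2 q" for \<pi> w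
  proof -
    obtain g where g: "u \<pi> = map g w"
      using matching_word_factor[of w k \<pi> lab n] \<pi> w[OF wq] by (auto simp: Mt_def u_def)
    have "pair_matched w" "length w = k" using w[OF wq] by auto
    then have "2 * card (set w) = k" using length_pair_matched[of w] by simp
    moreover have "2 * card (set (u \<pi>)) = k"
    proof -
      have "(\<Sum>x\<in>set (u \<pi>). count_list (u \<pi>) x) = k" using sum_count_set[of "u \<pi>" "set (u \<pi>)"] len_u by simp
      moreover have "(\<Sum>x\<in>set (u \<pi>). count_list (u \<pi>) x) = (\<Sum>x\<in>set (u \<pi>). 2)"
        using \<pi>(1) by (intro sum.cong refl) (simp add: count_u set_u P_def paired_circuits_def)
      ultimately show ?thesis by simp
    qed
    ultimately have "card (g ` set w) = card (set w)" by (simp add: g)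
    then have "inj_on g (set w)" by (intro eq_card_imp_inj_on) auto
    then have "inj_on (inv_into (set w) g) (set (u \<pi>)) \<and> w = map (inv_into (set w) g) (u \<pi>)"
      by (auto simp: g inj_on_inv_into intro!: map_idI[symmetric])
    then show ?thesis by blast
  qed
  have uniq: "w = w'" if "\<pi> \<in> P" "\<pi> \<in> Mt w" "\<pi> \<in> Mt w'" "w \<in> CIW2 q" "w' \<in> CIW2 q" for \<pi> w w'
    using ex1_normal_word[of "u \<pi>"] inj[OF that(1,2,4)] inj[OF that(1,3,5)] w(1)[OF that(4)] w(1)[OF that(5)]
    by blast
  have "P = (\<Union>w\<in>CIW2 q. Mt w \<inter> P)" using ex by auto
  moreover have "card (\<Union>w\<in>CIW2 q. Mt w \<inter> P) = (\<Sum>w\<in>CIW2 q. card (Mt w \<inter> P))"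
    by (rule card_UN_disjoint) (use finite_CIW2 fin uniq in auto)
  ultimately have cardP: "card P = (\<Sum>w\<in>CIW2 q. card (Mt w \<inter> P))" by simp
  \<comment> \<open>A map that merges letters still leaves every label with multiplicity at least 2,
    so a failure of exact pairing means few labels. Such a circuit may match several words, hence
    the factor \<open>card (CIW2 q)\<close>.\<close>
  have "Mt w - P \<subseteq> R" if wq: "w \<in> CIW2 q" for w
  proof
    fix \<pi> assume \<pi>: "\<pi> \<in> Mt w - P"
    then obtain g where g: "u \<pi> = map g w"
      using matching_word_factor[of w k \<pi> lab n] w[OF wq] by (auto simp: Mt_def u_def)
    show "\<pi> \<in> R"
      unfolding R_def
    proof (rule matched_not_paired)
      show "\<pi> \<in> circuits k n" "\<pi> \<notin> paired_circuits lab k n"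
        using \<pi> by (auto simp: Mt_def matching_circuits_def P_def)
      fix x assume "x \<in># labels lab k \<pi>"
      then obtain y where y: "y \<in> set w" "x = g y" by (auto simp: set_u[symmetric] g)
      then have "2 \<le> count_list (u \<pi>) x"
        using count_list_map_ge[of w y g] w(2)[OF wq] by (simp add: g pair_matched_def)
      then show "2 \<le> count (labels lab k \<pi>) x" by (simp add: count_u)
    qed
  qed
  then have "card (Mt w - P) \<le> card R" if "w \<in> CIW2 q" for w using that fin by (intro card_mono) auto
  then have "(\<Sum>w\<in>CIW2 q. real (card (Mt w - P))) \<le> (\<Sum>w\<in>CIW2 q. real (card R))" by (intro sum_mono) auto
  moreover have "real (card (Mt w)) - real (card (Mt w \<inter> P)) = real (card (Mt w - P))" for w
    using card_Int_Diff[OF fin(3), of w P] by simp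
  then have "(\<Sum>w\<in>CIW2 q. real (card (Mt w))) - real (card P) = (\<Sum>w\<in>CIW2 q. real (card (Mt w - P)))"
    by (simp add: cardP sum_subtractf[symmetric])
  ultimately show ?thesis by (simp add: P_def R_def Mt_def abs_le_iff sum_nonneg order_trans[OF _ sum_nonneg])
qed

text \<open>Paired circuits contribute exactly 1 because second moments are 1, and a single label
  forces 0 through its mean; the circuits in between are so few that a uniform moment bound
  suffices.\<close>

lemma (in standardized_variables) sum_expectation_circuits:
  fixes lab :: "nat \<Rightarrow> nat \<Rightarrow> nat \<Rightarrow> 'l"
  assumes lab: "\<And>\<pi>. \<pi> \<in> circuits k n \<Longrightarrow> set_mset (labels lab k \<pi>) \<subseteq> S"
  shows "\<bar>(\<Sum>\<pi>\<in>circuits k n. expectation (vprod (labels lab k \<pi>))) - real (card (paired_circuits lab k n))\<bar>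
     \<le> (1 + real k * c k) * real (card (few_label_circuits lab k n))"
proof -
  define T where "T \<pi> = expectation (vprod (labels lab k \<pi>))" for \<pi>
  define P where "P = paired_circuits lab k n"
  define R where "R = few_label_circuits lab k n"
  have sub: "P \<subseteq> circuits k n" "R \<subseteq> circuits k n" by (auto simp: P_def R_def paired_circuits_def few_label_circuits_def)
  have finR: "finite R" using finite_subset[OF sub(2) finite_circuits] .
  have T_le: "\<bar>T \<pi>\<bar> \<le> 1 + real k * c k" if "\<pi> \<in> circuits k n" for \<pi>
    unfolding T_def using abs_expectation_vprod_le[OF lab[OF that]] by (simp add: size_labels)
  have zero: "T \<pi> = 0" if \<pi>: "\<pi> \<in> circuits k n - P" "\<pi> \<notin> R" for \<pi>
  proof -
    obtain x where x: "x \<in># labels lab k \<pi>" "\<not> count (labels lab k \<pi>) x \<ge> 2"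
      using matched_not_paired[of \<pi> k n lab] \<pi> unfolding P_def R_def by blast
    have "count (labels lab k \<pi>) x > 0" using x(1) by simp
    then have "count (labels lab k \<pi>) x = 1" using x(2) by linarith
    then show ?thesis unfolding T_def using \<pi> by (intro expectation_vprod_single lab) auto
  qed
  have "(\<Sum>\<pi>\<in>circuits k n. T \<pi>) = (\<Sum>\<pi>\<in>circuits k n - P. T \<pi>) + (\<Sum>\<pi>\<in>P. T \<pi>)"
    by (rule sum.subset_diff[OF sub(1) finite_circuits])
  also have "(\<Sum>\<pi>\<in>P. T \<pi>) = (\<Sum>\<pi>\<in>P. 1)"
    unfolding T_def by (intro sum.cong refl expectation_vprod_pairs lab)
      (use sub in \<open>auto simp: P_def paired_circuits_def\<close>)
  finally have "(\<Sum>\<pi>\<in>circuits k n. T \<pi>) - real (card P) = (\<Sum>\<pi>\<in>circuits k n - P. T \<pi>)" by simp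
  also have "\<dots> = (\<Sum>\<pi>\<in>R - P. T \<pi>)"
    using sub zero by (intro sum.mono_neutral_right) (auto simp: finite_circuits)
  also have "\<bar>\<dots>\<bar> \<le> (\<Sum>\<pi>\<in>R - P. \<bar>T \<pi>\<bar>)" by (rule sum_abs)
  also have "\<dots> \<le> (\<Sum>\<pi>\<in>R. \<bar>T \<pi>\<bar>)" by (rule sum_mono2[OF finR]) auto
  also have "\<dots> \<le> (\<Sum>\<pi>\<in>R. 1 + real k * c k)" using sub by (intro sum_mono T_le) auto
  finally show ?thesis by (simp add: T_def P_def R_def mult.commute)
qed

section \<open>Limits\<close>

text \<open>The series of fourth powers has finite expectation, hence converges almost everywhere,
  and its terms tend to 0. This replaces Markov's inequality and the Borel-Cantelli lemma.\<close>

lemma AE_tendsto_zero_power4: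
  fixes f :: "nat \<Rightarrow> 'a \<Rightarrow> real"
  assumes int: "\<And>n. integrable M (\<lambda>\<omega>. f n \<omega> ^ 4)"
    and sum: "summable (\<lambda>n. \<integral>\<omega>. f n \<omega> ^ 4 \<partial>M)"
  shows "AE \<omega> in M. (\<lambda>n. f n \<omega>) \<longlonglongrightarrow> 0"
proof -
  have [measurable]: "(\<lambda>\<omega>. f n \<omega> ^ 4) \<in> borel_measurable M" for n using int[of n] by auto
  have "(\<integral>\<^sup>+\<omega>. (\<Sum>n. ennreal (f n \<omega> ^ 4)) \<partial>M) = (\<Sum>n. \<integral>\<^sup>+\<omega>. ennreal (f n \<omega> ^ 4) \<partial>M)"
    by (rule nn_integral_suminf) simp
  also have "\<dots> = (\<Sum>n. ennreal (\<integral>\<omega>. f n \<omega> ^ 4 \<partial>M))"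
    by (intro suminf_cong nn_integral_eq_integral int) simp
  also have "\<dots> \<noteq> \<infinity>"
    using sum by (subst suminf_ennreal2) (auto intro: integral_nonneg_AE)
  finally have "AE \<omega> in M. (\<Sum>n. ennreal (f n \<omega> ^ 4)) \<noteq> \<infinity>"
    by (intro nn_integral_noteq_infinite) auto
  then show ?thesis
  proof eventually_elim
    case (elim \<omega>)
    then have "summable (\<lambda>n. f n \<omega> ^ 4)"
      by (intro summable_suminf_not_top) (auto simp: top_ennreal_def[symmetric])
    then have "(\<lambda>n. f n \<omega> ^ 4) \<longlonglongrightarrow> 0" by (rule summable_LIMSEQ_zero)
    then have "(\<lambda>n. sqrt (sqrt (f n \<omega> ^ 4))) \<longlonglongrightarrow> sqrt (sqrt 0)" by (intro tendsto_real_sqrt)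
    moreover have "sqrt (sqrt (x ^ 4)) = \<bar>x\<bar>" for x :: real
    proof -
      have "x ^ 4 = (x\<^sup>2)\<^sup>2" by simp
      then have "sqrt (x ^ 4) = x\<^sup>2" by (simp only: real_sqrt_abs) simp
      then show ?thesis by simp
    qed
    ultimately have "(\<lambda>n. \<bar>f n \<omega>\<bar>) \<longlonglongrightarrow> 0" by simp
    then show ?case by (rule tendsto_rabs_zero_cancel)
  qed
qed

section \<open>From the assumptions to labels and standardized variables\<close>

text \<open>(A1) speaks only about lattice points, so one has to be exhibited: the value of the
  first link function at the entry of the 1 by 1 matrix.\<close>

lemma assumption_A1_nonneg:
  assumes "h \<ge> 1" "\<forall>j\<in>{1..h}. link_function (d j) (L j)" "assumption_A1 h d L \<Delta>"
  shows "\<Delta> \<ge> 0"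
proof -
  have "L 1 1 1 1 \<in> lattice (d 1)" using assms(1,2) by (auto simp: link_function_def)
  then have "real (card {q \<in> {1..1}. L 1 1 1 q = L 1 1 1 1}) \<le> \<Delta>"
    using assms(1) by (intro assms(3)[unfolded assumption_A1_def, rule_format]) auto
  then show ?thesis by linarith
qed

lemma monomials_nth:
  assumes "q \<in> monomials h p" "i < length q"
  shows "fst (q ! i) \<in> {1..h} \<and> snd (q ! i) \<in> {1..p (fst (q ! i))}"
proof -
  have "q ! i \<in> set q" using assms(2) by simp
  then have "case q ! i of (j, i) \<Rightarrow> j \<in> {1..h} \<and> i \<in> {1..p j}"
    using assms(1) unfolding monomials_def mem_Collect_eq by (rule bspec[rotated])
  then show ?thesis unfolding case_prod_beta .
qed

text \<open>(A1) is restricted to lattice points, while \<open>t\<close> is an arbitrary triple. A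
  triple attained at some \<open>b\<close> has a lattice point as its third component; for any other
  the set is empty and \<Delta> \<ge> 0 suffices.\<close>

lemma monomial_label_bound:
  fixes L :: "nat \<Rightarrow> nat \<Rightarrow> nat \<Rightarrow> nat \<Rightarrow> int list"
  assumes h: "h \<ge> 1" and link: "\<forall>j\<in>{1..h}. link_function (d j) (L j)" and A1: "assumption_A1 h d L \<Delta>"
    and q: "q \<in> monomials h p" and i: "i < length q" and a: "a \<in> {1..n}"
  shows "real (card {b \<in> {1..n}. (fst (q ! i), snd (q ! i), L (fst (q ! i)) n a b) = t}) \<le> \<Delta>"
proof (cases "\<exists>b\<in>{1..n}. (fst (q ! i), snd (q ! i), L (fst (q ! i)) n a b) = t")
  case False
  then have "{b \<in> {1..n}. (fst (q ! i), snd (q ! i), L (fst (q ! i)) n a b) = t} = {}" by blast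
  then show ?thesis using assumption_A1_nonneg[OF h link A1] by (simp only: card.empty of_nat_0)
next
  case True
  then obtain b where b: "b \<in> {1..n}" "(fst (q ! i), snd (q ! i), L (fst (q ! i)) n a b) = t" by blast
  have j: "fst (q ! i) \<in> {1..h}" using monomials_nth[OF q i] by simp
  have "card {b' \<in> {1..n}. (fst (q ! i), snd (q ! i), L (fst (q ! i)) n a b') = t} \<le>
      card {b' \<in> {1..n}. L (fst (q ! i)) n a b' = L (fst (q ! i)) n a b}"
    using b by (intro card_mono) auto
  moreover have "L (fst (q ! i)) n a b \<in> lattice (d (fst (q ! i)))"
    using link j a b unfolding link_function_def by blast
  then have "real (card {b' \<in> {1..n}. L (fst (q ! i)) n a b' = L (fst (q ! i)) n a b}) \<le> \<Delta>"
    using A1 j a unfolding assumption_A1_def by fastforce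
  ultimately show ?thesis by linarith
qed

definition input_labels :: "nat \<Rightarrow> (nat \<Rightarrow> nat) \<Rightarrow> (nat \<Rightarrow> nat) \<Rightarrow> (nat \<times> nat \<times> int list) set" where
  "input_labels h p d = {(j, i, t). j \<in> {1..h} \<and> i \<in> {1..p j} \<and> t \<in> lattice (d j)}"

definition entry_labels ::
  "nat \<Rightarrow> (nat \<Rightarrow> nat) \<Rightarrow> (nat \<Rightarrow> nat \<Rightarrow> nat \<Rightarrow> nat \<Rightarrow> int list) \<Rightarrow> (nat \<times> nat \<times> int list) set" where
  "entry_labels h p L = {(j, i, t). j \<in> {1..h} \<and> i \<in> {1..p j} \<and>
     (\<exists>n\<ge>1. \<exists>a\<in>{1..n}. \<exists>b\<in>{1..n}. t = L j n a b)}"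

lemma monomial_labels_subset:
  assumes q: "q \<in> monomials h p" and \<pi>: "\<pi> \<in> circuits (length q) n"
  shows "set_mset (monomial_labels L q n \<pi>) \<subseteq> entry_labels h p L"
proof -
  have "(fst (q ! i), snd (q ! i), L (fst (q ! i)) n (\<pi> i) (\<pi> (Suc i))) \<in> entry_labels h p L"
    if i: "i < length q" for i
  proof -
    have "fst (q ! i) \<in> {1..h}" "snd (q ! i) \<in> {1..p (fst (q ! i))}"
      using monomials_nth[OF q i] by auto
    moreover have "\<pi> i \<in> {1..n}" "\<pi> (Suc i) \<in> {1..n}" using \<pi> i by (auto simp: circuits_def)
    moreover from this have "n \<ge> 1" by simp
    ultimately show ?thesis unfolding entry_labels_def by blast
  qed
  then show ?thesis unfolding monomial_labels_def set_mset_labels by blast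
qed

lemma standardized_variables_input:
  assumes "prob_space M" and A2: "assumption_A2 M h p d L X"
    and link: "\<forall>j\<in>{1..h}. link_function (d j) (L j)"
  shows "\<exists>c. standardized_variables M (\<lambda>(j, i, t). X j i t) (input_labels h p d) (entry_labels h p L) c"
proof -
  interpret prob_space M by fact
  obtain c where c: "\<forall>k. \<forall>j\<in>{1..h}. \<forall>i\<in>{1..p j}. \<forall>n\<ge>1. \<forall>a\<in>{1..n}. \<forall>b\<in>{1..n}.
        integrable M (\<lambda>\<omega>. \<bar>X j i (L j n a b) \<omega>\<bar> ^ k) \<and>
        expectation (\<lambda>\<omega>. \<bar>X j i (L j n a b) \<omega>\<bar> ^ k) \<le> c k"
    using A2[unfolded assumption_A2_def, THEN conjunct2, THEN conjunct2] by (rule exE)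
  have mean: "expectation (X j i t) = 0" and var: "variance (X j i t) = 1"
    if "j \<in> {1..h}" "i \<in> {1..p j}" "t \<in> lattice (d j)" for j i t
    using A2 that unfolding assumption_A2_def by blast+
  have "standardized_variables M (\<lambda>(j, i, t). X j i t) (input_labels h p d) (entry_labels h p L) c"
  proof
    show "indep_vars (\<lambda>_. borel) (\<lambda>(j, i, t). X j i t) (input_labels h p d)"
      using A2 unfolding assumption_A2_def input_labels_def by blast
    show "entry_labels h p L \<subseteq> input_labels h p d"
      using link unfolding entry_labels_def input_labels_def link_function_def by blast
  next
    fix l assume "l \<in> input_labels h p d"
    then obtain j i t where l: "l = (j, i, t)" "j \<in> {1..h}" "i \<in> {1..p j}" "t \<in> lattice (d j)"
      by (auto simp: input_labels_def)
    show "expectation (case l of (j, i, t) \<Rightarrow> X j i t) = 0" using mean[OF l(2-4)] l(1) by simp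
    show "expectation (\<lambda>\<omega>. ((case l of (j, i, t) \<Rightarrow> X j i t) \<omega>)\<^sup>2) = 1"
      using mean[OF l(2-4)] var[OF l(2-4)] l(1) by simp
  next
    fix l k assume "l \<in> entry_labels h p L"
    then obtain j i n a b where l: "l = (j, i, L j n a b)" "j \<in> {1..h}" "i \<in> {1..p j}" "n \<ge> 1"
        "a \<in> {1..n}" "b \<in> {1..n}"
      by (auto simp: entry_labels_def)
    show "integrable M (\<lambda>\<omega>. \<bar>(case l of (j, i, t) \<Rightarrow> X j i t) \<omega>\<bar> ^ k)"
      "expectation (\<lambda>\<omega>. \<bar>(case l of (j, i, t) \<Rightarrow> X j i t) \<omega>\<bar> ^ k) \<le> c k"
      using c l by simp_all
  qed
  then show ?thesis by blast
qed

section \<open>Limits of circuit counts and the size of their sum\<close>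

text \<open>Compatibility with \<open>q\<close> already forces equal indices on equal letters, so
  recording the index adds no constraint. The sets agree for every n, hence existence and value of
  the limit carry over.\<close>

lemma Pi_CI_eq_Pi_C:
  assumes "w \<in> CIW2 q"
  shows "Pi_CI L q w n = Pi_C L (psi q) w n"
proof -
  have w: "length w = length q"
    "\<And>i j. i < length w \<Longrightarrow> j < length w \<Longrightarrow> w ! i = w ! j \<Longrightarrow> q ! i = q ! j"
    using assms unfolding CIW2_def compatible_def by blast+
  have eq: "(w ! i = w ! j \<longrightarrow> (fst (q ! i), snd (q ! i), L (fst (q ! i)) n (\<pi> i) (\<pi> (i + 1))) =
       (fst (q ! j), snd (q ! j), L (fst (q ! j)) n (\<pi> j) (\<pi> (j + 1)))) \<longleftrightarrow>
    (w ! i = w ! j \<longrightarrow> psi q ! i = psi q ! j \<and>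
       L (psi q ! i) n (\<pi> i) (\<pi> (i + 1)) = L (psi q ! j) n (\<pi> j) (\<pi> (j + 1)))"
    if "i < length q" "j < length q" for i j \<pi>
  proof (cases "w ! i = w ! j")
    case True
    then have "q ! i = q ! j" using that w(1) by (intro w(2)) auto
    then show ?thesis using that by (simp add: psi_def)
  qed simp
  moreover have "length (psi q) = length q" by (simp add: psi_def)
  ultimately show ?thesis unfolding Pi_CI_def Pi_C_def
    by (simp only:) (intro Collect_cong conj_cong refl all_cong, rule eq)
qed

lemma p_CI_seq_eq_p_C_seq: "w \<in> CIW2 q \<Longrightarrow> p_CI_seq L q w = p_C_seq L (psi q) w"
  by (simp add: fun_eq_iff p_CI_seq_def p_C_seq_def Pi_CI_eq_Pi_C) (simp add: psi_def)

lemma tendsto_powr_minus_half: "(\<lambda>n. real n powr (- (1 / 2))) \<longlonglongrightarrow> 0"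
  using tendsto_neg_powr[OF _ filterlim_real_sequentially, of "- 1 / 2"] by simp

lemma p_CI_seq_tendsto:
  assumes ex: "p_C_exists L q" and w: "w \<in> CIW2 q"
  shows "p_CI_seq L q w \<longlonglongrightarrow> p_CI L q w" "p_CI L q w = p_C L (psi q) w"
proof -
  have "convergent (p_C_seq L (psi q) w)"
    using ex w CIW2_subset_CW2[of q] unfolding p_C_exists_def by blast
  then show "p_CI_seq L q w \<longlonglongrightarrow> p_CI L q w"
    unfolding p_CI_def p_CI_seq_eq_p_C_seq[OF w] by (simp only: convergent_LIMSEQ_iff)
  show "p_CI L q w = p_C L (psi q) w"
    unfolding p_CI_def p_C_def p_CI_seq_eq_p_C_seq[OF w] ..
qed

text \<open>A pair-matched word has k/2 letters, so the matching walks number at most n^(1 + k/2)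
  \<Delta>^(k/2); the normalization removes the power of n exactly, and the bound passes to the
  limit.\<close>

lemma p_CI_bounds:
  assumes h: "h \<ge> 1" and link: "\<forall>j\<in>{1..h}. link_function (d j) (L j)" and A1: "assumption_A1 h d L \<Delta>"
    and q: "q \<in> monomials h p" and ex: "p_C_exists L q" and w: "w \<in> CIW2 q"
  shows "0 \<le> p_CI L q w" "p_CI L q w \<le> \<Delta> ^ (length q div 2)"
proof -
  let ?k = "length q" and ?m = "length q div 2"
  note lim = p_CI_seq_tendsto(1)[OF ex w]
  note \<Delta> = assumption_A1_nonneg[OF h link A1]
  show "0 \<le> p_CI L q w"
    by (rule LIMSEQ_le_const[OF lim]) (simp add: p_CI_seq_def)
  have km: "real ?k = 2 * real ?m" using CIW2_even(1)[OF w] by (simp add: real_of_nat_div)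
  have len: "length w = ?k" and pm: "pair_matched w"
    using w unfolding CIW2_def compatible_def by blast+
  have letters: "card ((!) w ` {..<?k}) = ?m"
  proof -
    have "(!) w ` {..<?k} = set w" unfolding len[symmetric] by (simp add: set_conv_nth image_def lessThan_def) blast
    then show ?thesis using length_pair_matched[OF pm] len by simp
  qed
  have "p_CI_seq L q w n \<le> \<Delta> ^ ?m" if n: "n \<ge> 1" for n
  proof -
    let ?lab = "\<lambda>i a b. (fst (q ! i), snd (q ! i), L (fst (q ! i)) n a b)"
    let ?W = "{\<pi> \<in> {0..?k} \<rightarrow>\<^sub>E {1..n}. \<forall>i<?k. \<forall>j<?k. w ! i = w ! j \<longrightarrow>
            ?lab i (\<pi> i) (\<pi> (Suc i)) = ?lab j (\<pi> j) (\<pi> (Suc j))}"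
    have "Pi_CI L q w n \<subseteq> ?W"
      unfolding Pi_CI_eq_matching_circuits matching_circuits_def circuits_def by blast
    then have "card (Pi_CI L q w n) \<le> card ?W"
      by (rule card_mono[rotated])
        (rule finite_subset[of _ "{0..?k} \<rightarrow>\<^sub>E {1..n}"], auto intro: finite_PiE)
    also have "real (card ?W) \<le> real n ^ Suc ?m * \<Delta> ^ (?k - ?m)"
      using card_walks_matching_word[of n ?k ?lab \<Delta> "(!) w"] monomial_label_bound[OF h link A1 q] \<Delta>
      unfolding letters by blast
    also have "?k - ?m = ?m" using km by linarith
    finally have "p_CI_seq L q w n \<le> 1 / real n powr (1 + real ?k / 2) * (real n ^ Suc ?m * \<Delta> ^ ?m)"
      unfolding p_CI_seq_def by (intro mult_left_mono) auto
    also have "real n powr (1 + real ?k / 2) = real n ^ Suc ?m"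
    proof -
      have "1 + real ?k / 2 = real (Suc ?m)" using km by simp
      then show ?thesis using n by (simp only: powr_realpow)
    qed
    finally show ?thesis using n by simp
  qed
  then show "p_CI L q w \<le> \<Delta> ^ ?m" by (intro LIMSEQ_le_const2[OF lim]) blast
qed

lemma card_CIW2_le:
  assumes "even (length q)"
  shows "real (card (CIW2 q)) \<le> fact (length q) / (fact (length q div 2) * 2 ^ (length q div 2))"
proof -
  let ?m = "length q div 2"
  let ?W = "{w. normal_word w \<and> pair_matched w \<and> length w = 2 * ?m}"
  have k: "length q = 2 * ?m" using assms by simp
  have "?W \<subseteq> {w. set w \<subseteq> {..<2 * ?m} \<and> length w = 2 * ?m}"
  proof
    fix w assume w: "w \<in> ?W"
    have "card (set w) \<le> 2 * ?m" using card_length[of w] w by simp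
    moreover have "set w = {..<card (set w)}" using w by (intro set_normal_word) simp
    ultimately have "set w \<subseteq> {..<2 * ?m}" by (metis lessThan_subset_iff)
    with w show "w \<in> {w. set w \<subseteq> {..<2 * ?m} \<and> length w = 2 * ?m}" by simp
  qed
  then have "finite ?W" using finite_lists_length_eq[of "{..<2 * ?m}" "2 * ?m"] finite_subset by blast
  moreover have "CIW2 q \<subseteq> ?W"
  proof
    fix w assume "w \<in> CIW2 q"
    then have "normal_word w" "pair_matched w" "length w = length q" unfolding CIW2_def compatible_def by blast+
    then show "w \<in> ?W" using k by simp
  qed
  ultimately have "card (CIW2 q) \<le> card ?W" by (rule card_mono)
  then have "card (CIW2 q) * (fact ?m * 2 ^ ?m) \<le> card ?W * (fact ?m * 2 ^ ?m)" by (rule mult_right_mono) simp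
  also have "\<dots> \<le> fact (2 * ?m)" by (rule card_normal_pair_matched)
  finally have "real (card (CIW2 q) * (fact ?m * 2 ^ ?m)) \<le> real (fact (2 * ?m))" by (rule of_nat_mono)
  then have "real (card (CIW2 q)) * (fact ?m * 2 ^ ?m) \<le> fact (length q)" using k by simp
  then show ?thesis by (simp add: pos_le_divide_eq)
qed

lemma alpha_bound:
  assumes h: "h \<ge> 1" and link: "\<forall>j\<in>{1..h}. link_function (d j) (L j)" and A1: "assumption_A1 h d L \<Delta>"
    and q: "q \<in> monomials h p" and ex: "p_C_exists L q"
  shows "if even (length q) \<and> (\<forall>j\<in>{1..h}. \<forall>i\<in>{1..p j}. even (count_list q (j, i)))
       then \<bar>alpha L q\<bar> \<le> fact (length q) * \<Delta> ^ (length q div 2)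
              / (fact (length q div 2) * 2 ^ (length q div 2))
       else alpha L q = 0"
proof (cases "even (length q) \<and> (\<forall>j\<in>{1..h}. \<forall>i\<in>{1..p j}. even (count_list q (j, i)))")
  case True
  note b = p_CI_bounds[OF h link A1 q ex]
  have "0 \<le> alpha L q" unfolding alpha_def by (intro sum_nonneg b)
  then have "\<bar>alpha L q\<bar> = (\<Sum>w\<in>CIW2 q. p_CI L q w)" by (simp add: alpha_def)
  also have "\<dots> \<le> (\<Sum>w\<in>CIW2 q. \<Delta> ^ (length q div 2))" by (intro sum_mono b)
  also have "\<dots> = real (card (CIW2 q)) * \<Delta> ^ (length q div 2)" by simp
  also have "\<dots> \<le> fact (length q) / (fact (length q div 2) * 2 ^ (length q div 2)) * \<Delta> ^ (length q div 2)"
    using True assumption_A1_nonneg[OF h link A1] by (intro mult_right_mono card_CIW2_le) auto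
  finally show ?thesis using True by simp
next
  case False
  then have "CIW2 q = {}" using CIW2_even by blast
  then have "alpha L q = 0" by (simp add: alpha_def)
  then show ?thesis by (subst if_not_P[OF False])
qed

section \<open>Convergence of the moments\<close>

lemma moment_limits:
  fixes M :: "'a measure"
  assumes h: "h \<ge> 1" and link: "\<forall>j\<in>{1..h}. link_function (d j) (L j)" and A1: "assumption_A1 h d L \<Delta>"
    and M: "prob_space M" and A2: "assumption_A2 M h p d L X"
    and q: "q \<in> monomials h p" and ex: "p_C_exists L q"
  shows "mu_hat M L X q \<longlonglongrightarrow> alpha L q"
    and "AE \<omega> in M. (\<lambda>n. mu_tilde L X q n \<omega>) \<longlonglongrightarrow> alpha L q"
proof -
  obtain c where "standardized_variables M (\<lambda>(j, i, t). X j i t) (input_labels h p d) (entry_labels h p L) c"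
    using standardized_variables_input[OF M A2 link] by (rule exE)
  then interpret standardized_variables M "\<lambda>(j, i, t). X j i t" "input_labels h p d" "entry_labels h p L" c .
  define k where "k = length q"
  define lab where "lab n i a b = (fst (q ! i), snd (q ! i), L (fst (q ! i)) n a b)" for n i a b
  define A where "A n \<pi> = labels (lab n) k \<pi>" for n \<pi>
  define s where "s n = real n powr (- (1 + real k / 2))" for n
  define Z where "Z n \<omega> = (\<Sum>\<pi>\<in>circuits k n. vprod (A n \<pi>) \<omega>)" for n \<omega>
  note \<Delta> = assumption_A1_nonneg[OF h link A1]
  have lab_eq: "lab n = (\<lambda>i a b. (fst (q ! i), snd (q ! i), L (fst (q ! i)) n a b))" for n
    by (simp add: lab_def[abs_def])
  have A_eq: "A n \<pi> = monomial_labels L q n \<pi>" for n \<pi>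
    by (simp add: A_def monomial_labels_def lab_eq k_def)
  have bound: "real (card {b \<in> {1..n}. lab n i a b = t}) \<le> \<Delta>" if "a \<in> {1..n}" "i < k" for n i a t
    unfolding lab_def using that by (intro monomial_label_bound[OF h link A1 q]) (auto simp: k_def)
  have A_S: "set_mset (A n \<pi>) \<subseteq> entry_labels h p L" if "\<pi> \<in> circuits k n" for n \<pi>
    unfolding A_eq using that by (intro monomial_labels_subset[OF q]) (simp add: k_def)
  have A_size: "size (A n \<pi>) = k" for n \<pi> by (simp add: A_def size_labels)
  have mu_tilde: "mu_tilde L X q n = (\<lambda>\<omega>. s n * Z n \<omega>)" for n
    by (simp add: fun_eq_iff mu_tilde_circuits s_def Z_def A_eq k_def case_prod_beta')
  have mu_hat: "mu_hat M L X q n = s n * expectation (Z n)" for n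
    unfolding mu_hat_def mu_tilde by simp
  have EZ: "expectation (Z n) = (\<Sum>\<pi>\<in>circuits k n. expectation (vprod (A n \<pi>)))" for n
    unfolding Z_def by (intro Bochner_Integration.integral_sum all_moments_integrable all_moments_vprod A_S)

  \<comment> \<open>The terms \<open>1 + k * c k\<close> and \<open>card (CIW2 q)\<close> come from
    the two comparisons with paired circuits, the power from the count of circuits with few
    labels.\<close>
  define C where "C = (1 + real k * c k + real (card (CIW2 q))) * (real k * \<Delta> + 1) ^ k"
  have err: "\<bar>mu_hat M L X q n - (\<Sum>w\<in>CIW2 q. p_CI_seq L q w n)\<bar> \<le> \<bar>C\<bar> * real n powr (- (1 / 2))"
    if n: "n \<ge> 1" for n
  proof -
    let ?P = "real (card (paired_circuits (lab n) k n))" and ?R = "real (card (few_label_circuits (lab n) k n))"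
    let ?W = "\<Sum>w\<in>CIW2 q. real (card (matching_circuits (lab n) k w n))"
    have s0: "s n \<ge> 0" by (simp add: s_def)
    have "p_CI_seq L q w n = s n * real (card (matching_circuits (lab n) k w n))" for w
      by (simp only: p_CI_seq_def Pi_CI_eq_matching_circuits s_def lab_eq k_def powr_minus_divide)
    then have "mu_hat M L X q n - (\<Sum>w\<in>CIW2 q. p_CI_seq L q w n) = s n * (expectation (Z n) - ?W)"
      by (simp add: mu_hat right_diff_distrib sum_distrib_left)
    then have "\<bar>mu_hat M L X q n - (\<Sum>w\<in>CIW2 q. p_CI_seq L q w n)\<bar> = s n * \<bar>expectation (Z n) - ?W\<bar>"
      using s0 by (simp add: abs_mult)
    also have "\<bar>expectation (Z n) - ?W\<bar> \<le> (1 + real k * c k + real (card (CIW2 q))) * ?R"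
    proof -
      have "\<bar>expectation (Z n) - ?P\<bar> \<le> (1 + real k * c k) * ?R"
        unfolding EZ A_def using A_S unfolding A_def by (intro sum_expectation_circuits)
      moreover have "\<bar>?W - ?P\<bar> \<le> real (card (CIW2 q)) * ?R"
      proof (rule card_paired_circuits)
        show "k = length q" by (rule k_def)
        show "q ! i = q ! j" if "lab n i a b = lab n j a' b'" for i j a b a' b'
          using that by (simp add: lab_def prod_eq_iff)
      qed
      ultimately show ?thesis by (simp add: distrib_right)
    qed
    \<comment> \<open>The absolute value makes the coefficient visibly nonnegative, as required
      before \<open>?R\<close> is replaced by its bound.\<close>
    also have "(1 + real k * c k + real (card (CIW2 q))) * ?R \<le> \<bar>1 + real k * c k + real (card (CIW2 q))\<bar> * ?R"
      by (intro mult_right_mono) auto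
    also have "?R \<le> (real k * \<Delta> + 1) ^ k * real n powr (1 / 2 + real k / 2)"
      using bound n \<Delta> by (intro card_few_label_circuits) auto
    finally have "\<bar>mu_hat M L X q n - (\<Sum>w\<in>CIW2 q. p_CI_seq L q w n)\<bar> \<le>
        s n * (\<bar>1 + real k * c k + real (card (CIW2 q))\<bar> * ((real k * \<Delta> + 1) ^ k * real n powr (1 / 2 + real k / 2)))"
      using s0 by (simp add: mult_left_mono)
    also have "\<dots> = \<bar>C\<bar> * (s n * real n powr (1 / 2 + real k / 2))"
      using \<Delta> by (simp add: C_def abs_mult)
    also have "s n * real n powr (1 / 2 + real k / 2) = real n powr (- (1 / 2))"
    proof -
      have "s n * real n powr (1 / 2 + real k / 2) = real n powr (- (1 + real k / 2) + (1 / 2 + real k / 2))"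
        unfolding s_def by (rule powr_add[symmetric])
      then show ?thesis by simp
    qed
    finally show ?thesis .
  qed
  have "(\<lambda>n. mu_hat M L X q n - (\<Sum>w\<in>CIW2 q. p_CI_seq L q w n)) \<longlonglongrightarrow> 0"
  proof (rule Lim_null_comparison)
    show "\<forall>\<^sub>F n in sequentially. norm (mu_hat M L X q n - (\<Sum>w\<in>CIW2 q. p_CI_seq L q w n)) \<le> \<bar>C\<bar> * real n powr (- (1 / 2))"
      using eventually_ge_at_top[of 1] by eventually_elim (simp add: err)
    show "(\<lambda>n. \<bar>C\<bar> * real n powr (- (1 / 2))) \<longlonglongrightarrow> 0"
      using tendsto_mult_left[OF tendsto_powr_minus_half, of "\<bar>C\<bar>"] by simp
  qed
  moreover have "(\<lambda>n. \<Sum>w\<in>CIW2 q. p_CI_seq L q w n) \<longlonglongrightarrow> alpha L q"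
    unfolding alpha_def by (intro tendsto_sum p_CI_seq_tendsto ex)
  ultimately show hat: "mu_hat M L X q \<longlonglongrightarrow> alpha L q"
    using tendsto_add by fastforce

  define f where "f n \<omega> = mu_tilde L X q n \<omega> - mu_hat M L X q n" for n \<omega>
  define D where "D = \<bar>moment4_bound k\<bar> * ((1 + 4 * real k + 2 * (real k)\<^sup>2) * ((4 * real k * \<Delta> + 1) ^ k) ^ 4)"
  have f_eq: "(\<lambda>\<omega>. f n \<omega> ^ 4) = (\<lambda>\<omega>. s n ^ 4 * (Z n \<omega> - expectation (Z n)) ^ 4)" for n
    by (simp add: f_def mu_tilde mu_hat power_mult_distrib flip: right_diff_distrib)
  note Z4 = expectation_sum_centered_power4[of "circuits k n" "A n" k for n, OF finite_circuits A_S A_size,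
      folded Z_def]
  have f_int: "integrable M (\<lambda>\<omega>. f n \<omega> ^ 4)" for n unfolding f_eq using Z4(1) by simp
  have f_le: "expectation (\<lambda>\<omega>. f n \<omega> ^ 4) \<le> D * inverse (real n ^ 2)" if n: "n \<ge> 1" for n
  proof -
    let ?Q = "real (card {(a, b, c, d) \<in> circuits k n \<times> circuits k n \<times> circuits k n \<times> circuits k n.
      linked4 (A n a) (A n b) (A n c) (A n d)})"
    have s0: "s n ^ 4 \<ge> 0" by simp
    have "expectation (\<lambda>\<omega>. f n \<omega> ^ 4) = s n ^ 4 * expectation (\<lambda>\<omega>. (Z n \<omega> - expectation (Z n)) ^ 4)"
      unfolding f_eq by simp
    also have "\<dots> \<le> s n ^ 4 * (moment4_bound k * ?Q)" using Z4(2) by (intro mult_left_mono s0)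
    also have "\<dots> \<le> s n ^ 4 * (\<bar>moment4_bound k\<bar> * ?Q)" by (intro mult_left_mono mult_right_mono s0) auto
    also have "\<dots> \<le> s n ^ 4 * (\<bar>moment4_bound k\<bar> * ((1 + 4 * real k + 2 * (real k)\<^sup>2) *
        ((4 * real k * \<Delta> + 1) ^ k) ^ 4 * real n ^ (2 * k + 2)))"
      unfolding A_def using bound n \<Delta> by (intro mult_left_mono card_linked4_circuits) auto
    also have "\<dots> = D * (s n ^ 4 * real n ^ (2 * k + 2))" by (simp add: D_def mult_ac)
    \<comment> \<open>The normalization contributes n^(-4 - 2k) against n^(2k + 2)
      quadruples.\<close>
    also have "s n ^ 4 * real n ^ (2 * k + 2) = inverse (real n ^ 2)"
    proof -
      have "s n ^ 4 = real n powr (- (1 + real k / 2) * 4)"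
        using n unfolding s_def by (simp add: powr_powr flip: powr_realpow)
      moreover have "real n ^ (2 * k + 2) = real n powr (2 * real k + 2)"
        using n powr_realpow[of "real n" "2 * k + 2"] by (simp add: add.commute)
      ultimately have "s n ^ 4 * real n ^ (2 * k + 2) = real n powr (- (1 + real k / 2) * 4 + (2 * real k + 2))"
        by (simp only: powr_add)
      also have "- (1 + real k / 2) * 4 + (2 * real k + 2) = - real 2" by simp
      also have "real n powr (- real 2) = inverse (real n ^ 2)" using n by (simp only: powr_minus powr_realpow)
      finally show ?thesis .
    qed
    finally show ?thesis .
  qed
  have "summable (\<lambda>n. expectation (\<lambda>\<omega>. f n \<omega> ^ 4))"
  proof (rule summable_comparison_test')
    show "summable (\<lambda>n. D * inverse (real n ^ 2))" by (intro summable_mult inverse_power_summable) simp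
    show "norm (expectation (\<lambda>\<omega>. f n \<omega> ^ 4)) \<le> D * inverse (real n ^ 2)" if "n \<ge> 1" for n
      using f_le[OF that] by (simp add: integral_nonneg_AE)
  qed
  with f_int have "AE \<omega> in M. (\<lambda>n. f n \<omega>) \<longlonglongrightarrow> 0" by (rule AE_tendsto_zero_power4)
  then show "AE \<omega> in M. (\<lambda>n. mu_tilde L X q n \<omega>) \<longlonglongrightarrow> alpha L q"
  proof eventually_elim
    case (elim \<omega>)
    then show ?case using tendsto_add[OF elim hat] by (simp add: f_def)
  qed
qed

lemma converges_jointly:
  assumes "h \<ge> 1" and "\<forall>j\<in>{1..h}. link_function (d j) (L j)" and "assumption_A1 h d L \<Delta>"
    and "prob_space M" and "assumption_A2 M h p d L X" and "\<forall>q\<in>monomials h p. p_C_exists L q"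
  shows "converges_jointly_phi1_as M h p L X (alpha L)" "converges_jointly_phi2 M h p L X (alpha L)"
  unfolding converges_jointly_phi1_as_def converges_jointly_phi2_def
    phi1_scaled_monomial phi2_scaled_monomial
  using moment_limits[OF assms(1-5)] assms(6) by blast+

theorem theorem3p1:
  fixes h :: nat and p d :: "nat \<Rightarrow> nat"
    and L :: "nat \<Rightarrow> nat \<Rightarrow> nat \<Rightarrow> nat \<Rightarrow> int list"
    and \<Delta> :: real
    and M :: "'a measure"
    and X :: "nat \<Rightarrow> nat \<Rightarrow> int list \<Rightarrow> 'a \<Rightarrow> real"
  assumes "h \<ge> 1" and "\<forall>j\<in>{1..h}. p j \<ge> 1"
    and "\<forall>j\<in>{1..h}. link_function (d j) (L j)"
    and "assumption_A1 h d L \<Delta>"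
    and "prob_space M"
    and "assumption_A2 M h p d L X"
  shows "(\<forall>q\<in>monomials h p. p_C_exists L q \<longrightarrow>
      (\<forall>w\<in>CIW2 q. convergent (p_CI_seq L q w) \<and> p_CI L q w = p_C L (psi q) w) \<and>
      (mu_hat M L X q \<longlonglongrightarrow> alpha L q) \<and>
      (if even (length q) \<and> (\<forall>j\<in>{1..h}. \<forall>i\<in>{1..p j}. even (count_list q (j, i)))
       then \<bar>alpha L q\<bar> \<le> fact (length q) * \<Delta> ^ (length q div 2)
              / (fact (length q div 2) * 2 ^ (length q div 2))
       else alpha L q = 0) \<and>
      (AE \<omega> in M. (\<lambda>n. mu_tilde L X q n \<omega>) \<longlonglongrightarrow> alpha L q))
    \<and> ((\<forall>q\<in>monomials h p. p_C_exists L q) \<longrightarrow>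
      (\<exists>a. converges_jointly_phi1_as M h p L X a \<and> converges_jointly_phi2 M h p L X a \<and>
         (\<forall>(M' :: 'b measure) X'. prob_space M' \<and> assumption_A2 M' h p d L X' \<longrightarrow>
            converges_jointly_phi1_as M' h p L X' a \<and> converges_jointly_phi2 M' h p L X' a)))"
proof (intro conjI ballI impI)
  fix q assume q: "q \<in> monomials h p" and ex: "p_C_exists L q"
  note assms' = assms(1,3,4)
  show "convergent (p_CI_seq L q w)" "p_CI L q w = p_C L (psi q) w" if "w \<in> CIW2 q" for w
    using p_CI_seq_tendsto[OF ex that] by (auto simp: convergent_def)
  show "mu_hat M L X q \<longlonglongrightarrow> alpha L q" "AE \<omega> in M. (\<lambda>n. mu_tilde L X q n \<omega>) \<longlonglongrightarrow> alpha L q"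
    using moment_limits[OF assms' assms(5,6) q ex] by blast+
  show "if even (length q) \<and> (\<forall>j\<in>{1..h}. \<forall>i\<in>{1..p j}. even (count_list q (j, i)))
       then \<bar>alpha L q\<bar> \<le> fact (length q) * \<Delta> ^ (length q div 2)
              / (fact (length q div 2) * 2 ^ (length q div 2))
       else alpha L q = 0"
    using assms' q ex by (rule alpha_bound)
next
  assume ex: "\<forall>q\<in>monomials h p. p_C_exists L q"
  note joint = converges_jointly[OF assms(1,3,4) _ _ ex]
  show "\<exists>a. converges_jointly_phi1_as M h p L X a \<and> converges_jointly_phi2 M h p L X a \<and>
         (\<forall>(M' :: 'b measure) X'. prob_space M' \<and> assumption_A2 M' h p d L X' \<longrightarrow>
            converges_jointly_phi1_as M' h p L X' a \<and> converges_jointly_phi2 M' h p L X' a)"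
  \<comment> \<open>\<open>alpha L\<close> is built from the link functions alone, so one witness
    serves every input sequence; \<open>joint\<close> leaves the measure and the type of its space
    open.\<close>
  proof (intro exI[of _ "alpha L"] conjI allI impI)
    show "converges_jointly_phi1_as M h p L X (alpha L)" "converges_jointly_phi2 M h p L X (alpha L)"
      using assms(5,6) by (rule joint)+
    fix M' :: "'b measure" and X'
    assume "prob_space M' \<and> assumption_A2 M' h p d L X'"
    then show "converges_jointly_phi1_as M' h p L X' (alpha L)" "converges_jointly_phi2 M' h p L X' (alpha L)"
      by (auto intro: joint)
  qed
qed

end
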